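(* Let $(C,d)$ be an equitising $\zeta$-regular ultrametric Cantor set whose Connes measure $\mu_\tau$ has support $C$ and is an equity measure, and let $s\in\mathbb{R}$. The Vladimirov-Pearson operator $\mathcal{D}^s$ generates (in the sense that $-\mathcal{D}^s$ is the infinitesimal generator) a strongly continuous semigroup $e^{-t\mathcal{D}^s}$, $t\ge0$, on the Sobolev space $W^{1,2}(C)$, which satisfies the Markov property.
   Context: A Cantor set is a totally disconnected compact metrisable space without isolated points. A regular ultrametric Cantor set $(C,d)$ is a Cantor set $C$ with an ultrametric $d$ generating its topology. Its Michon tree $T(C)$ is the rooted tree whose vertices $v\in V$ are in bijection with the balls (discs) $[v]\subseteq C$ for $d$; the root is $C$, and the children of $v$ are the maximal balls properly contained in $[v]$ (finitely many, at least two). $\mathcal{D}(C)$ is the space of test functions, i.e. locally constant functions $C\to\mathbb{C}$. $(C,d)$ is equitising if all children $u$ of any given vertex have the same $\operatorname{diam}([u])$. Dirac operator and zeta function. On $\mathcal{H}=\ell^2(V)\otimes\mathbb{C}^2$ put $D\psi(v)=\operatorname{diam}([v])^{-1}\sigma_1\psi(v)$ with $\sigma_1=\begin{pmatrix}0&1\\1&0\end{pmatrix}$, so $|D|\psi(v)=\operatorname{diam}([v])^{-1}\psi(v)$, and $\zeta(s)=\frac12\operatorname{Tr}(|D|^{-s})=\sum_{v\in V}\operatorname{diam}([v])^s$. A choice function is a map $\tau=(\tau_+,\tau_-):V\to C\times C$ with $\tau(v)\in[v]\times[v]$ and $d(\tau_+(v),\tau_-(v))=\operatorname{diam}([v])$;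 the set of choice functions is $\Upsilon(C)$. For $f$ continuous on $C$, $\pi_\tau(f)\psi(v)=\operatorname{diag}(f(\tau_+(v)),f(\tau_-(v)))\psi(v)$. $(C,d)$ is $\zeta$-regular if $\zeta(s)$ has an abscissa of convergence $s_0\in\mathbb{R}$ (converges for $\Re(s)>s_0$) and $\lim_{s\downarrow s_0}(s-s_0)\operatorname{Tr}(|D|^{-s}\pi_\tau(f))$ exists for all continuous $f$ and all $\tau\in\Upsilon(C)$. Connes measure. For $\zeta$-regular $(C,d)$, the Connes measure $\mu_\tau$ is the Borel probability measure on $C$ (independent of $\tau$) given by $\int_C f\,d\mu_\tau=\lim_{s\downarrow s_0}\operatorname{Tr}(|D|^{-s}\pi_\tau(f))/\operatorname{Tr}(|D|^{-s})$ for continuous $f$. It is an equity measure if for every vertex $v_0$ the value $\mu_\tau([v])$ is the same for all children $v$ of $v_0$. Vladimirov-Pearson operator. Assume $\operatorname{supp}\mu_\tau=C$. Identify $\Upsilon(C)=\prod_{v\in V}\Upsilon_v$ with $\Upsilon_v=\{(x,y)\in[v]^2: d(x,y)=\operatorname{diam}([v])\}$, and let $\nu$ be the product of the probability measures obtained by normalising the restriction of $\mu_\tau\times\mu_\tau$ to $\Upsilon_v$. For $s\in\mathbb{R}$ and $f,g\in\mathcal{D}(C)$ let \[Q_s(f,g)=\tfrac12\int_{\Upsilon(C)}\operatorname{Tr}\{|D|^{-s}[D,\pi_\tau(f)]^*[D,\pi_\tau(g)]\}\,d\nu(\tau),\] a closable Dirichlet form on $L^2(C,\mu_\tau)$, and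 let $\Delta_s$ be the associated self-adjoint non-positive operator, $\langle-\Delta_sf,g\rangle=Q_s(f,g)$ in $L^2(C,\mu_\tau)$. The Vladimirov-Pearson operator is \[\mathcal{D}^sf(z)=\tfrac12\lim_{v\to z}\mu_\tau([v])^{-1}\langle 1_{[v]},-\Delta_sf\rangle,\quad f\in\mathcal{D}(C),\] where $v\to z$ means that $[v]$ runs through the discs containing $z$, shrinking to $\{z\}$. As an operator on $L^2(C,\mu_\tau)$, $\mathcal{D}^s$ is understood as the closure of this operator with initial domain $\mathcal{D}(C)$. Sobolev space. For fixed $s\in\mathbb{R}$, $W^{1,2}(C)=\{f\in L^2(C,\mu_\tau):\|\mathcal{D}^sf\|_{L^2(C,\mu_\tau)}<\infty\}$, i.e. the domain of $\mathcal{D}^s$ on $L^2(C,\mu_\tau)$, with norm $\|f\|_{W^{1,2}(C)}=\left(\|f\|_{L^2(C,\mu_\tau)}^2+\|\mathcal{D}^sf\|_{L^2(C,\mu_\tau)}^2\right)^{1/2}$. Markov property: for all $t\ge0$ and $f\in W^{1,2}(C)$, $f\ge0$ a.e. implies $e^{-t\mathcal{D}^s}f\ge0$ a.e.; $f\le1$ a.e. implies $e^{-t\mathcal{D}^s}f\le1$ a.e.; and $e^{-t\mathcal{D}^s}1_C=1_C$. *)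

theory Defs
  imports "HOL-Probability.Probability"
begin

text \<open>
  The space \<open>(C, d)\<close> is the whole type \<open>'a :: metric_space\<close> with \<open>dist\<close> as \<open>d\<close>.
  Properties of \<open>(C, d)\<close> alone take the argument \<open>TYPE('a)\<close>.
\<close>

section \<open>Ultrametric Cantor sets and the Michon tree\<close>

definition cantor_set :: "'a::topological_space set \<Rightarrow> bool" where
  "cantor_set S \<longleftrightarrow> compact S \<and> S \<noteq> {} \<and>
     (\<forall>x\<in>S. connected_component_set S x = {x}) \<and> (\<forall>x\<in>S. x islimpt S)"

definition ultrametric_cantor_set :: "'a::metric_space itself \<Rightarrow> bool" where
  "ultrametric_cantor_set _ \<longleftrightarrow> cantor_set (UNIV :: 'a set) \<and>
     (\<forall>x y z :: 'a. dist x z \<le> max (dist x y) (dist y z))"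

text \<open>
  A vertex \<open>v\<close> is identified with its disc \<open>[v]\<close>. In a compact ultrametric space the closed
  discs of positive radius are exactly the open ones.
\<close>

definition vertices :: "'a::metric_space set set" where
  "vertices = {ball x r | x r. r > 0}"

definition children :: "'a::metric_space set \<Rightarrow> 'a set set" where
  "children v = {u \<in> vertices. u \<subset> v \<and> \<not> (\<exists>w\<in>vertices. u \<subset> w \<and> w \<subset> v)}"

definition equitising :: "'a::metric_space itself \<Rightarrow> bool" where
  "equitising _ \<longleftrightarrow>
     (\<forall>v\<in>(vertices :: 'a set set). \<forall>u\<in>children v. \<forall>u'\<in>children v. diameter u = diameter u')"

definition test_functions :: "('a::metric_space \<Rightarrow> complex) set" where
  "test_functions = {f. \<forall>x. \<exists>U. open U \<and> x \<in> U \<and> f constant_on U}"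

definition choices :: "'a::metric_space set \<Rightarrow> ('a \<times> 'a) set" where
  "choices v = {(x, y). x \<in> v \<and> y \<in> v \<and> dist x y = diameter v}"

definition choice_functions :: "('a::metric_space set \<Rightarrow> 'a \<times> 'a) set" where
  "choice_functions = (\<Pi>\<^sub>E v\<in>vertices. choices v)"

section \<open>The spectral triple\<close>

text \<open>
  All operators on \<open>\<ell>\<^sup>2(V) \<otimes> \<complex>\<^sup>2 = \<ell>\<^sup>2(V; \<complex>\<^sup>2)\<close> that occur act fibrewise, \<open>\<psi>(v) \<mapsto> A(v) \<psi>(v)\<close>.
  They are represented by the field \<open>A\<close> of 2x2 matrices over the vertices; products and adjoints
  are then fibrewise, and the trace is the sum over the vertices of the traces of the fibres.
\<close>

type_synonym 'a fibre_op = "'a set \<Rightarrow> complex^2^2"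

definition op_mult :: "'a fibre_op \<Rightarrow> 'a fibre_op \<Rightarrow> 'a fibre_op" where
  "op_mult A B = (\<lambda>v. A v ** B v)"

definition op_commutator :: "'a fibre_op \<Rightarrow> 'a fibre_op \<Rightarrow> 'a fibre_op" where
  "op_commutator A B = (\<lambda>v. A v ** B v - B v ** A v)"

definition op_adjoint :: "'a fibre_op \<Rightarrow> 'a fibre_op" where
  "op_adjoint A = (\<lambda>v. \<chi> i j. cnj (A v $ j $ i))"

definition op_trace :: "'a::metric_space fibre_op \<Rightarrow> complex" where
  "op_trace A = (\<Sum>\<^sub>\<infinity>v\<in>vertices. trace (A v))"

definition sigma1 :: "complex^2^2" where
  "sigma1 = vector [vector [0, 1], vector [1, 0]]"

definition dirac :: "'a::metric_space fibre_op" where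
  "dirac v = (1 / diameter v) *\<^sub>R sigma1"

text \<open>\<open>abs_dirac_powr z\<close> is \<open>|D|\<^sup>z\<close>, where \<open>|D|\<close> is multiplication by \<open>1 / diam [v]\<close>.\<close>

definition abs_dirac_powr :: "complex \<Rightarrow> 'a::metric_space fibre_op" where
  "abs_dirac_powr z v = mat (of_real (1 / diameter v) powr z)"

definition rep :: "('a set \<Rightarrow> 'a \<times> 'a) \<Rightarrow> ('a \<Rightarrow> complex) \<Rightarrow> 'a fibre_op" where
  "rep \<tau> f v = vector [vector [f (fst (\<tau> v)), 0], vector [0, f (snd (\<tau> v))]]"

text \<open>
  The terms of \<open>\<zeta>(z) = \<onehalf> Tr(|D|\<^sup>-\<^sup>z) = \<Sum>\<^sub>v diam([v])\<^sup>z\<close> are the halved traces of the fibres.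
\<close>

definition zeta_converges :: "'a::metric_space itself \<Rightarrow> complex \<Rightarrow> bool" where
  "zeta_converges _ z \<longleftrightarrow>
     (\<lambda>v :: 'a set. trace (abs_dirac_powr (- z) v) / 2) summable_on vertices"

definition zeta_abscissa :: "'a::metric_space itself \<Rightarrow> real \<Rightarrow> bool" where
  "zeta_abscissa T s\<^sub>0 \<longleftrightarrow>
     (\<forall>z. Re z > s\<^sub>0 \<longrightarrow> zeta_converges T z) \<and> (\<forall>z. Re z < s\<^sub>0 \<longrightarrow> \<not> zeta_converges T z)"

definition zeta_regular :: "'a::metric_space itself \<Rightarrow> bool" where
  "zeta_regular T \<longleftrightarrow> (\<exists>s\<^sub>0. zeta_abscissa T s\<^sub>0 \<and>
     (\<forall>f :: 'a \<Rightarrow> complex. \<forall>\<tau>\<in>choice_functions. continuous_on UNIV f \<longrightarrow>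
        (\<exists>L. ((\<lambda>t. of_real (t - s\<^sub>0) *
                 op_trace (op_mult (abs_dirac_powr (- of_real t)) (rep \<tau> f)))
              \<longlongrightarrow> L) (at_right s\<^sub>0))))"

section \<open>The Connes measure\<close>

definition connes_measure ::
    "('a::metric_space set \<Rightarrow> 'a \<times> 'a) \<Rightarrow> 'a measure \<Rightarrow> bool" where
  "connes_measure \<tau> \<mu> \<longleftrightarrow> prob_space \<mu> \<and> sets \<mu> = sets borel \<and>
     (\<exists>s\<^sub>0. zeta_abscissa TYPE('a) s\<^sub>0 \<and>
       (\<forall>f. continuous_on UNIV f \<longrightarrow>
          ((\<lambda>t. op_trace (op_mult (abs_dirac_powr (- of_real t)) (rep \<tau> f)) /
                op_trace (abs_dirac_powr (- of_real t) :: 'a fibre_op))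
             \<longlongrightarrow> (LINT x|\<mu>. f x)) (at_right s\<^sub>0)))"

definition supp :: "'a::topological_space measure \<Rightarrow> 'a set" where
  "supp \<mu> = {x. \<forall>U. open U \<and> x \<in> U \<longrightarrow> emeasure \<mu> U > 0}"

definition equity_measure :: "'a::metric_space measure \<Rightarrow> bool" where
  "equity_measure \<mu> \<longleftrightarrow>
     (\<forall>v\<in>vertices. \<forall>u\<in>children v. \<forall>u'\<in>children v. measure \<mu> u = measure \<mu> u')"

definition choice_measure :: "'a::metric_space measure \<Rightarrow> ('a set \<Rightarrow> 'a \<times> 'a) measure" where
  "choice_measure \<mu> = (\<Pi>\<^sub>M v\<in>vertices.
     scale_measure (1 / emeasure (\<mu> \<Otimes>\<^sub>M \<mu>) (choices v)) (restrict_space (\<mu> \<Otimes>\<^sub>M \<mu>) (choices v)))"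

section \<open>The Hilbert space of square-integrable functions\<close>

text \<open>
  Elements of \<open>L\<^sup>2(C, \<mu>)\<close> are represented by functions, equality being equality almost everywhere.
  The inner product is antilinear in its first argument, as is the form \<open>Q\<^sub>s\<close>.
\<close>

definition L2 :: "'a measure \<Rightarrow> ('a \<Rightarrow> complex) set" where
  "L2 \<mu> = {f \<in> borel_measurable \<mu>. integrable \<mu> (\<lambda>x. (norm (f x))\<^sup>2)}"

definition L2_inner :: "'a measure \<Rightarrow> ('a \<Rightarrow> complex) \<Rightarrow> ('a \<Rightarrow> complex) \<Rightarrow> complex" where
  "L2_inner \<mu> f g = (LINT x|\<mu>. cnj (f x) * g x)"

definition L2_norm :: "'a measure \<Rightarrow> ('a \<Rightarrow> complex) \<Rightarrow> real" where
  "L2_norm \<mu> f = sqrt (LINT x|\<mu>. (norm (f x))\<^sup>2)"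

section \<open>The Dirichlet form and its self-adjoint operator\<close>

definition form_Q ::
    "real \<Rightarrow> 'a::metric_space measure \<Rightarrow> ('a \<Rightarrow> complex) \<Rightarrow> ('a \<Rightarrow> complex) \<Rightarrow> complex" where
  "form_Q s \<mu> f g = 1 / 2 * (LINT \<tau>|choice_measure \<mu>.
     op_trace (op_mult (abs_dirac_powr (- of_real s))
       (op_mult (op_adjoint (op_commutator dirac (rep \<tau> f))) (op_commutator dirac (rep \<tau> g)))))"

text \<open>\<open>form_approx s \<mu> \<phi> f\<close>: \<open>\<phi>\<close> is a sequence of test functions that is Cauchy for \<open>Q\<^sub>s\<close> and
  converges to \<open>f\<close> in \<open>L\<^sup>2\<close>, so that it witnesses membership of \<open>f\<close> in the domain of the closure
  of \<open>Q\<^sub>s\<close>.\<close>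

definition form_approx ::
    "real \<Rightarrow> 'a::metric_space measure \<Rightarrow> (nat \<Rightarrow> 'a \<Rightarrow> complex) \<Rightarrow> ('a \<Rightarrow> complex) \<Rightarrow> bool" where
  "form_approx s \<mu> \<phi> f \<longleftrightarrow> (\<forall>n. \<phi> n \<in> test_functions) \<and>
     (\<forall>e>0. \<exists>N. \<forall>m\<ge>N. \<forall>n\<ge>N.
        norm (form_Q s \<mu> (\<lambda>x. \<phi> m x - \<phi> n x) (\<lambda>x. \<phi> m x - \<phi> n x)) < e) \<and>
     (\<lambda>n. L2_norm \<mu> (\<lambda>x. \<phi> n x - f x)) \<longlonglongrightarrow> 0"

definition form_domain :: "real \<Rightarrow> 'a::metric_space measure \<Rightarrow> ('a \<Rightarrow> complex) set" where
  "form_domain s \<mu> = {f \<in> L2 \<mu>. \<exists>\<phi>. form_approx s \<mu> \<phi> f}"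

definition form_closure ::
    "real \<Rightarrow> 'a::metric_space measure \<Rightarrow> ('a \<Rightarrow> complex) \<Rightarrow> ('a \<Rightarrow> complex) \<Rightarrow> complex" where
  "form_closure s \<mu> f g = (THE c. \<forall>\<phi> \<gamma>. form_approx s \<mu> \<phi> f \<longrightarrow> form_approx s \<mu> \<gamma> g \<longrightarrow>
     (\<lambda>n. form_Q s \<mu> (\<phi> n) (\<gamma> n)) \<longlonglongrightarrow> c)"

definition laplacian_graph ::
    "real \<Rightarrow> 'a::metric_space measure \<Rightarrow> (('a \<Rightarrow> complex) \<times> ('a \<Rightarrow> complex)) set" where
  "laplacian_graph s \<mu> = {(f, h). f \<in> form_domain s \<mu> \<and> h \<in> L2 \<mu> \<and>
     (\<forall>g\<in>form_domain s \<mu>. L2_inner \<mu> (\<lambda>x. - h x) g = form_closure s \<mu> f g)}"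

definition laplacian ::
    "real \<Rightarrow> 'a::metric_space measure \<Rightarrow> ('a \<Rightarrow> complex) \<Rightarrow> 'a \<Rightarrow> complex" where
  "laplacian s \<mu> f = (SOME h. (f, h) \<in> laplacian_graph s \<mu>)"

section \<open>The Vladimirov-Pearson operator and its Sobolev space\<close>

text \<open>The filter \<open>v \<rightarrow> z\<close>: discs containing \<open>z\<close> and shrinking to \<open>{z}\<close>.\<close>

definition discs_shrinking_to :: "'a::metric_space \<Rightarrow> 'a set filter" where
  "discs_shrinking_to z = (INF r\<in>{0<..}. principal {v \<in> vertices. z \<in> v \<and> diameter v < r})"

definition vp_test ::
    "real \<Rightarrow> 'a::metric_space measure \<Rightarrow> ('a \<Rightarrow> complex) \<Rightarrow> 'a \<Rightarrow> complex" where
  "vp_test s \<mu> f z = 1 / 2 * Lim (discs_shrinking_to z)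
     (\<lambda>v. L2_inner \<mu> (indicator v) (\<lambda>x. - laplacian s \<mu> f x) / of_real (measure \<mu> v))"

text \<open>The graph of the closure in \<open>L\<^sup>2(C, \<mu>)\<close> of \<open>vp_test\<close> on the test functions.\<close>

definition vp_graph ::
    "real \<Rightarrow> 'a::metric_space measure \<Rightarrow> (('a \<Rightarrow> complex) \<times> ('a \<Rightarrow> complex)) set" where
  "vp_graph s \<mu> = {(f, g). f \<in> L2 \<mu> \<and> g \<in> L2 \<mu> \<and>
     (\<exists>\<phi>. (\<forall>n. \<phi> n \<in> test_functions) \<and>
        (\<lambda>n. L2_norm \<mu> (\<lambda>x. \<phi> n x - f x)) \<longlonglongrightarrow> 0 \<and>
        (\<lambda>n. L2_norm \<mu> (\<lambda>x. vp_test s \<mu> (\<phi> n) x - g x)) \<longlonglongrightarrow> 0)}"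

definition vp_operator ::
    "real \<Rightarrow> 'a::metric_space measure \<Rightarrow> ('a \<Rightarrow> complex) \<Rightarrow> 'a \<Rightarrow> complex" where
  "vp_operator s \<mu> f = (SOME g. (f, g) \<in> vp_graph s \<mu>)"

definition sobolev :: "real \<Rightarrow> 'a::metric_space measure \<Rightarrow> ('a \<Rightarrow> complex) set" where
  "sobolev s \<mu> = {f. \<exists>g. (f, g) \<in> vp_graph s \<mu>}"

definition sobolev_norm :: "real \<Rightarrow> 'a::metric_space measure \<Rightarrow> ('a \<Rightarrow> complex) \<Rightarrow> real" where
  "sobolev_norm s \<mu> f = sqrt ((L2_norm \<mu> f)\<^sup>2 + (L2_norm \<mu> (vp_operator s \<mu> f))\<^sup>2)"

section \<open>Operator semigroups\<close>

text \<open>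
  Here \<open>W\<close> is a space of functions taken modulo equality almost everywhere with respect to \<open>\<mu>\<close>,
  and \<open>N\<close> is its norm.
\<close>

definition strongly_continuous_semigroup ::
    "'a measure \<Rightarrow> ('a \<Rightarrow> complex) set \<Rightarrow> (('a \<Rightarrow> complex) \<Rightarrow> real) \<Rightarrow>
     (real \<Rightarrow> ('a \<Rightarrow> complex) \<Rightarrow> 'a \<Rightarrow> complex) \<Rightarrow> bool" where
  "strongly_continuous_semigroup \<mu> W N T \<longleftrightarrow>
     (\<forall>t\<ge>0. \<forall>f\<in>W. T t f \<in> W) \<and>
     (\<forall>t\<ge>0. \<forall>f\<in>W. \<forall>g\<in>W. (AE x in \<mu>. f x = g x) \<longrightarrow> (AE x in \<mu>. T t f x = T t g x)) \<and>
     (\<forall>t\<ge>0. \<forall>f\<in>W. \<forall>g\<in>W. \<forall>a b.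
        AE x in \<mu>. T t (\<lambda>y. a * f y + b * g y) x = a * T t f x + b * T t g x) \<and>
     (\<forall>t\<ge>0. \<exists>K. \<forall>f\<in>W. N (T t f) \<le> K * N f) \<and>
     (\<forall>f\<in>W. AE x in \<mu>. T 0 f x = f x) \<and>
     (\<forall>t\<ge>0. \<forall>r\<ge>0. \<forall>f\<in>W. AE x in \<mu>. T (t + r) f x = T t (T r f) x) \<and>
     (\<forall>f\<in>W. ((\<lambda>t. N (\<lambda>x. T t f x - f x)) \<longlongrightarrow> 0) (at_right 0))"

text \<open>The graph of the infinitesimal generator on its maximal domain.\<close>

definition infinitesimal_generator ::
    "('a \<Rightarrow> complex) set \<Rightarrow> (('a \<Rightarrow> complex) \<Rightarrow> real) \<Rightarrow>
     (real \<Rightarrow> ('a \<Rightarrow> complex) \<Rightarrow> 'a \<Rightarrow> complex) \<Rightarrow> (('a \<Rightarrow> complex) \<times> ('a \<Rightarrow> complex)) set" where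
  "infinitesimal_generator W N T = {(f, g). f \<in> W \<and> g \<in> W \<and>
     ((\<lambda>t. N (\<lambda>x. (T t f x - f x) / of_real t - g x)) \<longlongrightarrow> 0) (at_right 0)}"

text \<open>
  The order on \<^typ>\<open>complex\<close> is the one with \<open>z \<le> w\<close> iff \<open>w - z\<close> is a nonnegative real,
  so the hypotheses below force \<open>f\<close> to be real almost everywhere.
\<close>

definition markov_property ::
    "'a measure \<Rightarrow> ('a \<Rightarrow> complex) set \<Rightarrow> (real \<Rightarrow> ('a \<Rightarrow> complex) \<Rightarrow> 'a \<Rightarrow> complex) \<Rightarrow> bool" where
  "markov_property \<mu> W T \<longleftrightarrow> (\<forall>t\<ge>0.
     (\<forall>f\<in>W. (AE x in \<mu>. 0 \<le> f x) \<longrightarrow> (AE x in \<mu>. 0 \<le> T t f x)) \<and>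
     (\<forall>f\<in>W. (AE x in \<mu>. f x \<le> 1) \<longrightarrow> (AE x in \<mu>. T t f x \<le> 1)) \<and>
     (AE x in \<mu>. T t (\<lambda>_. 1) x = 1))"

end

theory Submission
  imports Defs
begin

text \<open>
  The operator \<open>D\<^sup>s\<close> is diagonal in the wavelets of the Michon tree.  For a ball \<open>v\<close> let the
  component of \<open>f\<close> at \<open>v\<close> be the function on \<open>v\<close> whose value on each child is the average of \<open>f\<close>
  over that child minus the average over \<open>v\<close>.  These components and the mean of \<open>f\<close> are mutually
  orthogonal; those of the balls of diameter at least \<open>e\<close> telescope to the average of \<open>f\<close> over the
  ball of radius \<open>e\<close> around each point (\<open>avg_ball_eq_sum\<close>), and all of them together sum to \<open>f\<close> in
  \<open>L\<^sup>2\<close> (\<open>synth_tendsto\<close>).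

  Integrating out the choice function turns \<open>Q\<^sub>s(f, g)\<close> into a sum over the vertices \<open>v\<close> of weighted
  double integrals of the increments of \<open>f\<close> and \<open>g\<close> between different children of \<open>v\<close>.  The operator
  that belongs to one such \<open>v\<close> multiplies the component at \<open>w\<close> by a nonnegative number, which is \<open>0\<close>
  unless \<open>v\<close> contains \<open>w\<close> (\<open>jump_component\<close>).  Summing over the finitely many ancestors of \<open>w\<close>
  gives the eigenvalues \<open>\<lambda>(w)\<close> and the identity \<open>Q\<^sub>s(f, g) = 2 \<langle>D f, g\<rangle>\<close> on test functions, where
  \<open>D\<close> multiplies each component by its eigenvalue.  A form that is given by an operator is closable,
  so that \<open>- \<Delta>\<^sub>s\<close> is \<open>2 D\<close> and \<open>D\<^sup>s\<close> is \<open>D\<close> on test functions; the closure of the latter is the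
  multiplier \<open>\<lambda>\<close> on its maximal domain (\<open>vp_graph_eq\<close>).

  The semigroup is the multiplier \<open>exp (- t \<lambda>)\<close>, which exists by the Riesz--Fischer theorem.  Since
  the Sobolev norm of \<open>f\<close> is made of the \<open>L\<^sup>2\<close> norms of \<open>f\<close> and \<open>D f\<close>, and multipliers commute, the
  semigroup laws, strong continuity and the generator reduce to statements about the scalars
  \<open>exp (- t \<lambda>)\<close> together with dominated convergence (\<open>multiplier_tendsto_0\<close>).

  The eigenvalues need not increase along the branches of the tree, so positivity cannot be read
  off the series.  It comes from the form: truncating a function does not increase the size of its
  increments nor change their sign, so by the argument of Beurling and Deny the resolvents
  \<open>(1 + h D)\<^sup>-\<^sup>1\<close> preserve positivity (\<open>resolvent_pos\<close>).  Euler's formula carries this over to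
  \<open>exp (- t D)\<close> on functions that are constant on the balls of a fixed radius, and averaging
  over smaller and smaller balls to all of \<open>L\<^sup>2\<close>.
\<close>

section \<open>The seminormed space of square-integrable functions\<close>

lemma L2_measurable: "f \<in> L2 \<mu> \<Longrightarrow> f \<in> borel_measurable \<mu>"
  by (simp add: L2_def)

lemma L2_integrable_sq: "f \<in> L2 \<mu> \<Longrightarrow> integrable \<mu> (\<lambda>x. (norm (f x))\<^sup>2)"
  by (simp add: L2_def)

lemma L2_norm_nonneg [simp]: "L2_norm \<mu> f \<ge> 0"
  by (simp add: L2_norm_def)

lemma L2_norm_sq: "(L2_norm \<mu> f)\<^sup>2 = (LINT x|\<mu>. (norm (f x))\<^sup>2)"
  by (simp add: L2_norm_def)

lemma L2_norm_cong_AE: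
  assumes "f \<in> borel_measurable \<mu>" "g \<in> borel_measurable \<mu>" "AE x in \<mu>. f x = g x"
  shows "L2_norm \<mu> f = L2_norm \<mu> g"
  unfolding L2_norm_def
  by (rule arg_cong[where f = sqrt], rule integral_cong_AE) (use assms in auto)

lemma borel_measurable_cnj [measurable (raw)]:
  "f \<in> borel_measurable M \<Longrightarrow> (\<lambda>x. cnj (f x)) \<in> borel_measurable M"
  by (rule borel_measurable_continuous_on[of cnj]) (intro continuous_intros)

lemma integrable_L2_inner:
  assumes "f \<in> L2 \<mu>" "g \<in> L2 \<mu>"
  shows "integrable \<mu> (\<lambda>x. cnj (f x) * g x)"
proof (rule Bochner_Integration.integrable_bound)
  show "integrable \<mu> (\<lambda>x. (norm (f x))\<^sup>2 + (norm (g x))\<^sup>2)"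
    using assms by (intro Bochner_Integration.integrable_add L2_integrable_sq)
  show "(\<lambda>x. cnj (f x) * g x) \<in> borel_measurable \<mu>"
    using assms[THEN L2_measurable] by (intro borel_measurable_times borel_measurable_cnj)
  have "norm (cnj (f x) * g x) \<le> norm ((norm (f x))\<^sup>2 + (norm (g x))\<^sup>2)" for x
  proof -
    have "0 \<le> (norm (f x) - norm (g x))\<^sup>2 + (norm (f x))\<^sup>2 + (norm (g x))\<^sup>2" by simp
    then show ?thesis by (simp add: norm_mult power2_diff)
  qed
  then show "AE x in \<mu>. norm (cnj (f x) * g x) \<le> norm ((norm (f x))\<^sup>2 + (norm (g x))\<^sup>2)" by simp
qed

lemma L2_norm_sq_inner: "L2_inner \<mu> f f = of_real ((L2_norm \<mu> f)\<^sup>2)"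
  unfolding L2_inner_def L2_norm_sq
  by (simp add: complex_norm_square mult.commute del: of_real_power flip: integral_complex_of_real)

lemma L2_add:
  assumes "f \<in> L2 \<mu>" "g \<in> L2 \<mu>"
  shows "(\<lambda>x. f x + g x) \<in> L2 \<mu>"
proof -
  have "integrable \<mu> (\<lambda>x. (norm (f x + g x))\<^sup>2)"
  proof (rule Bochner_Integration.integrable_bound)
    show "integrable \<mu> (\<lambda>x. 2 * (norm (f x))\<^sup>2 + 2 * (norm (g x))\<^sup>2)"
      using assms by (intro Bochner_Integration.integrable_add integrable_mult_right L2_integrable_sq)
    show "(\<lambda>x. (norm (f x + g x))\<^sup>2) \<in> borel_measurable \<mu>"
      using assms[THEN L2_measurable] by measurable
    have "norm ((norm (f x + g x))\<^sup>2) \<le> norm (2 * (norm (f x))\<^sup>2 + 2 * (norm (g x))\<^sup>2)" for x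
    proof -
      have "(norm (f x + g x))\<^sup>2 \<le> (norm (f x) + norm (g x))\<^sup>2"
        by (intro power_mono norm_triangle_ineq) simp
      moreover have "0 \<le> (norm (f x) - norm (g x))\<^sup>2" by simp
      ultimately show ?thesis by (simp add: power2_sum power2_diff)
    qed
    then show "AE x in \<mu>. norm ((norm (f x + g x))\<^sup>2) \<le> norm (2 * (norm (f x))\<^sup>2 + 2 * (norm (g x))\<^sup>2)"
      by simp
  qed
  then show ?thesis using assms[THEN L2_measurable] by (simp add: L2_def)
qed

lemma L2_cmult: "f \<in> L2 \<mu> \<Longrightarrow> (\<lambda>x. c * f x) \<in> L2 \<mu>"
  by (auto simp: L2_def norm_mult power_mult_distrib intro: borel_measurable_times)

lemma L2_scaleR: "f \<in> L2 \<mu> \<Longrightarrow> (\<lambda>x. r *\<^sub>R f x) \<in> L2 \<mu>"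
  by (simp add: scaleR_conv_of_real L2_cmult)

lemma L2_uminus: "f \<in> L2 \<mu> \<Longrightarrow> (\<lambda>x. - f x) \<in> L2 \<mu>"
  using L2_cmult[of f \<mu> "-1"] by simp

lemma L2_diff: "f \<in> L2 \<mu> \<Longrightarrow> g \<in> L2 \<mu> \<Longrightarrow> (\<lambda>x. f x - g x) \<in> L2 \<mu>"
  using L2_add[OF _ L2_uminus, of f \<mu> g] by simp

lemma L2_zero: "(\<lambda>x. 0) \<in> L2 \<mu>"
  by (simp add: L2_def)

lemma L2_inner_add_right:
  "f \<in> L2 \<mu> \<Longrightarrow> g \<in> L2 \<mu> \<Longrightarrow> h \<in> L2 \<mu> \<Longrightarrow>
    L2_inner \<mu> f (\<lambda>x. g x + h x) = L2_inner \<mu> f g + L2_inner \<mu> f h"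
  by (simp add: L2_inner_def distrib_left integrable_L2_inner)

lemma L2_inner_diff_right:
  "f \<in> L2 \<mu> \<Longrightarrow> g \<in> L2 \<mu> \<Longrightarrow> h \<in> L2 \<mu> \<Longrightarrow>
    L2_inner \<mu> f (\<lambda>x. g x - h x) = L2_inner \<mu> f g - L2_inner \<mu> f h"
  by (simp add: L2_inner_def right_diff_distrib integrable_L2_inner)

lemma L2_inner_add_left:
  "f \<in> L2 \<mu> \<Longrightarrow> g \<in> L2 \<mu> \<Longrightarrow> h \<in> L2 \<mu> \<Longrightarrow>
    L2_inner \<mu> (\<lambda>x. f x + g x) h = L2_inner \<mu> f h + L2_inner \<mu> g h"
  by (simp add: L2_inner_def distrib_right integrable_L2_inner)

lemma L2_inner_diff_left:
  "f \<in> L2 \<mu> \<Longrightarrow> g \<in> L2 \<mu> \<Longrightarrow> h \<in> L2 \<mu> \<Longrightarrow>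
    L2_inner \<mu> (\<lambda>x. f x - g x) h = L2_inner \<mu> f h - L2_inner \<mu> g h"
  by (simp add: L2_inner_def left_diff_distrib integrable_L2_inner)

lemma L2_inner_cmult_right: "L2_inner \<mu> f (\<lambda>x. c * g x) = c * L2_inner \<mu> f g"
  by (simp add: L2_inner_def mult.left_commute[of _ c])

lemma L2_inner_scaleR_left: "L2_inner \<mu> (\<lambda>x. r *\<^sub>R f x) g = r *\<^sub>R L2_inner \<mu> f g"
  by (simp add: L2_inner_def)

lemma L2_inner_sum_left:
  "(\<And>i. i \<in> I \<Longrightarrow> f i \<in> L2 \<mu>) \<Longrightarrow> g \<in> L2 \<mu> \<Longrightarrow>
    L2_inner \<mu> (\<lambda>x. \<Sum>i\<in>I. f i x) g = (\<Sum>i\<in>I. L2_inner \<mu> (f i) g)"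
  by (simp add: L2_inner_def sum_distrib_right integrable_L2_inner)

lemma cnj_L2_inner: "cnj (L2_inner \<mu> f g) = L2_inner \<mu> g f"
  unfolding L2_inner_def Bochner_Integration.integral_cnj[symmetric]
  by (rule Bochner_Integration.integral_cong) (simp_all add: mult.commute)

lemma L2_norm_minus_commute: "L2_norm \<mu> (\<lambda>x. f x - g x) = L2_norm \<mu> (\<lambda>x. g x - f x)"
  by (simp add: L2_norm_def norm_minus_commute)

text \<open>Completing the square: with \<open>a = |f|\<close>, \<open>b = |g|\<close>, \<open>B = \<integral> b\<^sup>2\<close> and \<open>I = \<integral> a b\<close>, the integral of
  \<open>(B a - I b)\<^sup>2\<close> is nonnegative.  If \<open>B = 0\<close>, this carries no information, but then \<open>g\<close> vanishes
  almost everywhere.\<close>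

lemma L2_Cauchy_Schwarz:
  assumes f: "f \<in> L2 \<mu>" and g: "g \<in> L2 \<mu>"
  shows "norm (L2_inner \<mu> f g) \<le> L2_norm \<mu> f * L2_norm \<mu> g"
proof -
  let ?a = "\<lambda>x. norm (f x)" and ?b = "\<lambda>x. norm (g x)"
  define A where "A = (LINT x|\<mu>. (?a x)\<^sup>2)"
  define B where "B = (LINT x|\<mu>. (?b x)\<^sup>2)"
  define I where "I = (LINT x|\<mu>. ?a x * ?b x)"
  have [measurable]: "f \<in> borel_measurable \<mu>" "g \<in> borel_measurable \<mu>"
    using f g by (simp_all add: L2_measurable)
  have int: "integrable \<mu> (\<lambda>x. ?a x * ?b x)" "integrable \<mu> (\<lambda>x. (?a x)\<^sup>2)" "integrable \<mu> (\<lambda>x. (?b x)\<^sup>2)"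
    using integrable_norm[OF integrable_L2_inner[OF f g]] f g
    by (simp_all add: norm_mult L2_integrable_sq)
  have "I\<^sup>2 \<le> A * B"
  proof (cases "B = 0")
    case True
    then have "AE x in \<mu>. (?b x)\<^sup>2 = 0"
      unfolding B_def using int(3) by (subst (asm) integral_nonneg_eq_0_iff_AE) auto
    then have "I = (LINT x|\<mu>. 0)"
      unfolding I_def by (intro integral_cong_AE) auto
    then show ?thesis using True by simp
  next
    case False
    moreover have "B \<ge> 0" by (simp add: B_def)
    ultimately have "B > 0" by simp
    have "0 \<le> (LINT x|\<mu>. (B * ?a x - I * ?b x)\<^sup>2)" by simp
    also have "\<dots> = (LINT x|\<mu>. B\<^sup>2 * (?a x)\<^sup>2 - 2 * B * I * (?a x * ?b x) + I\<^sup>2 * (?b x)\<^sup>2)"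
      by (rule Bochner_Integration.integral_cong) (auto simp: power2_eq_square algebra_simps)
    also have "\<dots> = B\<^sup>2 * A - 2 * B * I * I + I\<^sup>2 * B"
      unfolding A_def B_def I_def using int by simp
    also have "\<dots> = B * (A * B - I\<^sup>2)" by (simp add: power2_eq_square algebra_simps)
    finally show ?thesis using \<open>B > 0\<close> by (simp add: zero_le_mult_iff)
  qed
  then have "I \<le> sqrt (A * B)" by (rule real_le_rsqrt)
  then have "I \<le> L2_norm \<mu> f * L2_norm \<mu> g"
    by (simp add: L2_norm_def A_def B_def real_sqrt_mult)
  moreover have "norm (L2_inner \<mu> f g) \<le> I"
    unfolding L2_inner_def I_def by (rule order_trans[OF integral_norm_bound]) (simp add: norm_mult)
  ultimately show ?thesis by simp
qed

lemma L2_norm_triangle: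
  assumes f: "f \<in> L2 \<mu>" and g: "g \<in> L2 \<mu>"
  shows "L2_norm \<mu> (\<lambda>x. f x + g x) \<le> L2_norm \<mu> f + L2_norm \<mu> g"
proof (rule power2_le_imp_le)
  have "of_real ((L2_norm \<mu> (\<lambda>x. f x + g x))\<^sup>2) =
      L2_inner \<mu> f f + L2_inner \<mu> f g + (L2_inner \<mu> g f + L2_inner \<mu> g g)"
    unfolding L2_norm_sq_inner[symmetric] using f g
    by (simp add: L2_inner_add_left L2_inner_add_right L2_add)
  from arg_cong[OF this, of Re] have "(L2_norm \<mu> (\<lambda>x. f x + g x))\<^sup>2 =
      (L2_norm \<mu> f)\<^sup>2 + Re (L2_inner \<mu> f g) + (Re (L2_inner \<mu> g f) + (L2_norm \<mu> g)\<^sup>2)"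
    by (simp add: L2_norm_sq_inner)
  also have "\<dots> \<le> (L2_norm \<mu> f)\<^sup>2 + L2_norm \<mu> f * L2_norm \<mu> g + (L2_norm \<mu> g * L2_norm \<mu> f + (L2_norm \<mu> g)\<^sup>2)"
    using f g by (intro add_mono order_refl order_trans[OF complex_Re_le_cmod] L2_Cauchy_Schwarz)
  finally show "(L2_norm \<mu> (\<lambda>x. f x + g x))\<^sup>2 \<le> (L2_norm \<mu> f + L2_norm \<mu> g)\<^sup>2"
    by (simp add: power2_sum)
qed simp

lemma L2_norm_triangle_diff:
  assumes "f \<in> L2 \<mu>" "g \<in> L2 \<mu>" "h \<in> L2 \<mu>"
  shows "L2_norm \<mu> (\<lambda>x. f x - h x) \<le> L2_norm \<mu> (\<lambda>x. f x - g x) + L2_norm \<mu> (\<lambda>x. g x - h x)"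
  using L2_norm_triangle[of "\<lambda>x. f x - g x" \<mu> "\<lambda>x. g x - h x"] assms by (simp add: L2_diff)

lemma L2_norm_diff_ge:
  assumes "f \<in> L2 \<mu>" "g \<in> L2 \<mu>"
  shows "\<bar>L2_norm \<mu> f - L2_norm \<mu> g\<bar> \<le> L2_norm \<mu> (\<lambda>x. f x - g x)"
  using L2_norm_triangle_diff[of f \<mu> g "\<lambda>x. 0"] L2_norm_triangle_diff[of g \<mu> f "\<lambda>x. 0"] assms
  by (simp add: L2_zero L2_norm_minus_commute[of \<mu> g f])

abbreviation L2_tendsto ::
    "'a measure \<Rightarrow> (nat \<Rightarrow> 'a \<Rightarrow> complex) \<Rightarrow> ('a \<Rightarrow> complex) \<Rightarrow> bool" where
  "L2_tendsto \<mu> S f \<equiv> (\<lambda>n. L2_norm \<mu> (\<lambda>x. S n x - f x)) \<longlonglongrightarrow> 0"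

lemma L2_norm_tendsto:
  assumes "\<And>n. S n \<in> L2 \<mu>" "f \<in> L2 \<mu>" "L2_tendsto \<mu> S f"
  shows "(\<lambda>n. L2_norm \<mu> (S n)) \<longlonglongrightarrow> L2_norm \<mu> f"
proof -
  have "(\<lambda>n. L2_norm \<mu> (S n) - L2_norm \<mu> f) \<longlonglongrightarrow> 0"
    by (rule Lim_null_comparison[OF _ assms(3)]) (simp add: L2_norm_diff_ge assms(1,2))
  then show ?thesis by (simp add: LIM_zero_iff)
qed

lemma L2_inner_tendsto:
  assumes "\<And>n. S n \<in> L2 \<mu>" "f \<in> L2 \<mu>" "h \<in> L2 \<mu>" "L2_tendsto \<mu> S f"
  shows "(\<lambda>n. L2_inner \<mu> h (S n)) \<longlonglongrightarrow> L2_inner \<mu> h f"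
proof -
  have "(\<lambda>n. L2_inner \<mu> h (S n) - L2_inner \<mu> h f) \<longlonglongrightarrow> 0"
  proof (rule Lim_null_comparison)
    show "(\<lambda>n. L2_norm \<mu> h * L2_norm \<mu> (\<lambda>x. S n x - f x)) \<longlonglongrightarrow> 0"
      using tendsto_mult_left[OF assms(4), of "L2_norm \<mu> h"] by simp
    have "norm (L2_inner \<mu> h (S n) - L2_inner \<mu> h f) \<le> L2_norm \<mu> h * L2_norm \<mu> (\<lambda>x. S n x - f x)" for n
      using L2_Cauchy_Schwarz[of h \<mu> "\<lambda>x. S n x - f x"] assms by (simp add: L2_inner_diff_right L2_diff)
    then show "\<forall>\<^sub>F n in sequentially. norm (L2_inner \<mu> h (S n) - L2_inner \<mu> h f)
        \<le> L2_norm \<mu> h * L2_norm \<mu> (\<lambda>x. S n x - f x)" by simp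
  qed
  then show ?thesis by (simp add: LIM_zero_iff)
qed

context prob_space
begin

lemma L2_const: "(\<lambda>x. c) \<in> L2 M"
  by (simp add: L2_def)

lemma L2_norm_const: "L2_norm M (\<lambda>x. c) = norm c"
  by (simp add: L2_norm_def prob_space)

lemma L2_integrable:
  assumes "f \<in> L2 M"
  shows "integrable M f"
  using integrable_L2_inner[OF L2_const[of 1] assms] by simp

lemma L1_norm_le_L2_norm:
  assumes "f \<in> L2 M"
  shows "(LINT x|M. norm (f x)) \<le> L2_norm M f"
proof -
  have "(\<lambda>x. of_real (norm (f x))) \<in> L2 M"
    using assms by (auto simp: L2_def)
  from L2_Cauchy_Schwarz[OF L2_const[of 1] this]
  have "norm (LINT x|M. complex_of_real (norm (f x))) \<le> L2_norm M f"
    by (simp add: L2_norm_const L2_inner_def) (simp add: L2_norm_def)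
  then show ?thesis by (simp add: integral_nonneg_AE)
qed

lemma L2_bounded:
  assumes "f \<in> borel_measurable M" "\<And>x. norm (f x) \<le> B"
  shows "f \<in> L2 M"
proof -
  have "integrable M (\<lambda>x. (norm (f x))\<^sup>2)"
    by (rule integrable_const_bound[of _ "B\<^sup>2"]) (use assms in \<open>auto intro!: power_mono\<close>)
  then show ?thesis using assms by (simp add: L2_def)
qed

text \<open>Riesz--Fischer: along a subsequence with summable increments the sequence converges almost
  everywhere, and Fatou's lemma turns the pointwise limit into a limit in the norm.\<close>

lemma L2_complete:
  assumes S: "\<And>n. S n \<in> L2 M"
    and Cauchy: "\<And>e. e > 0 \<Longrightarrow> \<exists>N. \<forall>m\<ge>N. \<forall>n\<ge>N. L2_norm M (\<lambda>x. S m x - S n x) < e"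
  shows "\<exists>g\<in>L2 M. (\<lambda>n. L2_norm M (\<lambda>x. S n x - g x)) \<longlonglongrightarrow> 0"
proof -
  have [measurable]: "S n \<in> borel_measurable M" for n using S by (rule L2_measurable)
  have "\<forall>k. \<exists>N. \<forall>m\<ge>N. \<forall>n\<ge>N. L2_norm M (\<lambda>x. S m x - S n x) < (1/2) ^ k"
    using Cauchy by simp
  then obtain N where N: "\<And>k m n. m \<ge> N k \<Longrightarrow> n \<ge> N k \<Longrightarrow> L2_norm M (\<lambda>x. S m x - S n x) < (1/2) ^ k"
    by metis
  \<comment> \<open>The partial sums make \<open>r\<close> increasing, and the summand \<open>k\<close> makes it unbounded.\<close>
  define r where "r k = (\<Sum>i\<le>k. N i) + k" for k
  have r_ge: "r k \<ge> N k" for k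
  proof -
    have "N k \<le> (\<Sum>i\<le>k. N i)" by (rule member_le_sum) auto
    then show ?thesis by (simp add: r_def)
  qed
  have r_le: "r (Suc k) \<ge> r k" for k by (simp add: r_def)
  have step: "L2_norm M (\<lambda>x. S (r (Suc k)) x - S (r k) x) < (1/2) ^ k" for k
    using r_le[of k] r_ge[of k] by (intro N) auto
  let ?d = "\<lambda>k x. S (r (Suc k)) x - S (r k) x"
  have d_L2: "?d k \<in> L2 M" for k using S by (intro L2_diff)
  have "(\<integral>\<^sup>+x. (\<Sum>k. ennreal (norm (?d k x))) \<partial>M) = (\<Sum>k. \<integral>\<^sup>+x. ennreal (norm (?d k x)) \<partial>M)"
    by (rule nn_integral_suminf) simp
  also have "\<dots> \<le> (\<Sum>k. ennreal ((1/2) ^ k))"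
  proof (rule suminf_le)
    fix k
    have "(\<integral>\<^sup>+x. ennreal (norm (?d k x)) \<partial>M) = ennreal (LINT x|M. norm (?d k x))"
      using d_L2 by (intro nn_integral_eq_integral integrable_norm L2_integrable) auto
    also have "\<dots> \<le> ennreal ((1/2) ^ k)"
      using L1_norm_le_L2_norm[OF d_L2[of k]] step[of k] by (intro ennreal_leI) simp
    finally show "(\<integral>\<^sup>+x. ennreal (norm (?d k x)) \<partial>M) \<le> ennreal ((1/2) ^ k)" .
  qed auto
  also have "\<dots> = ennreal (\<Sum>k. (1/2) ^ k)"
    by (rule suminf_ennreal2) (auto intro: summable_geometric)
  finally have fin: "(\<integral>\<^sup>+x. (\<Sum>k. ennreal (norm (?d k x))) \<partial>M) \<noteq> \<infinity>" by (auto simp: top_unique)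
  have "AE x in M. (\<Sum>k. ennreal (norm (?d k x))) \<noteq> \<infinity>"
    by (rule nn_integral_PInf_AE[OF _ fin]) simp
  then have conv: "AE x in M. convergent (\<lambda>k. S (r k) x)"
  proof eventually_elim
    case (elim x)
    then have "summable (\<lambda>k. norm (?d k x))"
      by (intro summable_suminf_not_top) auto
    then have "summable (\<lambda>k. ?d k x)" by (rule summable_norm_cancel)
    then have "convergent (\<lambda>n. S (r n) x - S (r 0) x)"
      by (simp add: summable_iff_convergent sum_lessThan_telescope[of "\<lambda>k. S (r k) x"])
    from convergent_add[OF this convergent_const[of "S (r 0) x"]] show ?case by simp
  qed
  define g where "g x = lim (\<lambda>k. S (r k) x)" for x
  have [measurable]: "g \<in> borel_measurable M"
    unfolding g_def by (rule borel_measurable_lim_metric) simp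
  have bound: "(\<integral>\<^sup>+x. ennreal ((norm (S n x - g x))\<^sup>2) \<partial>M) \<le> ennreal (e\<^sup>2)"
    if n: "\<And>m. m \<ge> n \<Longrightarrow> L2_norm M (\<lambda>x. S n x - S m x) \<le> e" and "e > 0" for n e
  proof -
    have "(\<integral>\<^sup>+x. ennreal ((norm (S n x - g x))\<^sup>2) \<partial>M)
        = (\<integral>\<^sup>+x. liminf (\<lambda>k. ennreal ((norm (S n x - S (r k) x))\<^sup>2)) \<partial>M)"
      using conv
    proof (intro nn_integral_cong_AE, eventually_elim)
      case (elim x)
      then have "(\<lambda>k. S (r k) x) \<longlonglongrightarrow> g x" by (simp add: g_def convergent_LIMSEQ_iff)
      then have "(\<lambda>k. ennreal ((norm (S n x - S (r k) x))\<^sup>2)) \<longlonglongrightarrow> ennreal ((norm (S n x - g x))\<^sup>2)"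
        by (intro tendsto_intros tendsto_ennrealI)
      then show ?case by (intro lim_imp_Liminf[symmetric]) auto
    qed
    also have "\<dots> \<le> liminf (\<lambda>k. \<integral>\<^sup>+x. ennreal ((norm (S n x - S (r k) x))\<^sup>2) \<partial>M)"
      by (rule nn_integral_liminf) simp
    also have "\<dots> \<le> liminf (\<lambda>k. ennreal (e\<^sup>2))"
    proof (rule Liminf_mono, rule eventually_sequentiallyI[of n])
      fix k assume "n \<le> k"
      then have "n \<le> r k" by (simp add: r_def)
      have "(\<integral>\<^sup>+x. ennreal ((norm (S n x - S (r k) x))\<^sup>2) \<partial>M)
          = ennreal ((L2_norm M (\<lambda>x. S n x - S (r k) x))\<^sup>2)"
        unfolding L2_norm_sq using S
        by (intro nn_integral_eq_integral L2_integrable_sq L2_diff) auto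
      also have "\<dots> \<le> ennreal (e\<^sup>2)"
        using n[OF \<open>n \<le> r k\<close>] by (intro ennreal_leI power_mono) auto
      finally show "(\<integral>\<^sup>+x. ennreal ((norm (S n x - S (r k) x))\<^sup>2) \<partial>M) \<le> ennreal (e\<^sup>2)" .
    qed
    also have "\<dots> = ennreal (e\<^sup>2)" by (simp add: Liminf_const)
    finally show ?thesis .
  qed
  have L2_Sg: "(\<lambda>x. S n x - g x) \<in> L2 M \<and> L2_norm M (\<lambda>x. S n x - g x) \<le> e"
    if n: "\<And>m. m \<ge> n \<Longrightarrow> L2_norm M (\<lambda>x. S n x - S m x) \<le> e" and "e > 0" for n e
  proof -
    have b: "(\<integral>\<^sup>+x. ennreal ((norm (S n x - g x))\<^sup>2) \<partial>M) \<le> ennreal (e\<^sup>2)" by (rule bound[OF that])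
    have int: "integrable M (\<lambda>x. (norm (S n x - g x))\<^sup>2)"
      by (rule integrableI_bounded) (use b in \<open>auto simp: less_top[symmetric] top_unique\<close>)
    from b have "ennreal (LINT x|M. (norm (S n x - g x))\<^sup>2) \<le> ennreal (e\<^sup>2)"
      by (subst (asm) nn_integral_eq_integral[OF int]) auto
    then have "(L2_norm M (\<lambda>x. S n x - g x))\<^sup>2 \<le> e\<^sup>2"
      by (simp add: L2_norm_sq)
    then have "L2_norm M (\<lambda>x. S n x - g x) \<le> e" by (rule power2_le_imp_le) (use \<open>e > 0\<close> in simp)
    with int show ?thesis by (simp add: L2_def)
  qed
  have N': "\<exists>N. \<forall>n\<ge>N. (\<forall>m\<ge>n. L2_norm M (\<lambda>x. S n x - S m x) \<le> e)" if "e > 0" for e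
    using Cauchy[OF that] by (meson less_imp_le order_trans)
  have "(\<lambda>n. L2_norm M (\<lambda>x. S n x - g x)) \<longlonglongrightarrow> 0"
  proof (rule LIMSEQ_I)
    fix e :: real assume "e > 0"
    then obtain N where "\<And>n m. n \<ge> N \<Longrightarrow> m \<ge> n \<Longrightarrow> L2_norm M (\<lambda>x. S n x - S m x) \<le> e / 2"
      using N'[of "e / 2"] by auto
    then have "\<And>n. n \<ge> N \<Longrightarrow> L2_norm M (\<lambda>x. S n x - g x) \<le> e / 2"
      using L2_Sg \<open>e > 0\<close> by (metis half_gt_zero)
    then have "\<And>n. n \<ge> N \<Longrightarrow> norm (L2_norm M (\<lambda>x. S n x - g x) - 0) < e"
      using \<open>e > 0\<close> by (simp add: field_sum_of_halves) (smt (verit) field_sum_of_halves)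
    then show "\<exists>N. \<forall>n\<ge>N. norm (L2_norm M (\<lambda>x. S n x - g x) - 0) < e" by blast
  qed
  moreover have "g \<in> L2 M"
  proof -
    obtain n where "\<And>m. m \<ge> n \<Longrightarrow> L2_norm M (\<lambda>x. S n x - S m x) \<le> 1"
      using N'[of 1] by auto
    then have "(\<lambda>x. S n x - g x) \<in> L2 M" using L2_Sg[of n 1] by simp
    from L2_diff[OF S[of n] this] show ?thesis by simp
  qed
  ultimately show ?thesis by blast
qed

end

section \<open>The tree of balls of an ultrametric Cantor set\<close>

locale ultrametric_cantor =
  fixes carrier_type :: "'a::metric_space itself"
  assumes cantor: "ultrametric_cantor_set carrier_type"
begin

lemma compact_UNIV: "compact (UNIV :: 'a set)"
  using cantor by (simp add: ultrametric_cantor_set_def cantor_set_def)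

lemma perfect: "x islimpt (UNIV :: 'a set)"
  using cantor by (simp add: ultrametric_cantor_set_def cantor_set_def)

lemma ultra: "dist x z \<le> max (dist x y) (dist y (z :: 'a))"
  using cantor by (simp add: ultrametric_cantor_set_def)

lemma bounded_any: "bounded (A :: 'a set)"
  using compact_imp_bounded[OF compact_UNIV] bounded_subset by blast

lemma dist_le_diameter: "x \<in> v \<Longrightarrow> y \<in> v \<Longrightarrow> dist x y \<le> diameter (v :: 'a set)"
  by (rule diameter_bounded_bound) (rule bounded_any)

lemma diameter_mono: "v \<subseteq> w \<Longrightarrow> diameter v \<le> diameter (w :: 'a set)"
  by (rule diameter_subset) (auto intro: bounded_any)

lemma dist_trans_less: "dist x y < r \<Longrightarrow> dist y z < r \<Longrightarrow> dist x (z :: 'a) < r"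
  using ultra[of x z y] by simp

lemma ball_eq: "y \<in> ball x r \<Longrightarrow> ball y r = ball (x :: 'a) r"
  by (auto intro: dist_trans_less) (metis dist_commute dist_trans_less)+

lemma closed_ball: "closed (ball (x :: 'a) r)"
proof -
  have "open (- ball x r)"
  proof (subst open_contains_ball, safe)
    fix y assume y: "y \<notin> ball x r"
    show "\<exists>e>0. ball y e \<subseteq> - ball x r"
    proof (cases "r > 0")
      case True
      have "ball y r \<subseteq> - ball x r" using y ball_eq by auto (metis ball_eq centre_in_ball mem_ball)
      with True show ?thesis by blast
    next
      case False then show ?thesis by (auto intro!: exI[of _ 1] simp: ball_empty)
    qed
  qed
  then show ?thesis by (simp add: closed_def)
qed

lemma UNIV_vertex: "UNIV \<in> (vertices :: 'a set set)"
proof -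
  obtain x :: 'a where True by blast
  have "UNIV = ball x (diameter (UNIV :: 'a set) + 1)"
    using le_less_trans[OF dist_le_diameter[of x UNIV] less_add_one] by auto
  moreover have "diameter (UNIV :: 'a set) + 1 > 0" using diameter_ge_0[OF bounded_any, of UNIV] by linarith
  ultimately show ?thesis unfolding vertices_def by blast
qed

lemma ball_vertex: "r > 0 \<Longrightarrow> ball x r \<in> (vertices :: 'a set set)"
  by (auto simp: vertices_def)

lemma vertex_nonempty: "v \<in> vertices \<Longrightarrow> v \<noteq> ({} :: 'a set)"
  by (auto simp: vertices_def)

lemma vertex_open: "v \<in> vertices \<Longrightarrow> open (v :: 'a set)"
  by (auto simp: vertices_def)

lemma vertex_compact: "v \<in> vertices \<Longrightarrow> compact (v :: 'a set)"
  using compact_Int_closed[OF compact_UNIV closed_ball] by (auto simp: vertices_def)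

lemma vertex_eq_ball: "v \<in> vertices \<Longrightarrow> x \<in> v \<Longrightarrow> \<exists>r>0. v = ball (x :: 'a) r"
  using ball_eq by (auto simp: vertices_def simp del: mem_ball)

lemma diameter_pos:
  assumes "v \<in> vertices" shows "diameter (v :: 'a set) > 0"
proof -
  obtain x where x: "x \<in> v" using vertex_nonempty[OF assms] by blast
  obtain y where "y \<in> v" "y \<noteq> x"
    using perfect[of x] x vertex_open[OF assms] unfolding islimpt_def by blast
  then have "0 < dist x y" by simp
  also have "\<dots> \<le> diameter v" using x \<open>y \<in> v\<close> by (rule dist_le_diameter)
  finally show ?thesis .
qed

lemma diameter_attained:
  assumes "v \<in> vertices" shows "\<exists>x\<in>v. \<exists>y\<in>v. dist x y = diameter (v :: 'a set)"
  using diameter_compact_attained[OF vertex_compact[OF assms] vertex_nonempty[OF assms]] by blast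

text \<open>If \<open>a\<close> and \<open>b\<close> realise the diameter, then by the ultrametric inequality every point has
  this distance from at least one of them.\<close>

lemma diameter_attained_at:
  assumes "v \<in> vertices" "x \<in> v" shows "\<exists>y\<in>v. dist x y = diameter (v :: 'a set)"
proof -
  obtain a b where ab: "a \<in> v" "b \<in> v" "dist a b = diameter v" using diameter_attained[OF assms(1)] by blast
  then have "dist x a = diameter v \<or> dist x b = diameter v"
    using ultra[of a b x] dist_le_diameter[of x v a] dist_le_diameter[of x v b] assms
    by (auto simp: dist_commute max_def split: if_splits)
  then show ?thesis using ab by blast
qed

text \<open>A ball is recovered from its diameter and any one of its points; this makes the tree
  structure of the vertices computable from diameters.\<close>

lemma vertex_eq_cball:
  assumes "v \<in> vertices" "x \<in> v" shows "v = cball (x :: 'a) (diameter v)"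
proof
  show "v \<subseteq> cball x (diameter v)" using dist_le_diameter assms by auto
  obtain r where r: "v = ball x r" using vertex_eq_ball assms by blast
  obtain y where "y \<in> v" "dist x y = diameter v" using diameter_attained_at assms by blast
  then have "diameter v < r" using r by simp
  then show "cball x (diameter v) \<subseteq> v" using r by auto
qed

lemma mem_vertex_cong:
  assumes "v \<in> vertices" "dist x y < diameter (v :: 'a set)" shows "x \<in> v \<longleftrightarrow> y \<in> v"
  using vertex_eq_cball[OF assms(1), of x] vertex_eq_cball[OF assms(1), of y] assms(2)
  by (metis dist_commute less_imp_le mem_cball)

lemma vertices_nested:
  assumes "v \<in> vertices" "w \<in> vertices" "x \<in> v" "x \<in> w"
  shows "v \<subseteq> w \<longleftrightarrow> diameter v \<le> diameter (w :: 'a set)"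
  using vertex_eq_cball[of v x] vertex_eq_cball[of w x] assms diameter_mono
  by (metis subset_cball)

lemma psubset_diameter_less:
  assumes "v \<in> vertices" "w \<in> vertices" "v \<subset> w"
  shows "diameter v < diameter (w :: 'a set)"
proof -
  obtain x where "x \<in> v" using vertex_nonempty assms by blast
  then show ?thesis
    using vertices_nested[of w v x] assms by (force simp: not_le[symmetric])
qed

lemma ball_diameter_psubset:
  assumes "v \<in> vertices" "x \<in> v" shows "ball x (diameter v) \<subset> (v :: 'a set)"
proof -
  have "ball x (diameter v) \<subseteq> v" using vertex_eq_cball[OF assms] ball_subset_cball by blast
  moreover obtain y where "y \<in> v" "dist x y = diameter v" using diameter_attained_at assms by blast
  ultimately show ?thesis by force
qed

lemma psubset_iff_subset_child:
  assumes "v \<in> vertices" "w \<in> vertices" "x \<in> w" "x \<in> v"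
  shows "w \<subset> v \<longleftrightarrow> w \<subseteq> ball x (diameter (v :: 'a set))"
proof
  assume "w \<subset> v"
  then have "diameter w < diameter v" using psubset_diameter_less assms by blast
  then show "w \<subseteq> ball x (diameter v)" using vertex_eq_cball[of w x] assms by (metis cball_subset_ball_iff subsetI mem_ball mem_cball le_less_trans)
next
  assume "w \<subseteq> ball x (diameter v)"
  then show "w \<subset> v" using ball_diameter_psubset[of v x] assms by blast
qed

text \<open>Since the diameter is attained at every point, the open ball with radius \<open>diam v\<close> around a
  point of \<open>v\<close> is a proper subset of \<open>v\<close>, and it is the largest one that is a ball.\<close>

lemma children_eq:
  assumes "v \<in> vertices"
  shows "children v = (\<lambda>x. ball x (diameter (v :: 'a set))) ` v"
proof (intro set_eqI iffI)
  fix u assume u: "u \<in> children v"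
  then have uv: "u \<in> vertices" "u \<subset> v" by (auto simp: children_def)
  then obtain x where x: "x \<in> u" using vertex_nonempty by blast
  let ?b = "ball x (diameter v)"
  have "?b \<in> vertices" using diameter_pos[OF assms] by (rule ball_vertex)
  moreover have "?b \<subset> v" using x uv assms by (intro ball_diameter_psubset) auto
  moreover have "u \<subseteq> ?b" using psubset_iff_subset_child[of v u x] uv x assms by blast
  ultimately have "u = ?b" using u by (auto simp: children_def)
  then show "u \<in> (\<lambda>x. ball x (diameter v)) ` v" using x uv by blast
next
  fix u assume "u \<in> (\<lambda>x. ball x (diameter v)) ` v"
  then obtain x where x: "x \<in> v" "u = ball x (diameter v)" by blast
  have "u \<in> vertices" using x diameter_pos[OF assms] by (simp add: ball_vertex)
  moreover have "u \<subset> v" using x assms by (simp add: ball_diameter_psubset)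
  moreover have False if "w \<in> vertices" "u \<subset> w" "w \<subset> v" for w
  proof -
    have "x \<in> w" using that x diameter_pos[OF assms] by auto
    then have "w \<subseteq> u" using psubset_iff_subset_child[of v w x] that x assms by blast
    then show False using that by blast
  qed
  ultimately show "u \<in> children v" by (auto simp: children_def)
qed

lemma choices_eq:
  assumes "v \<in> vertices"
  shows "choices v = {(x, y). x \<in> v \<and> y \<in> v \<and> y \<notin> ball x (diameter (v :: 'a set))}"
  using dist_le_diameter[of _ v] by (fastforce simp: choices_def)

lemma in_child:
  assumes "v \<in> vertices" shows "(x :: 'a) \<in> ball x (diameter (v :: 'a set))"
  using diameter_pos[OF assms] by simp

lemma child_vertex:
  assumes "v \<in> vertices" shows "ball (x :: 'a) (diameter (v :: 'a set)) \<in> vertices"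
  by (rule ball_vertex) (rule diameter_pos[OF assms])

lemma ball_eq_iff:
  assumes "r > 0" shows "ball x r = ball y r \<longleftrightarrow> ball x r \<inter> ball (y :: 'a) r \<noteq> {}"
proof
  assume "ball x r \<inter> ball y r \<noteq> {}"
  then obtain z where "z \<in> ball x r" "z \<in> ball y r" by blast
  then show "ball x r = ball y r" using ball_eq by metis
qed (use assms in auto)

lemma finite_balls: 
  assumes "r > 0" shows "finite (range (\<lambda>x :: 'a. ball x r))"
proof -
  have "UNIV \<subseteq> (\<Union>x::'a. ball x r)" using assms by auto
  then obtain F where F: "finite F" "UNIV \<subseteq> (\<Union>x\<in>F. ball (x::'a) r)"
    using compactE_image[OF compact_UNIV, of UNIV "\<lambda>x. ball x r"] by (metis open_ball subset_UNIV)
  have "range (\<lambda>x :: 'a. ball x r) \<subseteq> (\<lambda>x. ball x r) ` F"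
    using F ball_eq by (auto simp del: mem_ball)
  then show ?thesis using F finite_surj by blast
qed

lemma finite_children: "v \<in> vertices \<Longrightarrow> finite (children (v :: 'a set))"
  unfolding children_eq by (rule finite_subset[OF image_mono[OF subset_UNIV] finite_balls[OF diameter_pos]])

text \<open>A ball of diameter at least \<open>e\<close> is a union of the finitely many balls of radius \<open>e\<close>.\<close>

lemma finite_large_vertices:
  assumes "e > 0" shows "finite {v \<in> (vertices :: 'a set set). e \<le> diameter v}"
proof -
  have "v = \<Union>(( \<lambda>x. ball x e) ` v)" if v: "v \<in> vertices" "e \<le> diameter v" for v :: "'a set"
  proof
    show "v \<subseteq> \<Union>((\<lambda>x. ball x e) ` v)" using assms by auto
    show "\<Union>((\<lambda>x. ball x e) ` v) \<subseteq> v"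
      using ball_diameter_psubset[OF v(1)] subset_ball[OF v(2)] by blast
  qed
  then have "{v \<in> (vertices :: 'a set set). e \<le> diameter v} \<subseteq> Union ` Pow (range (\<lambda>x :: 'a. ball x e))"
    by blast
  then show ?thesis using finite_balls[OF assms] by (meson finite_Pow_iff finite_surj)
qed

lemma finite_ancestors: "u \<in> vertices \<Longrightarrow> finite {v \<in> (vertices :: 'a set set). u \<subseteq> v}"
  by (rule finite_subset[OF _ finite_large_vertices[OF diameter_pos]]) (auto intro: diameter_mono)

text \<open>The parent is the ancestor of smallest diameter: if \<open>u\<close> were not one of its children, then the
  child that contains \<open>u\<close> would be a smaller ancestor.\<close>

lemma parent_exists:
  assumes u: "u \<in> vertices" "u \<noteq> UNIV" "x \<in> (u :: 'a set)"
  shows "\<exists>p\<in>vertices. u \<subset> p \<and> u = ball x (diameter p) \<and>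
    {v \<in> vertices. u \<subset> v} = insert p {v \<in> vertices. p \<subset> v}"
proof -
  define A where "A = {v \<in> vertices. u \<subset> v}"
  have "finite A" unfolding A_def by (rule finite_subset[OF _ finite_ancestors[OF u(1)]]) auto
  moreover have "UNIV \<in> A" using u UNIV_vertex by (auto simp: A_def)
  ultimately obtain p where p: "p \<in> A" "\<And>v. v \<in> A \<Longrightarrow> diameter p \<le> diameter v"
    using ex_min_if_finite[of "diameter ` A"] by (metis empty_iff finite_imageI imageE imageI image_is_empty not_le)
  have pv: "p \<in> vertices" "u \<subset> p" "x \<in> p" using p u by (auto simp: A_def)
  let ?b = "ball x (diameter p)"
  have "u \<subseteq> ?b" using psubset_iff_subset_child[of p u x] pv u by blast
  have eq: "u = ?b"
  proof (rule ccontr)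
    assume "u \<noteq> ?b"
    then have "?b \<in> A" using \<open>u \<subseteq> ?b\<close> child_vertex[OF pv(1)] by (auto simp: A_def)
    moreover have "diameter ?b < diameter p"
      using child_vertex[OF pv(1)] pv ball_diameter_psubset by (intro psubset_diameter_less) auto
    ultimately show False using p(2) by fastforce
  qed
  have "p \<subseteq> v" if "v \<in> A" for v
    using vertices_nested[of p v x] that p(2)[OF that] pv u by (auto simp: A_def)
  then have "A = insert p {v \<in> vertices. p \<subset> v}" using pv by (auto simp: A_def)
  then show ?thesis using pv eq unfolding A_def by blast
qed

end

section \<open>The wavelet decomposition\<close>

locale cantor_measure = ultrametric_cantor "TYPE('a)" + prob_space \<mu>
  for \<mu> :: "'a::metric_space measure" +
  assumes sets_borel: "sets \<mu> = sets borel"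
    and full_support: "supp \<mu> = UNIV"
begin

lemma space_UNIV [simp]: "space \<mu> = UNIV"
  using sets_eq_imp_space_eq[OF sets_borel] by simp

lemma vertex_sets [measurable]: "v \<in> vertices \<Longrightarrow> v \<in> sets \<mu>"
  by (simp add: sets_borel vertex_open)

lemma ball_sets [measurable]: "ball x r \<in> sets \<mu>"
  by (simp add: sets_borel)

lemma vertex_measure_pos: assumes "v \<in> vertices" shows "measure \<mu> v > 0"
proof -
  obtain x where "x \<in> v" using vertex_nonempty[OF assms] by blast
  moreover have "x \<in> supp \<mu>" using full_support by simp
  ultimately have "emeasure \<mu> v > 0" using vertex_open[OF assms] unfolding supp_def by blast
  then show ?thesis by (simp add: emeasure_eq_measure)
qed

subsection \<open>Locally constant functions\<close>

text \<open>By compactness a locally constant function is constant on all balls of some common radius.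
  Carrying this radius explicitly keeps all sums over vertices finite.\<close>

definition constant_at :: "real \<Rightarrow> ('a \<Rightarrow> complex) \<Rightarrow> bool" where
  "constant_at e \<phi> \<longleftrightarrow> (\<forall>x y. dist x y < e \<longrightarrow> \<phi> x = \<phi> y)"

lemma constant_at_mono: "constant_at e \<phi> \<Longrightarrow> e' \<le> e \<Longrightarrow> constant_at e' \<phi>"
  by (simp add: constant_at_def)

lemma test_functions_iff: "\<phi> \<in> test_functions \<longleftrightarrow> (\<exists>e>0. constant_at e (\<phi> :: 'a \<Rightarrow> complex))"
proof
  assume "\<phi> \<in> test_functions"
  define G where "G = {U. open U \<and> \<phi> constant_on U}"
  have "\<forall>x. \<exists>U. open U \<and> x \<in> U \<and> \<phi> constant_on U"
    using \<open>\<phi> \<in> test_functions\<close> by (simp add: test_functions_def)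
  then have "UNIV \<subseteq> \<Union>G" unfolding G_def by blast
  moreover have "\<And>U. U \<in> G \<Longrightarrow> open U" by (simp add: G_def)
  ultimately obtain e where e: "e > 0" "\<And>x. x \<in> UNIV \<Longrightarrow> \<exists>U\<in>G. ball x e \<subseteq> U"
    using Heine_Borel_lemma[OF compact_UNIV, of G] by metis
  have "\<phi> x = \<phi> y" if "dist x y < e" for x y
  proof -
    obtain U where "\<phi> constant_on U" "ball x e \<subseteq> U" using e(2)[of x] unfolding G_def by blast
    moreover have "x \<in> ball x e" "y \<in> ball x e" using that e by auto
    ultimately show ?thesis unfolding constant_on_def by (metis subsetD)
  qed
  then show "\<exists>e>0. constant_at e \<phi>" using e unfolding constant_at_def by blast
next
  assume "\<exists>e>0. constant_at e \<phi>"
  then obtain e where "e > 0" "constant_at e \<phi>" by blast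
  then have "\<phi> y = \<phi> x" if "y \<in> ball x e" for x y
    using that unfolding constant_at_def by (metis mem_ball)
  then have "\<phi> constant_on (ball x e)" for x unfolding constant_on_def by blast
  then have "open (ball x e) \<and> x \<in> ball x e \<and> \<phi> constant_on (ball x e)" for x
    using \<open>e > 0\<close> by simp
  then show "\<phi> \<in> test_functions" unfolding test_functions_def by blast
qed

lemma constant_at_finite_range:
  assumes "e > 0" "constant_at e \<phi>" shows "finite (range \<phi>)"
proof (rule finite_surj[OF finite_balls[OF assms(1)]])
  show "range \<phi> \<subseteq> (\<lambda>b. \<phi> (SOME y. y \<in> b)) ` range (\<lambda>x. ball x e)"
  proof (clarify)
    fix x :: 'a
    have "(SOME y. y \<in> ball x e) \<in> ball x e" 
      using someI[of "\<lambda>y. y \<in> ball x e" x] assms(1) by simp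
    then have "\<phi> x = \<phi> (SOME y. y \<in> ball x e)" using assms(2) by (simp add: constant_at_def)
    then show "\<phi> x \<in> (\<lambda>b. \<phi> (SOME y. y \<in> b)) ` range (\<lambda>x. ball x e)" by blast
  qed
qed

lemma test_bounded:
  assumes "\<phi> \<in> test_functions" shows "\<exists>B. \<forall>x::'a. norm (\<phi> x) \<le> B"
proof -
  have "finite (range \<phi>)" using assms constant_at_finite_range by (auto simp: test_functions_iff)
  then have "bounded (range \<phi>)" by (rule finite_imp_bounded)
  then show ?thesis by (auto simp: bounded_iff)
qed

lemma test_continuous:
  assumes "\<phi> \<in> test_functions" shows "continuous_on UNIV (\<phi> :: 'a \<Rightarrow> complex)"
  using assms unfolding test_functions_iff constant_at_def continuous_on_iff
  by (metis dist_commute dist_self)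

lemma test_measurable: "\<phi> \<in> test_functions \<Longrightarrow> \<phi> \<in> borel_measurable \<mu>"
  using borel_measurable_continuous_onI[OF test_continuous]
  by (simp add: measurable_cong_sets[OF sets_borel refl])

lemma test_L2: "\<phi> \<in> test_functions \<Longrightarrow> \<phi> \<in> L2 \<mu>"
  using test_bounded[of \<phi>] by (auto intro: L2_bounded test_measurable)

lemma test_const: "(\<lambda>x::'a. c) \<in> test_functions"
  unfolding test_functions_iff by (auto simp: constant_at_def intro: exI[of _ 1])

lemma test_binop:
  assumes "\<phi> \<in> test_functions" "\<psi> \<in> test_functions"
  shows "(\<lambda>x::'a. h (\<phi> x) (\<psi> x)) \<in> test_functions"
proof -
  obtain a b where "a > 0" "b > 0" "constant_at a \<phi>" "constant_at b \<psi>"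
    using assms by (auto simp: test_functions_iff)
  then have "min a b > 0" "constant_at (min a b) (\<lambda>x. h (\<phi> x) (\<psi> x))"
    by (simp, simp add: constant_at_def) metis
  then show ?thesis unfolding test_functions_iff by blast
qed

lemma test_scaleR: "\<phi> \<in> test_functions \<Longrightarrow> (\<lambda>x::'a. r *\<^sub>R \<phi> x) \<in> test_functions"
  using test_binop[of \<phi> \<phi> "\<lambda>a b. r *\<^sub>R a"] by simp

lemma test_sum:
  "(\<And>i. i \<in> I \<Longrightarrow> f i \<in> test_functions) \<Longrightarrow> (\<lambda>x::'a. \<Sum>i\<in>I. f i x) \<in> test_functions"
  by (induction I rule: infinite_finite_induct) (auto intro: test_const test_binop[where h = "(+)"])

lemma test_indicator:
  assumes "v \<in> vertices" shows "(indicator v :: 'a \<Rightarrow> complex) \<in> test_functions"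
proof -
  have "constant_at (diameter v) (indicator v)"
    unfolding constant_at_def
  proof (intro allI impI)
    fix x y :: 'a assume "dist x y < diameter v"
    then have "x \<in> v \<longleftrightarrow> y \<in> v" by (rule mem_vertex_cong[OF assms])
    then show "(indicator v x :: complex) = indicator v y" by (simp add: indicator_def)
  qed
  then show ?thesis using diameter_pos[OF assms] test_functions_iff by blast
qed

subsection \<open>Averages over balls\<close>

definition avg :: "'a set \<Rightarrow> ('a \<Rightarrow> complex) \<Rightarrow> complex" where
  "avg v f = (1 / measure \<mu> v) *\<^sub>R (LINT x:v|\<mu>. f x)"

lemma set_integrable_vertex:
  "integrable \<mu> f \<Longrightarrow> v \<in> vertices \<Longrightarrow> set_integrable \<mu> v (f :: 'a \<Rightarrow> complex)"
  unfolding set_integrable_def by (rule integrable_mult_indicator) auto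

lemma avg_add: "integrable \<mu> f \<Longrightarrow> integrable \<mu> g \<Longrightarrow> v \<in> vertices \<Longrightarrow>
    avg v (\<lambda>x. f x + g x) = avg v f + avg v g"
  by (simp add: avg_def set_integral_add set_integrable_vertex scaleR_add_right)

lemma avg_cmult: "avg v (\<lambda>x. c * f x) = c * avg v f"
  by (simp add: avg_def)

lemma avg_cong_AE:
  assumes "f \<in> borel_measurable \<mu>" "g \<in> borel_measurable \<mu>" "AE x in \<mu>. f x = g x" "v \<in> vertices"
  shows "avg v f = avg v g"
  unfolding avg_def set_lebesgue_integral_def using assms vertex_sets[OF assms(4)]
  by (intro arg_cong[where f = "\<lambda>i. _ *\<^sub>R i"] integral_cong_AE) (auto elim: AE_mp)

lemma avg_const:
  assumes "v \<in> vertices" "\<And>x. x \<in> v \<Longrightarrow> f x = c" shows "avg v f = c"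
proof -
  have "(LINT x:v|\<mu>. f x) = (LINT x:v|\<mu>. c)"
    using assms by (intro set_lebesgue_integral_cong) auto
  also have "\<dots> = measure \<mu> v *\<^sub>R c"
    unfolding set_lebesgue_integral_def using vertex_sets[OF assms(1)]
    by (subst integral_scaleR_left) (auto simp: emeasure_eq_measure)
  finally show ?thesis
    using vertex_measure_pos[OF assms(1)] by (simp add: avg_def)
qed

lemma integral_eq_avg: "v \<in> vertices \<Longrightarrow> (LINT x:v|\<mu>. f x) = measure \<mu> v *\<^sub>R avg v f"
  using vertex_measure_pos[of v] by (simp add: avg_def)

lemma L2_inner_indicator:
  assumes "v \<in> vertices" shows "L2_inner \<mu> (indicator v) f = measure \<mu> v *\<^sub>R avg v f"
proof -
  have "cnj (indicator v x) * f x = indicator v x *\<^sub>R f x" for x by (simp add: indicator_def)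
  then show ?thesis using integral_eq_avg[OF assms, of f]
    by (simp add: set_lebesgue_integral_def L2_inner_def)
qed

lemma avg_tendsto:
  assumes "\<And>n. S n \<in> L2 \<mu>" "f \<in> L2 \<mu>" "L2_tendsto \<mu> S f" "v \<in> vertices"
  shows "(\<lambda>n. avg v (S n)) \<longlonglongrightarrow> avg v f"
proof -
  have *: "avg v g = (1 / measure \<mu> v) *\<^sub>R L2_inner \<mu> (indicator v) g" for g
    using vertex_measure_pos[OF assms(4)] by (simp add: L2_inner_indicator[OF assms(4)])
  show ?thesis unfolding *
    by (intro tendsto_scaleR tendsto_const
        L2_inner_tendsto[OF assms(1,2) test_L2[OF test_indicator[OF assms(4)]] assms(3)])
qed

lemma children_disjoint:
  assumes "v \<in> vertices" "u \<in> children v" "u' \<in> children (v :: 'a set)" "u \<noteq> u'"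
  shows "u \<inter> u' = {}"
  using assms ball_eq_iff[OF diameter_pos[OF assms(1)]] by (auto simp: children_eq simp del: mem_ball)

lemma children_Union: "v \<in> vertices \<Longrightarrow> \<Union> (children v) = (v :: 'a set)"
  using ball_diameter_psubset[of v] in_child[of v] by (fastforce simp: children_eq simp del: mem_ball)

lemma child_in_vertices: "u \<in> children v \<Longrightarrow> u \<in> vertices"
  by (simp add: children_def)

lemma integral_children:
  assumes "v \<in> vertices" "integrable \<mu> f"
  shows "(LINT x:v|\<mu>. f x) = (\<Sum>u\<in>children v. LINT x:u|\<mu>. (f x :: complex))"
proof -
  have "(LINT x:(\<Union>u\<in>children v. u)|\<mu>. f x) = (\<Sum>u\<in>children v. LINT x:u|\<mu>. f x)"
    using assms children_disjoint[OF assms(1)]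
    by (intro set_integral_finite_Union finite_children)
      (auto simp: disjoint_family_on_def intro: child_in_vertices vertex_sets set_integrable_vertex)
  then show ?thesis using children_Union[OF assms(1)] by simp
qed

subsection \<open>The components of a function\<close>

text \<open>The empty set, which is not a ball, serves as the index of the constant component, the mean
  of \<open>f\<close> over the whole space, so that it can be treated together with the wavelet components.\<close>

definition modes :: "'a set set" where
  "modes = insert {} vertices"

definition component :: "'a set \<Rightarrow> ('a \<Rightarrow> complex) \<Rightarrow> 'a \<Rightarrow> complex" where
  "component v f x = (if v = {} then avg UNIV f
     else if x \<in> v then avg (ball x (diameter v)) f - avg v f else 0)"

lemma component_empty: "component {} f x = avg UNIV f"
  by (simp add: component_def)

lemma component_inside: "v \<in> vertices \<Longrightarrow> x \<in> v \<Longrightarrow> component v f x = avg (ball x (diameter v)) f - avg v f"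
  using vertex_nonempty by (auto simp: component_def)

lemma component_outside: "v \<in> vertices \<Longrightarrow> x \<notin> v \<Longrightarrow> component v f x = 0"
  using vertex_nonempty by (auto simp: component_def)

lemma component_constant_at:
  assumes "v \<in> vertices" shows "constant_at (diameter v) (component v f)"
  unfolding constant_at_def
proof (intro allI impI)
  fix x y :: 'a assume d: "dist x y < diameter v"
  then have "x \<in> v \<longleftrightarrow> y \<in> v" by (rule mem_vertex_cong[OF assms])
  moreover have "ball y (diameter v) = ball x (diameter v)" using d by (intro ball_eq) simp
  ultimately show "component v f x = component v f y"
    by (cases "x \<in> v") (simp_all add: component_inside component_outside assms)
qed

lemma component_test: "v \<in> modes \<Longrightarrow> component v f \<in> test_functions"
  using component_constant_at[of v f] diameter_pos[of v] test_const
  by (auto simp: modes_def test_functions_iff component_empty[abs_def])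

lemma component_L2: "v \<in> modes \<Longrightarrow> component v f \<in> L2 \<mu>"
  by (intro test_L2 component_test)

lemma component_add:
  assumes "integrable \<mu> f" "integrable \<mu> g" "v \<in> modes"
  shows "component v (\<lambda>x. f x + g x) x = component v f x + component v g x"
  using assms child_vertex[of v x] UNIV_vertex by (auto simp: modes_def component_def avg_add)

lemma component_cmult: "component v (\<lambda>x. c * f x) x = c * component v f x"
  by (simp add: component_def avg_cmult algebra_simps)

lemma component_scaleR: "component v (\<lambda>x. r *\<^sub>R f x) x = r *\<^sub>R component v f x"
  using component_cmult[of v "of_real r" f x] by (simp add: scaleR_conv_of_real)

lemma component_uminus: "component v (\<lambda>x. - f x) x = - component v f x"
  using component_cmult[of v "-1" f x] by simp

lemma component_diff:
  assumes "integrable \<mu> f" "integrable \<mu> g" "v \<in> modes"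
  shows "component v (\<lambda>x. f x - g x) x = component v f x - component v g x"
  using component_add[of f "\<lambda>x. - g x" v x] assms by (simp add: component_uminus)

lemma component_zero: "component v (\<lambda>x. 0) x = 0"
  by (simp add: component_def avg_def)

lemma component_sum:
  assumes "\<And>i. i \<in> I \<Longrightarrow> integrable \<mu> (f i)" "v \<in> modes"
  shows "component v (\<lambda>x. \<Sum>i\<in>I. f i x) x = (\<Sum>i\<in>I. component v (f i) x)"
  using assms by (induction I rule: infinite_finite_induct) (simp_all add: component_zero component_add)

lemma component_tendsto:
  assumes "\<And>n. S n \<in> L2 \<mu>" "f \<in> L2 \<mu>" "L2_tendsto \<mu> S f" "v \<in> modes"
  shows "(\<lambda>n. component v (S n) x) \<longlonglongrightarrow> component v f x"
proof (cases "v = {}")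
  case True
  then show ?thesis using avg_tendsto[OF assms(1-3) UNIV_vertex] by (simp add: component_empty)
next
  case False
  then have v: "v \<in> vertices" using assms(4) by (simp add: modes_def)
  show ?thesis
  proof (cases "x \<in> v")
    case True
    then show ?thesis
      using v by (simp add: component_inside)
        (intro tendsto_diff avg_tendsto[OF assms(1-3)] child_vertex)
  qed (simp add: v component_outside)
qed

lemma component_cong_AE:
  assumes "f \<in> borel_measurable \<mu>" "g \<in> borel_measurable \<mu>" "AE x in \<mu>. f x = g x" "v \<in> modes"
  shows "component v f x = component v g x"
  using assms(4) avg_cong_AE[OF assms(1-3)] UNIV_vertex child_vertex[of v x]
  by (cases "v = {}") (simp_all add: component_def modes_def)

lemma component_eq_sum:
  assumes "v \<in> vertices"
  shows "component v f x = (\<Sum>u\<in>children v. indicator u x *\<^sub>R (avg u f - avg v f))"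
proof (cases "x \<in> v")
  case True
  let ?u = "ball x (diameter v)"
  have u: "?u \<in> children v" using True assms by (simp add: children_eq)
  have "indicator u x *\<^sub>R (avg u f - avg v f) = (if u = ?u then avg ?u f - avg v f else 0)"
    if "u \<in> children v" for u
  proof (cases "u = ?u")
    case False
    then have "x \<notin> u" using children_disjoint[OF assms that u] in_child[OF assms, of x] by blast
    then show ?thesis using False by simp
  qed (use in_child[OF assms, of x] in simp)
  then have "(\<Sum>u\<in>children v. indicator u x *\<^sub>R (avg u f - avg v f)) = avg ?u f - avg v f"
    using u finite_children[OF assms] by (simp add: sum.delta cong: sum.cong)
  then show ?thesis using True assms by (simp add: component_inside)
next
  case False
  then have "indicator u x *\<^sub>R (avg u f - avg v f) = 0" if "u \<in> children v" for u
    using children_Union[OF assms] that by (auto simp: indicator_def)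
  then have "(\<Sum>u\<in>children v. indicator u x *\<^sub>R (avg u f - avg v f)) = 0"
    by (intro sum.neutral) blast
  then show ?thesis using False assms by (simp add: component_outside)
qed

lemma component_on_child:
  assumes "v \<in> vertices" "u \<in> children v" "x \<in> u"
  shows "component v f x = avg u f - avg v f"
proof -
  obtain y where y: "y \<in> v" "u = ball y (diameter v)" using assms by (auto simp: children_eq)
  then have "u = ball x (diameter v)" using assms(3) ball_eq by metis
  moreover have "x \<in> v" using assms children_Union by blast
  ultimately show ?thesis by (simp add: assms component_inside)
qed

lemma L2_inner_component:
  assumes v: "v \<in> vertices" and g: "integrable \<mu> g"
  shows "L2_inner \<mu> (component v f) g =
    (\<Sum>u\<in>children v. cnj (avg u f - avg v f) * (LINT x:u|\<mu>. g x))"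
proof -
  have "L2_inner \<mu> (component v f) g =
      (LINT x|\<mu>. (\<Sum>u\<in>children v. cnj (avg u f - avg v f) * (indicator u x *\<^sub>R g x)))"
    unfolding L2_inner_def
    by (rule Bochner_Integration.integral_cong) (simp_all add: component_eq_sum[OF v] sum_distrib_right)
  also have "\<dots> = (\<Sum>u\<in>children v. cnj (avg u f - avg v f) * (LINT x:u|\<mu>. g x))"
    unfolding set_lebesgue_integral_def
    by (subst Bochner_Integration.integral_sum)
      (auto simp del: mult_scaleR_right intro!: integrable_mult_right integrable_mult_indicator g vertex_sets child_in_vertices)
  finally show ?thesis .
qed

text \<open>The mean of a wavelet component is zero, written as a sum over the children.\<close>

lemma integral_component:
  assumes v: "v \<in> vertices" and f: "integrable \<mu> f"
  shows "(\<Sum>u\<in>children v. measure \<mu> u *\<^sub>R (avg u f - avg v f)) = 0"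
proof -
  have "measure \<mu> v = measure \<mu> (\<Union>u\<in>children v. u)" using children_Union[OF v] by simp
  also have "\<dots> = (\<Sum>u\<in>children v. measure \<mu> u)"
    using children_disjoint[OF v]
    by (intro finite_measure_finite_Union finite_children v)
      (auto simp: disjoint_family_on_def intro: child_in_vertices vertex_sets)
  finally have m: "measure \<mu> v = (\<Sum>u\<in>children v. measure \<mu> u)" .
  have "(\<Sum>u\<in>children v. measure \<mu> u *\<^sub>R avg u f) = (\<Sum>u\<in>children v. LINT x:u|\<mu>. f x)"
    by (rule sum.cong) (simp_all add: integral_eq_avg child_in_vertices)
  also have "\<dots> = measure \<mu> v *\<^sub>R avg v f"
    using integral_children[OF v f] integral_eq_avg[OF v] by simp
  finally show ?thesis by (simp add: m scaleR_diff_right sum_subtractf scaleR_sum_left)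
qed

text \<open>A ball that is not strictly inside \<open>w\<close> is disjoint from \<open>w\<close> or contains all of it.\<close>

lemma avg_component_outside:
  assumes w: "w \<in> vertices" and f: "integrable \<mu> f" and u: "u \<in> vertices" and uw: "\<not> u \<subset> w"
  shows "avg u (component w f) = 0"
proof (cases "u \<inter> w = {}")
  case True
  then show ?thesis using w u by (intro avg_const) (auto intro: component_outside)
next
  case False
  then have "w \<subseteq> u" using vertices_nested[OF w u] vertices_nested[OF u w] uw by fastforce
  have int: "integrable \<mu> (component w f)" using component_L2[of w f] w by (intro L2_integrable) (simp add: modes_def)
  have "(LINT x:u|\<mu>. component w f x) = (LINT x:w|\<mu>. component w f x)"
    unfolding set_lebesgue_integral_def
    using \<open>w \<subseteq> u\<close> component_outside[OF w] by (intro Bochner_Integration.integral_cong) (auto simp: indicator_def)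
  also have "\<dots> = (\<Sum>u\<in>children w. LINT x:u|\<mu>. component w f x)" by (rule integral_children[OF w int])
  also have "\<dots> = (\<Sum>u\<in>children w. measure \<mu> u *\<^sub>R avg u (component w f))"
    by (rule sum.cong) (simp_all add: integral_eq_avg child_in_vertices)
  also have "\<dots> = (\<Sum>u\<in>children w. measure \<mu> u *\<^sub>R (avg u f - avg w f))"
    using avg_const[OF child_in_vertices component_on_child[OF w]] by (intro sum.cong) auto
  finally show ?thesis using integral_component[OF w f] by (simp add: avg_def)
qed

lemma avg_component_inside:
  assumes w: "w \<in> vertices" and u: "u \<in> vertices" "u \<subset> w" "x \<in> u"
  shows "avg u (component w f) = component w f x"
proof (rule avg_const[OF u(1)])
  fix y assume "y \<in> u"
  then have "dist y x \<le> diameter u" using u by (intro dist_le_diameter)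
  also have "\<dots> < diameter w" using u w by (intro psubset_diameter_less)
  finally show "component w f y = component w f x" using component_constant_at[OF w] by (auto simp: constant_at_def)
qed

lemma component_const: "v \<in> vertices \<Longrightarrow> component v (\<lambda>x. c) x = 0"
  using avg_const[of _ "\<lambda>x. c" c] child_vertex[of v x] by (cases "x \<in> v") (simp_all add: component_inside component_outside)

text \<open>A component of \<open>w\<close> is constant on the balls strictly inside \<open>w\<close> and has mean zero over all
  others, so the averages of it over a ball \<open>v\<close> and over a child of \<open>v\<close> differ only if \<open>v = w\<close>.\<close>

lemma component_component:
  assumes v: "v \<in> modes" and w: "w \<in> modes" and f: "integrable \<mu> f"
  shows "component v (component w f) x = (if v = w then component w f x else 0)"
proof (cases "w = {}")
  case True
  then have "component w f = (\<lambda>x. avg UNIV f)" by (simp add: component_def fun_eq_iff)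
  then show ?thesis
    using v True avg_const[OF UNIV_vertex, of "\<lambda>x. avg UNIV f"] vertex_nonempty
    by (auto simp: modes_def component_const component_empty)
next
  case False
  then have w: "w \<in> vertices" using w by (simp add: modes_def)
  show ?thesis
  proof (cases "v = {}")
    case True
    then show ?thesis using False avg_component_outside[OF w f UNIV_vertex] by (auto simp: component_empty)
  next
    case False
    then have v: "v \<in> vertices" using v by (simp add: modes_def)
    show ?thesis
    proof (cases "x \<in> v")
      case True
      let ?u = "ball x (diameter v)"
      have u: "?u \<in> vertices" "x \<in> ?u" "?u \<subset> v"
        using child_vertex in_child ball_diameter_psubset v True by auto
      have "avg ?u (component w f) - avg v (component w f) = (if v = w then component w f x else 0)"
      proof (cases "v \<subset> w")
        case True
        then show ?thesis using avg_component_inside[OF w u(1) _ u(2)] avg_component_inside[OF w v True \<open>x \<in> v\<close>] u by auto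
      next
        case False
        then have "avg v (component w f) = 0" by (intro avg_component_outside w f v)
        moreover have "avg ?u (component w f) = (if v = w then component w f x else 0)"
        proof (cases "v = w")
          case True
          then show ?thesis using avg_component_inside[OF w u(1) _ u(2)] u by auto
        next
          case False
          have "\<not> ?u \<subset> w"
          proof
            assume "?u \<subset> w"
            then have "x \<in> w" using u by blast
            then have "w \<subset> v" using vertices_nested[OF v w True] vertices_nested[OF w v _ True] \<open>\<not> v \<subset> w\<close> False
              by fastforce
            then have "w \<subseteq> ?u" using psubset_iff_subset_child[OF v w \<open>x \<in> w\<close> True] by simp
            with \<open>?u \<subset> w\<close> show False by blast
          qed
          then show ?thesis using False avg_component_outside[OF w f u(1)] by simp
        qed
        ultimately show ?thesis by simp
      qed
      then show ?thesis using True v by (simp add: component_inside)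
    next
      case False
      then show ?thesis using v w by (auto simp: component_outside)
    qed
  qed
qed

text \<open>Taking a component is an orthogonal projection: on each child of \<open>v\<close>, the functions \<open>g\<close> and
  its component at \<open>v\<close> have averages that differ by the same constant, and this constant is
  orthogonal to a function of mean zero.\<close>

lemma L2_inner_component_component:
  assumes v: "v \<in> modes" and f: "f \<in> L2 \<mu>" and g: "g \<in> L2 \<mu>"
  shows "L2_inner \<mu> (component v f) (component v g) = L2_inner \<mu> (component v f) g"
proof (cases "v = {}")
  case True
  have "avg UNIV g = (LINT x|\<mu>. g x)"
    using prob_space by (simp add: avg_def set_lebesgue_integral_def)
  moreover have "component v f = (\<lambda>x. avg UNIV f)" "component v g = (\<lambda>x. avg UNIV g)"
    using True by (simp_all add: component_def fun_eq_iff)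
  ultimately show ?thesis using prob_space by (simp add: L2_inner_def)
next
  case False
  then have v': "v \<in> vertices" using v by (simp add: modes_def)
  have int: "integrable \<mu> g" "integrable \<mu> f" "integrable \<mu> (component v g)"
    using f g component_L2[OF v] by (auto intro: L2_integrable)
  have "L2_inner \<mu> (component v f) g - L2_inner \<mu> (component v f) (component v g)
      = (\<Sum>u\<in>children v. cnj (avg u f - avg v f) *
          (measure \<mu> u *\<^sub>R avg u g - measure \<mu> u *\<^sub>R (avg u g - avg v g)))"
    unfolding L2_inner_component[OF v' int(1)] L2_inner_component[OF v' int(3)] sum_subtractf[symmetric]
    using avg_const[OF child_in_vertices component_on_child[OF v']]
    by (intro sum.cong) (auto simp: integral_eq_avg child_in_vertices right_diff_distrib)
  also have "\<dots> = cnj (\<Sum>u\<in>children v. measure \<mu> u *\<^sub>R (avg u f - avg v f)) * avg v g"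
    by (simp add: sum_distrib_left scaleR_conv_of_real algebra_simps)
  also have "\<dots> = 0" using integral_component[OF v' int(2)] by simp
  finally show ?thesis by simp
qed

text \<open>Telescoping along the chain of ancestors: passing from a ball to its parent \<open>p\<close> changes the
  average by the value of the component at \<open>p\<close>.\<close>

lemma avg_eq_sum_ancestors:
  assumes "u \<in> vertices" "x \<in> u"
  shows "avg u f = avg UNIV f + (\<Sum>v\<in>{v \<in> vertices. u \<subset> v}. component v f x)"
proof -
  have fin: "finite {v \<in> vertices. u \<subset> v}" if "u \<in> vertices" for u :: "'a set"
    by (rule finite_subset[OF _ finite_ancestors[OF that]]) auto
  have "card {v \<in> vertices. u \<subset> v} = n \<Longrightarrow> ?thesis" for n
    using assms
  proof (induction n arbitrary: u)
    case 0
    then have "{v \<in> vertices. u \<subset> v} = {}" using fin by simp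
    moreover from this have "u = UNIV" using UNIV_vertex by blast
    ultimately show ?case by simp
  next
    case (Suc n)
    then have "u \<noteq> UNIV" by auto
    then obtain p where p: "p \<in> vertices" "u \<subset> p" "u = ball x (diameter p)"
        "{v \<in> vertices. u \<subset> v} = insert p {v \<in> vertices. p \<subset> v}"
      using parent_exists Suc by metis
    have "card {v \<in> vertices. p \<subset> v} = n" using Suc(2) fin[OF p(1)] by (simp add: p(4))
    moreover have "x \<in> p" using p Suc by blast
    ultimately have "avg p f = avg UNIV f + (\<Sum>v\<in>{v \<in> vertices. p \<subset> v}. component v f x)"
      using Suc.IH p(1) by blast
    moreover have "component p f x = avg u f - avg p f" using p \<open>x \<in> p\<close> by (simp add: component_inside)
    ultimately show ?case unfolding p(4) using fin[OF p(1)] by simp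
  qed
  then show ?thesis by blast
qed

definition coarse :: "real \<Rightarrow> 'a set set" where
  "coarse e = insert {} {v \<in> vertices. e \<le> diameter v}"

lemma finite_coarse: "e > 0 \<Longrightarrow> finite (coarse e)"
  by (simp add: coarse_def finite_large_vertices)

lemma coarse_modes: "coarse e \<subseteq> modes"
  by (auto simp: coarse_def modes_def)

lemma coarse_mono: "e' \<le> e \<Longrightarrow> coarse e \<subseteq> coarse e'"
  by (auto simp: coarse_def)

text \<open>The ancestors of the ball with radius \<open>e\<close> around \<open>x\<close> are the balls of diameter at least \<open>e\<close>
  that contain \<open>x\<close>; the components of the other balls vanish at \<open>x\<close>.\<close>

lemma avg_ball_eq_sum:
  assumes "e > 0" shows "avg (ball x e) f = (\<Sum>v\<in>coarse e. component v f x)"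
proof -
  let ?u = "ball x e"
  have u: "?u \<in> vertices" "x \<in> ?u" using assms by (simp_all add: ball_vertex)
  have iff: "?u \<subset> v \<longleftrightarrow> x \<in> v \<and> e \<le> diameter v" if v: "v \<in> vertices" for v
  proof
    assume uv: "?u \<subset> v"
    then obtain y where "y \<in> v" "y \<notin> ?u" by blast
    then have "e \<le> dist x y" by simp
    also have "\<dots> \<le> diameter v" using uv u(2) \<open>y \<in> v\<close> by (intro dist_le_diameter) blast+
    finally have "e \<le> diameter v" .
    moreover have "x \<in> v" using uv u(2) by blast
    ultimately show "x \<in> v \<and> e \<le> diameter v" by simp
  next
    assume "x \<in> v \<and> e \<le> diameter v"
    then show "?u \<subset> v" using ball_diameter_psubset[OF v, of x] subset_ball[of e "diameter v" x] by auto
  qed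
  have "(\<Sum>v\<in>{v \<in> vertices. ?u \<subset> v}. component v f x) = (\<Sum>v\<in>{v \<in> vertices. e \<le> diameter v}. component v f x)"
  proof (rule sum.mono_neutral_left)
    show "{v \<in> vertices. ?u \<subset> v} \<subseteq> {v \<in> vertices. e \<le> diameter v}" using iff by blast
    show "\<forall>v\<in>{v \<in> vertices. e \<le> diameter v} - {v \<in> vertices. ?u \<subset> v}. component v f x = 0"
      using iff component_outside by blast
  qed (rule finite_large_vertices[OF assms])
  moreover have "({} :: 'a set) \<notin> {v \<in> vertices. e \<le> diameter v}" using vertex_nonempty by blast
  ultimately show ?thesis
    using avg_eq_sum_ancestors[OF u, of f] finite_large_vertices[OF assms]
    by (simp add: coarse_def component_empty)
qed


section \<open>Multipliers of the wavelet decomposition\<close>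

lemma countable_vertices: "countable (vertices :: 'a set set)"
proof -
  have "vertices = (\<Union>n. {v \<in> (vertices :: 'a set set). inverse (real (Suc n)) \<le> diameter v})"
  proof (intro set_eqI iffI)
    fix v :: "'a set" assume "v \<in> vertices"
    moreover obtain n where "inverse (real (Suc n)) < diameter v"
      using reals_Archimedean[OF diameter_pos[OF \<open>v \<in> vertices\<close>]] by blast
    ultimately show "v \<in> (\<Union>n. {v \<in> vertices. inverse (real (Suc n)) \<le> diameter v})"
      using less_imp_le by blast
  qed blast
  also have "countable \<dots>"
    by (rule countable_UN) (auto intro!: countable_finite finite_large_vertices)
  finally show ?thesis .
qed

lemma borel_eq_sigma_modes: "sets \<mu> = sigma_sets UNIV modes"
proof -
  have *: "U \<in> sigma_sets UNIV modes" if U: "open U" for U :: "'a set"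
  proof -
    have "\<exists>v\<in>vertices. x \<in> v \<and> v \<subseteq> U" if "x \<in> U" for x
    proof -
      obtain e where "e > 0" "ball x e \<subseteq> U" using U \<open>x \<in> U\<close> open_contains_ball by blast
      then show ?thesis by (intro bexI[of _ "ball x e"]) (auto intro: ball_vertex)
    qed
    then have "U = \<Union>{v \<in> vertices. v \<subseteq> U}" by blast
    moreover have "countable {v \<in> vertices. v \<subseteq> U}" using countable_vertices by (rule countable_subset[rotated]) auto
    then have "\<Union>{v \<in> vertices. v \<subseteq> U} \<in> sigma_sets UNIV modes"
      by (intro sigma_sets_UNION) (auto simp: modes_def intro: sigma_sets.Basic)
    ultimately show ?thesis by simp
  qed
  have "sigma_sets UNIV {U :: 'a set. open U} = sigma_sets UNIV modes"
  proof
    show "sigma_sets UNIV {U :: 'a set. open U} \<subseteq> sigma_sets UNIV modes"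
      by (rule sigma_sets_mono) (use * in auto)
    show "sigma_sets UNIV modes \<subseteq> sigma_sets UNIV {U :: 'a set. open U}"
      by (rule sigma_sets_mono) (auto simp: modes_def intro: sigma_sets.Basic vertex_open)
  qed
  then show ?thesis by (simp add: sets_borel borel_def)
qed

text \<open>The balls, together with the empty set, generate the Borel sets and are stable under
  intersection, so averages over balls determine all integrals over Borel sets.\<close>

lemma eq_AE_if_avg_eq:
  assumes f: "integrable \<mu> f" and g: "integrable \<mu> g"
    and avg: "\<And>v. v \<in> vertices \<Longrightarrow> avg v f = avg v g"
  shows "AE x in \<mu>. f x = g x"
proof (rule density_unique_banach[OF f g])
  define h where "h x = f x - g x" for x
  have h: "integrable \<mu> h" using f g by (simp add: h_def[abs_def])
  have int: "set_integrable \<mu> A h" if "A \<in> sets \<mu>" for A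
    unfolding set_integrable_def using that h by (rule integrable_mult_indicator)
  have vert: "(LINT x:v|\<mu>. h x) = 0" if "v \<in> vertices" for v
    using that avg[OF that] integral_eq_avg[OF that, of f] integral_eq_avg[OF that, of g]
      set_integrable_vertex[OF f that] set_integrable_vertex[OF g that]
    unfolding h_def by (subst set_integral_diff) auto
  have Int: "Int_stable (modes :: 'a set set)"
  proof (rule Int_stableI)
    fix u v :: "'a set" assume "u \<in> modes" "v \<in> modes"
    then show "u \<inter> v \<in> modes"
    proof (cases "u \<inter> v = {}")
      case False
      then obtain x where x: "x \<in> u" "x \<in> v" by blast
      with \<open>u \<in> modes\<close> \<open>v \<in> modes\<close> have uv: "u \<in> vertices" "v \<in> vertices" by (auto simp: modes_def)
      have "u \<subseteq> v \<or> v \<subseteq> u"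
        using vertices_nested[OF uv x] vertices_nested[OF uv(2,1) x(2,1)] by linarith
      then have "u \<inter> v = u \<or> u \<inter> v = v" by blast
      then show ?thesis using \<open>u \<in> modes\<close> \<open>v \<in> modes\<close> by auto
    qed (simp add: modes_def)
  qed
  have zero: "(LINT x:A|\<mu>. h x) = 0" if "A \<in> sigma_sets UNIV modes" for A
  proof (rule sigma_sets_induct_disjoint[OF Int _ that])
    show "modes \<subseteq> Pow UNIV" by simp
    show "(LINT x:A|\<mu>. h x) = 0" if "A \<in> modes" for A
      using that vert by (auto simp: modes_def set_lebesgue_integral_def)
    show "(LINT x:{}|\<mu>. h x) = 0" by (simp add: set_lebesgue_integral_def)
    show "(LINT x:UNIV - A|\<mu>. h x) = 0" if A: "A \<in> sigma_sets UNIV modes" "(LINT x:A|\<mu>. h x) = 0" for A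
    proof -
      have "A \<in> sets \<mu>" using A borel_eq_sigma_modes by simp
      then have "UNIV - A \<in> sets \<mu>" using sets.compl_sets[of A \<mu>] by simp
      have "(LINT x:(UNIV - A) \<union> A|\<mu>. h x) = (LINT x:UNIV - A|\<mu>. h x) + (LINT x:A|\<mu>. h x)"
        using int \<open>A \<in> sets \<mu>\<close> \<open>UNIV - A \<in> sets \<mu>\<close> by (intro set_integral_Un) auto
      then show ?thesis using A vert[OF UNIV_vertex] by simp
    qed
    show "(LINT x:(\<Union>i::nat. A i)|\<mu>. h x) = 0"
      if A: "disjoint_family A" "range A \<subseteq> sigma_sets UNIV modes" "\<And>i. (LINT x:A i|\<mu>. h x) = 0" for A
    proof -
      have "A i \<in> sets \<mu>" for i using A(2) borel_eq_sigma_modes by auto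
      moreover have "A i \<inter> A j = {}" if "i \<noteq> j" for i j
        using A(1) that by (auto simp: disjoint_family_on_def)
      ultimately have "(LINT x:(\<Union>i::nat. A i)|\<mu>. h x) = (\<Sum>i. LINT x:A i|\<mu>. h x)"
        by (intro lebesgue_integral_countable_add int) auto
      then show ?thesis by (simp add: A(3))
    qed
  qed
  fix A assume A: "A \<in> sets \<mu>"
  then have "(LINT x:A|\<mu>. h x) = 0" using zero borel_eq_sigma_modes by blast
  moreover have "set_integrable \<mu> A f" "set_integrable \<mu> A g"
    unfolding set_integrable_def using A f g by (auto intro: integrable_mult_indicator)
  ultimately show "set_lebesgue_integral \<mu> A f = set_lebesgue_integral \<mu> A g"
    unfolding h_def by (subst (asm) set_integral_diff) auto
qed

lemma eq_AE_if_components_eq: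
  assumes "f \<in> L2 \<mu>" "g \<in> L2 \<mu>" "\<And>v x. v \<in> modes \<Longrightarrow> component v f x = component v g x"
  shows "AE x in \<mu>. f x = g x"
proof (rule eq_AE_if_avg_eq)
  fix v :: "'a set" assume "v \<in> vertices"
  then obtain x e where "e > 0" "v = ball x e" by (auto simp: vertices_def)
  moreover have "(\<Sum>v\<in>coarse e. component v f x) = (\<Sum>v\<in>coarse e. component v g x)"
    using coarse_modes by (intro sum.cong refl assms(3)) blast
  ultimately show "avg v f = avg v g" by (simp add: avg_ball_eq_sum)
qed (use assms in \<open>auto intro: L2_integrable\<close>)

subsection \<open>Finite synthesis\<close>

definition synth :: "'a set set \<Rightarrow> ('a set \<Rightarrow> real) \<Rightarrow> ('a \<Rightarrow> complex) \<Rightarrow> 'a \<Rightarrow> complex" where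
  "synth F m f x = (\<Sum>v\<in>F. m v *\<^sub>R component v f x)"

lemma synth_test: "F \<subseteq> modes \<Longrightarrow> synth F m f \<in> test_functions"
  unfolding synth_def by (intro test_sum test_scaleR component_test) auto

lemma synth_L2: "F \<subseteq> modes \<Longrightarrow> synth F m f \<in> L2 \<mu>"
  by (intro test_L2 synth_test)

lemma component_synth:
  assumes "finite F" "F \<subseteq> modes" "w \<in> modes" "integrable \<mu> f"
  shows "component w (synth F m f) x = (if w \<in> F then m w *\<^sub>R component w f x else 0)"
proof -
  have "component w (synth F m f) x = (\<Sum>v\<in>F. m v *\<^sub>R component w (component v f) x)"
    unfolding synth_def using assms
    by (subst component_sum) (auto simp: component_scaleR intro: L2_integrable component_L2)
  also have "\<dots> = (\<Sum>v\<in>F. if v = w then m w *\<^sub>R component w f x else 0)"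
  proof (rule sum.cong)
    fix v assume "v \<in> F"
    then have "v \<in> modes" using assms by blast
    then show "m v *\<^sub>R component w (component v f) x = (if v = w then m w *\<^sub>R component w f x else 0)"
      using assms component_component[of w v f x] by (cases "v = w") simp_all
  qed simp
  finally show ?thesis using assms(1) by simp
qed

lemma component_synth_inner:
  assumes "F \<subseteq> modes" "f \<in> L2 \<mu>" "g \<in> L2 \<mu>"
  shows "L2_inner \<mu> (synth F m f) g =
    (\<Sum>v\<in>F. m v *\<^sub>R L2_inner \<mu> (component v f) (component v g))"
  unfolding synth_def using assms
  by (subst L2_inner_sum_left)
    (auto intro!: L2_scaleR component_L2 sum.cong simp: L2_inner_scaleR_left L2_inner_component_component subset_iff)

lemma L2_norm_synth:
  assumes "finite F" "F \<subseteq> modes" "f \<in> L2 \<mu>"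
  shows "(L2_norm \<mu> (synth F m f))\<^sup>2 = (\<Sum>v\<in>F. (m v)\<^sup>2 * (L2_norm \<mu> (component v f))\<^sup>2)"
proof -
  have "of_real ((L2_norm \<mu> (synth F m f))\<^sup>2) = L2_inner \<mu> (synth F m f) (synth F m f)"
    by (simp only: L2_norm_sq_inner)
  also have "\<dots> = (\<Sum>v\<in>F. m v *\<^sub>R L2_inner \<mu> (component v f) (component v (synth F m f)))"
    using assms by (intro component_synth_inner synth_L2) auto
  also have "\<dots> = (\<Sum>v\<in>F. of_real ((m v)\<^sup>2 * (L2_norm \<mu> (component v f))\<^sup>2))"
  proof (rule sum.cong)
    fix v assume "v \<in> F"
    moreover from this have "v \<in> modes" using assms by blast
    ultimately have "component v (synth F m f) = (\<lambda>x. of_real (m v) * component v f x)"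
      using assms by (intro ext) (simp add: component_synth L2_integrable scaleR_conv_of_real)
    then show "m v *\<^sub>R L2_inner \<mu> (component v f) (component v (synth F m f))
        = of_real ((m v)\<^sup>2 * (L2_norm \<mu> (component v f))\<^sup>2)"
      by (simp add: L2_inner_cmult_right L2_norm_sq_inner scaleR_conv_of_real power2_eq_square)
  qed simp
  finally show ?thesis by (simp only: of_real_sum[symmetric] of_real_eq_iff)
qed

lemma Bessel:
  assumes "finite F" "F \<subseteq> modes" "f \<in> L2 \<mu>"
  shows "(\<Sum>v\<in>F. (L2_norm \<mu> (component v f))\<^sup>2) \<le> (L2_norm \<mu> f)\<^sup>2"
proof -
  let ?N = "L2_norm \<mu> (synth F (\<lambda>_. 1) f)"
  have sq: "?N\<^sup>2 = (\<Sum>v\<in>F. (L2_norm \<mu> (component v f))\<^sup>2)" using L2_norm_synth[OF assms, of "\<lambda>_. 1"] by simp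
  have "L2_inner \<mu> (synth F (\<lambda>_. 1) f) f = of_real (?N\<^sup>2)"
    using component_synth_inner[OF assms(2,3,3), of "\<lambda>_. 1"] unfolding sq
    by (simp add: L2_norm_sq_inner)
  then have "?N\<^sup>2 \<le> ?N * L2_norm \<mu> f"
    using L2_Cauchy_Schwarz[OF synth_L2[OF assms(2)] assms(3), of "\<lambda>_. 1" f] by (simp add: norm_power)
  then have "?N \<le> L2_norm \<mu> f"
    by (metis L2_norm_nonneg mult_le_cancel_left_pos order_le_less power2_eq_square)
  then show ?thesis unfolding sq[symmetric] by (intro power_mono) auto
qed

definition level :: "nat \<Rightarrow> 'a set set" where
  "level n = coarse (inverse (real (Suc n)))"

abbreviation partial_sum :: "nat \<Rightarrow> ('a \<Rightarrow> complex) \<Rightarrow> 'a \<Rightarrow> complex" where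
  "partial_sum n \<equiv> synth (level n) (\<lambda>_. 1)"

lemma finite_level [simp]: "finite (level n)"
  by (simp add: level_def finite_coarse)

lemma level_modes: "level n \<subseteq> modes"
  by (simp add: level_def coarse_modes)

lemma level_mono: "k \<le> n \<Longrightarrow> level k \<subseteq> level n"
  unfolding level_def by (intro coarse_mono) (simp add: field_simps)

lemma eventually_in_level:
  assumes "v \<in> modes" shows "eventually (\<lambda>n. v \<in> level n) sequentially"
proof -
  have "\<exists>k. v \<in> level k"
  proof (cases "v = {}")
    case False
    then have "v \<in> vertices" using assms by (simp add: modes_def)
    then show ?thesis using reals_Archimedean[OF diameter_pos, of v]
      by (auto simp: level_def coarse_def intro: less_imp_le)
  qed (simp add: level_def coarse_def)
  then show ?thesis using level_mono eventually_sequentially by blast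
qed

lemma synth_diff:
  assumes "finite G" "F \<subseteq> G"
  shows "synth G m f x - synth F m f x = synth (G - F) m f x"
  unfolding synth_def using assms by (simp add: sum_diff)

subsection \<open>Multiplier relations\<close>

text \<open>A relation rather than an operation on functions, because the components determine a
  function only almost everywhere.\<close>

definition diagonal :: "('a set \<Rightarrow> real) \<Rightarrow> ('a \<Rightarrow> complex) \<Rightarrow> ('a \<Rightarrow> complex) \<Rightarrow> bool" where
  "diagonal m f g \<longleftrightarrow> f \<in> L2 \<mu> \<and> g \<in> L2 \<mu> \<and>
     (\<forall>v\<in>modes. \<forall>x. component v g x = m v *\<^sub>R component v f x)"

lemma diagonalD:
  assumes "diagonal m f g"
  shows "f \<in> L2 \<mu>" "g \<in> L2 \<mu>" "v \<in> modes \<Longrightarrow> component v g x = m v *\<^sub>R component v f x"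
  using assms by (auto simp: diagonal_def)

lemma diagonal_unique:
  assumes "diagonal m f g" "diagonal m f' g'" "AE x in \<mu>. f x = f' x"
  shows "AE x in \<mu>. g x = g' x"
proof -
  have "component v f x = component v f' x" if "v \<in> modes" for v x
    using assms that by (intro component_cong_AE) (auto simp: diagonal_def intro: L2_measurable)
  then show ?thesis using assms by (intro eq_AE_if_components_eq) (auto simp: diagonal_def)
qed

lemma diagonal_cong:
  "diagonal m f g \<Longrightarrow> (\<And>v. v \<in> modes \<Longrightarrow> m v = m' v) \<Longrightarrow> diagonal m' f g"
  by (simp add: diagonal_def)

lemma diagonal_lincomb:
  assumes "diagonal m f g" "diagonal m f' g'"
  shows "diagonal m (\<lambda>x. a * f x + b * f' x) (\<lambda>x. a * g x + b * g' x)"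
  using assms
  by (simp add: diagonal_def L2_add L2_cmult component_add component_cmult L2_integrable algebra_simps)

lemma diagonal_compose:
  "diagonal m f g \<Longrightarrow> diagonal m' g h \<Longrightarrow> diagonal (\<lambda>v. m' v * m v) f h"
  by (simp add: diagonal_def)

lemma diagonal_synth:
  assumes "diagonal m f g" shows "partial_sum n g = synth (level n) m f"
  using diagonalD(3)[OF assms] level_modes unfolding synth_def by (intro ext sum.cong) auto

lemma abs_le_imp_sq_le: "\<bar>r\<bar> \<le> K \<Longrightarrow> r\<^sup>2 \<le> (K :: real)\<^sup>2"
  using power_mono[of "\<bar>r\<bar>" K 2] by simp

text \<open>The squared norms of the partial sums increase and are bounded by Bessel's inequality.\<close>

lemma synth_Cauchy:
  assumes f: "f \<in> L2 \<mu>" and m: "\<And>v. v \<in> modes \<Longrightarrow> \<bar>m v\<bar> \<le> K" and e: "e > 0"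
  shows "\<exists>N. \<forall>j\<ge>N. \<forall>k\<ge>N. L2_norm \<mu> (\<lambda>x. synth (level j) m f x - synth (level k) m f x) < e"
proof -
  define a where "a n = (\<Sum>v\<in>level n. (m v)\<^sup>2 * (L2_norm \<mu> (component v f))\<^sup>2)" for n
  have diff: "(L2_norm \<mu> (\<lambda>x. synth (level j) m f x - synth (level k) m f x))\<^sup>2 = a j - a k" if "k \<le> j" for j k
  proof -
    have sub: "level k \<subseteq> level j" using that by (rule level_mono)
    have "(\<lambda>x. synth (level j) m f x - synth (level k) m f x) = synth (level j - level k) m f"
      using synth_diff[OF _ sub] by auto
    moreover have "level j - level k \<subseteq> modes" using level_modes by blast
    ultimately show ?thesis using L2_norm_synth[of "level j - level k" f m] f sub
      by (simp add: a_def sum_diff)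
  qed
  have mono: "a k \<le> a j" if "k \<le> j" for j k
    using diff[OF that] zero_le_power2 by (metis diff_ge_0_iff_ge)
  have "a n \<le> K\<^sup>2 * (L2_norm \<mu> f)\<^sup>2" for n
  proof -
    have "a n \<le> (\<Sum>v\<in>level n. K\<^sup>2 * (L2_norm \<mu> (component v f))\<^sup>2)"
      unfolding a_def using m level_modes
      by (intro sum_mono mult_right_mono abs_le_imp_sq_le) auto
    also have "\<dots> \<le> K\<^sup>2 * (L2_norm \<mu> f)\<^sup>2"
      unfolding sum_distrib_left[symmetric] using Bessel[OF finite_level level_modes f]
      by (intro mult_left_mono) auto
    finally show ?thesis .
  qed
  then have "Bseq a" by (intro BseqI'[of _ "K\<^sup>2 * (L2_norm \<mu> f)\<^sup>2"]) (simp add: a_def sum_nonneg)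
  moreover have "monoseq a" using mono by (simp add: monoseq_def)
  ultimately have "convergent a" by (rule Bseq_monoseq_convergent)
  then have "Cauchy a" by (rule convergent_Cauchy)
  then obtain N where N: "\<And>j k. j \<ge> N \<Longrightarrow> k \<ge> N \<Longrightarrow> dist (a j) (a k) < e\<^sup>2"
    using e unfolding Cauchy_def by (meson zero_less_power)
  have "L2_norm \<mu> (\<lambda>x. synth (level j) m f x - synth (level k) m f x) < e" if "N \<le> k" "k \<le> j" for j k
  proof (rule power2_less_imp_less)
    show "(L2_norm \<mu> (\<lambda>x. synth (level j) m f x - synth (level k) m f x))\<^sup>2 < e\<^sup>2"
      unfolding diff[OF that(2)] using N[of j k] that by (simp add: dist_real_def)
  qed (use e in simp)
  then have "\<forall>j\<ge>N. \<forall>k\<ge>N. L2_norm \<mu> (\<lambda>x. synth (level j) m f x - synth (level k) m f x) < e"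
    by (metis L2_norm_minus_commute nle_le)
  then show ?thesis by blast
qed

lemma multiplier_exists:
  assumes f: "f \<in> L2 \<mu>" and m: "\<And>v. v \<in> modes \<Longrightarrow> \<bar>m v\<bar> \<le> K"
  shows "\<exists>g. diagonal m f g \<and> L2_tendsto \<mu> (\<lambda>n. synth (level n) m f) g"
proof -
  let ?S = "\<lambda>n. synth (level n) m f"
  have S: "?S n \<in> L2 \<mu>" for n using level_modes by (rule synth_L2)
  have "\<exists>g\<in>L2 \<mu>. (\<lambda>n. L2_norm \<mu> (\<lambda>x. ?S n x - g x)) \<longlonglongrightarrow> 0"
    using S synth_Cauchy[OF f m] by (rule L2_complete)
  then obtain g where g: "g \<in> L2 \<mu>" "(\<lambda>n. L2_norm \<mu> (\<lambda>x. ?S n x - g x)) \<longlonglongrightarrow> 0"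
    by blast
  have "component v g x = m v *\<^sub>R component v f x" if v: "v \<in> modes" for v x
  proof (rule LIMSEQ_unique)
    show "(\<lambda>n. component v (?S n) x) \<longlonglongrightarrow> component v g x"
      using S g v by (rule component_tendsto)
    have "eventually (\<lambda>n. component v (?S n) x = m v *\<^sub>R component v f x) sequentially"
      using eventually_in_level[OF v]
      by eventually_elim (simp add: component_synth level_modes v L2_integrable f)
    then show "(\<lambda>n. component v (?S n) x) \<longlonglongrightarrow> m v *\<^sub>R component v f x"
      by (rule tendsto_eventually)
  qed
  then show ?thesis using f g unfolding diagonal_def by blast
qed

text \<open>Completeness of the wavelet system: the partial sums converge by Riesz--Fischer, and their
  limit agrees with \<open>f\<close> because it has the same components.\<close>

lemma synth_tendsto:
  assumes f: "f \<in> L2 \<mu>"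
  shows "L2_tendsto \<mu> (\<lambda>n. partial_sum n f) f"
proof -
  obtain g where g: "diagonal (\<lambda>_. 1) f g"
      "L2_tendsto \<mu> (\<lambda>n. partial_sum n f) g"
    using multiplier_exists[OF f, of "\<lambda>_. 1" 1] by auto
  have ae: "AE x in \<mu>. f x = g x"
    using g(1) by (intro eq_AE_if_components_eq) (auto simp: diagonal_def)
  have "L2_norm \<mu> (\<lambda>x. partial_sum n f x - g x) = L2_norm \<mu> (\<lambda>x. partial_sum n f x - f x)" for n
    using ae diagonalD(1,2)[OF g(1)] synth_L2[OF level_modes]
    by (intro L2_norm_cong_AE L2_measurable[OF L2_diff]) auto
  then show ?thesis using g(2) by simp
qed

lemma multiplier_norm_le:
  assumes fg: "diagonal m f g" and m: "\<And>v. v \<in> modes \<Longrightarrow> \<bar>m v\<bar> \<le> K" and K: "K \<ge> 0"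
  shows "L2_norm \<mu> g \<le> K * L2_norm \<mu> f"
proof (rule LIMSEQ_le)
  note f = diagonalD(1)[OF fg] and g = diagonalD(2)[OF fg]
  show "(\<lambda>n. L2_norm \<mu> (partial_sum n g)) \<longlonglongrightarrow> L2_norm \<mu> g"
    by (intro L2_norm_tendsto synth_L2 level_modes g synth_tendsto)
  show "(\<lambda>n. K * L2_norm \<mu> (partial_sum n f)) \<longlonglongrightarrow> K * L2_norm \<mu> f"
    by (intro tendsto_mult_left L2_norm_tendsto synth_L2 level_modes f synth_tendsto)
  have "L2_norm \<mu> (partial_sum n g) \<le> K * L2_norm \<mu> (partial_sum n f)" for n
  proof (rule power2_le_imp_le)
    have "(L2_norm \<mu> (partial_sum n g))\<^sup>2
        = (\<Sum>v\<in>level n. (m v)\<^sup>2 * (L2_norm \<mu> (component v f))\<^sup>2)"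
      unfolding diagonal_synth[OF fg] using f by (simp add: L2_norm_synth level_modes)
    also have "\<dots> \<le> (\<Sum>v\<in>level n. K\<^sup>2 * (L2_norm \<mu> (component v f))\<^sup>2)"
      using m level_modes by (intro sum_mono mult_right_mono abs_le_imp_sq_le) auto
    also have "\<dots> = (K * L2_norm \<mu> (partial_sum n f))\<^sup>2"
      using f by (simp add: power_mult_distrib L2_norm_synth level_modes sum_distrib_left)
    finally show "(L2_norm \<mu> (partial_sum n g))\<^sup>2 \<le> (K * L2_norm \<mu> (partial_sum n f))\<^sup>2" .
  qed (use K in simp)
  then show "\<exists>N. \<forall>n\<ge>N. L2_norm \<mu> (partial_sum n g) \<le> K * L2_norm \<mu> (partial_sum n f)"
    by blast
qed

text \<open>Dominated convergence for multipliers: up to a small error in the norm only finitely many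
  components matter.\<close>

lemma multiplier_tendsto_0:
  fixes m :: "real \<Rightarrow> 'a set \<Rightarrow> real"
  assumes h: "\<And>t. t > 0 \<Longrightarrow> diagonal (m t) f (h t)"
    and bound: "\<And>t v. t > 0 \<Longrightarrow> v \<in> modes \<Longrightarrow> \<bar>m t v\<bar> \<le> 1"
    and lim: "\<And>v. v \<in> modes \<Longrightarrow> ((\<lambda>t. m t v) \<longlongrightarrow> 0) (at_right 0)"
  shows "((\<lambda>t. L2_norm \<mu> (h t)) \<longlongrightarrow> 0) (at_right 0)"
proof (rule tendstoI)
  fix e :: real assume "e > 0"
  have f: "f \<in> L2 \<mu>" using diagonalD(1)[OF h[of 1]] by simp
  let ?S = "\<lambda>n m. synth (level n) m f"
  obtain n where n: "L2_norm \<mu> (\<lambda>x. ?S n (\<lambda>_. 1) x - f x) < e / 2"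
    using LIMSEQ_D[OF synth_tendsto[OF f], of "e / 2"] \<open>e > 0\<close> by auto
  have "((\<lambda>t. (L2_norm \<mu> (?S n (m t)))\<^sup>2) \<longlongrightarrow> (\<Sum>v\<in>level n. 0\<^sup>2 * (L2_norm \<mu> (component v f))\<^sup>2)) (at_right 0)"
    using level_modes f
    by (simp only: L2_norm_synth finite_level) (intro tendsto_sum tendsto_mult tendsto_power tendsto_const lim, auto)
  then have "((\<lambda>t. sqrt ((L2_norm \<mu> (?S n (m t)))\<^sup>2)) \<longlongrightarrow> sqrt 0) (at_right 0)"
    by (intro tendsto_real_sqrt) simp
  then have "eventually (\<lambda>t. L2_norm \<mu> (?S n (m t)) < e / 2) (at_right 0)"
    using \<open>e > 0\<close> by (intro order_tendstoD(2)) auto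
  moreover have "eventually (\<lambda>t::real. t > 0) (at_right 0)" by (simp add: eventually_at_right_less)
  ultimately show "eventually (\<lambda>t. dist (L2_norm \<mu> (h t)) 0 < e) (at_right 0)"
  proof eventually_elim
    case (elim t)
    note ht = diagonalD(2)[OF h[OF elim(2)]]
    have S: "?S n k \<in> L2 \<mu>" for k using level_modes by (rule synth_L2)
    have "diagonal (m t) (\<lambda>x. f x - ?S n (\<lambda>_. 1) x) (\<lambda>x. h t x - ?S n (m t) x)"
      using h[OF elim(2)] S
      by (auto simp: diagonal_def L2_diff component_diff L2_integrable component_synth level_modes scaleR_diff_right)
    then have "L2_norm \<mu> (\<lambda>x. h t x - ?S n (m t) x) \<le> 1 * L2_norm \<mu> (\<lambda>x. f x - ?S n (\<lambda>_. 1) x)"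
      using bound elim by (intro multiplier_norm_le) auto
    also have "\<dots> < e / 2" using n by (simp add: L2_norm_minus_commute)
    finally have "L2_norm \<mu> (\<lambda>x. h t x - ?S n (m t) x) < e / 2" .
    moreover have "L2_norm \<mu> (h t) \<le> L2_norm \<mu> (\<lambda>x. h t x - ?S n (m t) x) + L2_norm \<mu> (?S n (m t))"
      using L2_norm_triangle_diff[OF ht S L2_zero, of "m t"] by simp
    ultimately show ?case using elim by simp
  qed
qed

end

section \<open>The Dirichlet form in terms of the wavelets\<close>

lemma scale_measure_eq_density:
  assumes "r \<ge> 0"
  shows "scale_measure (ennreal r) M = density M (\<lambda>_. ennreal r)"
  by (rule measure_eqI) (simp_all add: emeasure_density_const)

text \<open>The commutator \<open>[\<sigma>\<^sub>1, diag(a, b)]\<close> is antidiagonal with entries \<open>b - a\<close> and \<open>a - b\<close>, so both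
  diagonal entries of the product are \<open>diam([v])\<^sup>s\<^sup>-\<^sup>2\<close> times the product of the increments.\<close>

lemma trace_fibre:
  assumes "diameter v > 0"
  shows "trace (op_mult (abs_dirac_powr (- of_real s))
      (op_mult (op_adjoint (op_commutator dirac (rep \<tau> f))) (op_commutator dirac (rep \<tau> g))) v) =
    of_real (2 * diameter v powr (s - 2)) *
      (cnj (f (fst (\<tau> v)) - f (snd (\<tau> v))) * (g (fst (\<tau> v)) - g (snd (\<tau> v))))"
proof -
  define d where "d = diameter v"
  have d: "d > 0" using assms by (simp add: d_def)
  have "complex_of_real (1 / d) powr (- of_real s) = of_real ((1 / d) powr (- s))"
    using d powr_of_real[of "1 / d" "- s"] by simp
  also have "(1 / d) powr (- s) = d powr s"
    using d by (simp add: powr_divide powr_minus_divide)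
  finally have p: "complex_of_real (1 / d) powr (- of_real s) = of_real (d powr s)" .
  \<comment> \<open>The factor \<open>d powr s\<close> is \<open>|D|\<^sup>-\<^sup>s\<close>, and each commutator with \<open>D\<close> contributes \<open>1 / d\<close>.\<close>
  have "d powr (s - 2) = d powr s * (1 / d)\<^sup>2"
    using d by (simp add: powr_diff powr_numeral power_divide)
  then have q: "of_real (2 * d powr (s - 2)) = (2 * of_real (d powr s) * (1 / of_real d)\<^sup>2 :: complex)"
    by simp
  show ?thesis
    unfolding op_mult_def op_adjoint_def op_commutator_def abs_dirac_powr_def dirac_def rep_def sigma1_def
      d_def[symmetric] p q
    by (simp add: trace_def matrix_matrix_mult_def mat_def sum_2)
      (simp add: scaleR_conv_of_real power2_eq_square algebra_simps)
qed

context cantor_measure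
begin

sublocale pair: pair_prob_space \<mu> \<mu> ..

text \<open>The first point lies in one of the finitely many children of \<open>v\<close> and the second one in the rest
  of \<open>v\<close>, so \<open>choices v\<close> is a finite union of rectangles.\<close>

lemma measurable_choices [measurable]:
  assumes v: "v \<in> vertices" shows "choices v \<in> sets (\<mu> \<Otimes>\<^sub>M \<mu>)"
proof -
  have "choices v = (\<Union>u\<in>children v. u \<times> (v - u))"
  proof (intro subset_antisym subrelI)
    fix x y assume p: "(x, y) \<in> choices v"
    let ?u = "ball x (diameter v)"
    have "x \<in> v" "y \<in> v - ?u" using p by (auto simp: choices_eq[OF v])
    moreover have "?u \<in> children v" using \<open>x \<in> v\<close> by (simp add: children_eq[OF v])
    moreover have "x \<in> ?u" by (rule in_child[OF v])
    ultimately have "(x, y) \<in> ?u \<times> (v - ?u)" by blast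
    with \<open>?u \<in> children v\<close> show "(x, y) \<in> (\<Union>u\<in>children v. u \<times> (v - u))" by blast
  next
    fix x y assume p: "(x, y) \<in> (\<Union>u\<in>children v. u \<times> (v - u))"
    obtain u where u: "u \<in> children v" "x \<in> u" "y \<in> v" "y \<notin> u" using p by blast
    then have "x \<in> v" using children_Union[OF v] by blast
    obtain z where "u = ball z (diameter v)" using u by (auto simp: children_eq[OF v])
    with ball_eq[of x z "diameter v"] u have "u = ball x (diameter v)" by blast
    then show "(x, y) \<in> choices v" using u \<open>x \<in> v\<close> by (simp add: choices_eq[OF v])
  qed
  moreover have "u \<times> (v - u) \<in> sets (\<mu> \<Otimes>\<^sub>M \<mu>)" if "u \<in> children v" for u
    using vertex_sets[OF v] vertex_sets[OF child_in_vertices[OF that]] by measurable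
  then have "(\<Union>u\<in>children v. u \<times> (v - u)) \<in> sets (\<mu> \<Otimes>\<^sub>M \<mu>)"
    by (intro sets.finite_UN finite_children v)
  ultimately show ?thesis by simp
qed

abbreviation choice_mass :: "'a set \<Rightarrow> real" where
  "choice_mass v \<equiv> measure (\<mu> \<Otimes>\<^sub>M \<mu>) (choices v)"

lemma measure_choices_pos:
  assumes v: "v \<in> vertices" shows "choice_mass v > 0"
proof -
  obtain x where x: "x \<in> v" using vertex_nonempty[OF v] by blast
  obtain y where y: "y \<in> v" "dist x y = diameter v" using diameter_attained_at[OF v x] by blast
  let ?a = "ball x (diameter v)" and ?b = "ball y (diameter v)"
  have ab: "?a \<in> vertices" "?b \<in> vertices" using child_vertex[OF v] by auto
  have "y \<notin> ?a" using y by simp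
  then have "?a \<noteq> ?b" using in_child[OF v, of y] by blast
  then have "?a \<inter> ?b = {}" using ball_eq_iff[OF diameter_pos[OF v], of x y] by blast
  then have sub: "?a \<times> ?b \<subseteq> choices v"
    
  proof (clarify)
    fix a b assume "a \<in> ?a" "b \<in> ?b"
    moreover from this have "ball a (diameter v) = ?a" using ball_eq by blast
    moreover have "?a \<subseteq> v" "?b \<subseteq> v" using ball_diameter_psubset[OF v] x y by blast+
    ultimately show "(a, b) \<in> choices v"
      unfolding choices_eq[OF v] using \<open>?a \<inter> ?b = {}\<close> by blast
  qed
  have "0 < measure \<mu> ?a * measure \<mu> ?b" using ab by (simp add: vertex_measure_pos)
  also have "\<dots> = measure (\<mu> \<Otimes>\<^sub>M \<mu>) (?a \<times> ?b)"
    using ab[THEN vertex_sets] 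
    by (simp add: measure_def emeasure_pair_measure_Times enn2real_mult)
  also have "\<dots> \<le> choice_mass v"
    by (rule pair.P.finite_measure_mono[OF sub measurable_choices[OF v]])
  finally show ?thesis .
qed

definition form_at :: "'a set \<Rightarrow> ('a \<Rightarrow> complex) \<Rightarrow> ('a \<Rightarrow> complex) \<Rightarrow> complex" where
  "form_at v f g = (LINT p|(\<mu> \<Otimes>\<^sub>M \<mu>).
     indicator (choices v) p *\<^sub>R (cnj (f (fst p) - f (snd p)) * (g (fst p) - g (snd p))))"

definition weight :: "real \<Rightarrow> 'a set \<Rightarrow> real" where
  "weight s v = diameter v powr (s - 2) / choice_mass v"

lemma weight_nonneg: "weight s v \<ge> 0"
  by (simp add: weight_def)

definition choice_factor :: "'a set \<Rightarrow> ('a \<times> 'a) measure" where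
  "choice_factor v = scale_measure (1 / emeasure (\<mu> \<Otimes>\<^sub>M \<mu>) (choices v))
     (restrict_space (\<mu> \<Otimes>\<^sub>M \<mu>) (choices v))"

text \<open>Integration against a rescaled measure is integration against a constant density.\<close>

lemma choice_factor_eq_density:
  assumes v: "v \<in> vertices"
  shows "choice_factor v = density (restrict_space (\<mu> \<Otimes>\<^sub>M \<mu>) (choices v))
    (\<lambda>_. ennreal (1 / choice_mass v))"
proof -
  have "1 / emeasure (\<mu> \<Otimes>\<^sub>M \<mu>) (choices v) = ennreal (1 / choice_mass v)"
    using measure_choices_pos[OF v]
    by (simp add: pair.P.emeasure_eq_measure divide_ennreal[symmetric])
  then show ?thesis unfolding choice_factor_def
    using measure_choices_pos[OF v] by (simp add: scale_measure_eq_density)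
qed

lemma space_choice_factor: "space (choice_factor v) = choices v"
  by (simp add: choice_factor_def space_scale_measure space_restrict_space space_pair_measure)

lemma prob_space_choice_factor:
  assumes v: "v \<in> vertices" shows "prob_space (choice_factor v)"
proof (rule prob_spaceI)
  have e: "emeasure (\<mu> \<Otimes>\<^sub>M \<mu>) (choices v) \<noteq> 0" "emeasure (\<mu> \<Otimes>\<^sub>M \<mu>) (choices v) \<noteq> \<infinity>"
    using measure_choices_pos[OF v] by (auto simp: pair.P.emeasure_eq_measure)
  have "emeasure (choice_factor v) (space (choice_factor v)) =
      1 / emeasure (\<mu> \<Otimes>\<^sub>M \<mu>) (choices v) * emeasure (\<mu> \<Otimes>\<^sub>M \<mu>) (choices v)"
    unfolding space_choice_factor unfolding choice_factor_def
    using measurable_choices[OF v] by (simp add: emeasure_restrict_space)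
  also have "\<dots> = 1" using e by (simp add: ennreal_divide_times divide_eq_1_ennreal)
  finally show "emeasure (choice_factor v) (space (choice_factor v)) = 1" .
qed

lemma increment_measurable:
  assumes "f \<in> test_functions" "g \<in> test_functions"
  shows "(\<lambda>p. cnj (f (fst p) - f (snd p)) * (g (fst p) - g (snd p))) \<in> borel_measurable (\<mu> \<Otimes>\<^sub>M \<mu>)"
proof -
  have [measurable]: "f \<in> borel_measurable \<mu>" "g \<in> borel_measurable \<mu>"
    using assms by (simp_all add: test_measurable)
  show ?thesis by measurable
qed

lemma increment_bounded:
  assumes f: "f \<in> test_functions" and g: "g \<in> test_functions"
  shows "\<exists>B. \<forall>p::'a \<times> 'a. norm (cnj (f (fst p) - f (snd p)) * (g (fst p) - g (snd p))) \<le> B"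
proof -
  obtain a b where ab: "\<And>x. norm (f x) \<le> a" "\<And>x. norm (g x) \<le> b"
    using test_bounded[OF f] test_bounded[OF g] by blast
  have "norm (cnj (f x - f y) * (g x - g y)) \<le> (a + a) * (b + b)" for x y
    unfolding norm_mult complex_mod_cnj
    by (intro mult_mono order_trans[OF norm_triangle_ineq4] add_mono ab) (auto intro: order_trans[OF norm_ge_zero ab(1)])
  then show ?thesis by blast
qed

lemma integral_choice_factor:
  assumes v: "v \<in> vertices" and f: "f \<in> test_functions" and g: "g \<in> test_functions"
  shows "integrable (choice_factor v) (\<lambda>p. cnj (f (fst p) - f (snd p)) * (g (fst p) - g (snd p)))"
    and "(LINT p|choice_factor v. cnj (f (fst p) - f (snd p)) * (g (fst p) - g (snd p))) =
      (1 / choice_mass v) *\<^sub>R form_at v f g"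
proof -
  let ?h = "\<lambda>p. cnj (f (fst p) - f (snd p)) * (g (fst p) - g (snd p))"
  interpret F: prob_space "choice_factor v" by (rule prob_space_choice_factor[OF v])
  have [measurable]: "?h \<in> borel_measurable (\<mu> \<Otimes>\<^sub>M \<mu>)" by (rule increment_measurable[OF f g])
  have m: "?h \<in> borel_measurable (restrict_space (\<mu> \<Otimes>\<^sub>M \<mu>) (choices v))"
    by (rule measurable_restrict_space1) measurable
  then have "?h \<in> borel_measurable (choice_factor v)"
    by (simp add: choice_factor_eq_density[OF v])
  moreover obtain B where "\<forall>p. norm (?h p) \<le> B" using increment_bounded[OF f g] by blast
  ultimately show "integrable (choice_factor v) ?h"
    by (intro F.integrable_const_bound[of _ B]) auto
  have "(LINT p|choice_factor v. ?h p) =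
      (LINT p|restrict_space (\<mu> \<Otimes>\<^sub>M \<mu>) (choices v). (1 / choice_mass v) *\<^sub>R ?h p)"
    unfolding choice_factor_eq_density[OF v] by (rule integral_density[OF m]) auto
  also have "\<dots> = (1 / choice_mass v) *\<^sub>R
      (LINT p|restrict_space (\<mu> \<Otimes>\<^sub>M \<mu>) (choices v). ?h p)"
    by (rule Bochner_Integration.integral_scaleR_right)
  also have "(LINT p|restrict_space (\<mu> \<Otimes>\<^sub>M \<mu>) (choices v). ?h p) = form_at v f g"
    unfolding form_at_def using measurable_choices[OF v]
    by (subst integral_restrict_space) (auto simp: split_def space_pair_measure)
  finally show "(LINT p|choice_factor v. ?h p) = (1 / choice_mass v) *\<^sub>R form_at v f g" .
qed

text \<open>Only the finitely many balls on which \<open>f\<close> is not constant contribute to the trace, so the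
  trace and the integral over the choice functions can be exchanged.\<close>

lemma form_Q_eq_sum:
  assumes f: "constant_at e f" "e > 0" and g: "g \<in> test_functions"
  shows "form_Q s \<mu> f g = (\<Sum>v\<in>{v \<in> vertices. e \<le> diameter v}. weight s v *\<^sub>R form_at v f g)"
proof -
  have f': "f \<in> test_functions" using f test_functions_iff by blast
  let ?L = "{v \<in> (vertices :: 'a set set). e \<le> diameter v}"
  have fin: "finite ?L" by (rule finite_large_vertices[OF f(2)])
  let ?h = "\<lambda>p. cnj (f (fst p) - f (snd p)) * (g (fst p) - g (snd p))"
  let ?t = "\<lambda>\<tau>. op_trace (op_mult (abs_dirac_powr (- of_real s))
       (op_mult (op_adjoint (op_commutator dirac (rep \<tau> f))) (op_commutator dirac (rep \<tau> g))))"
  let ?P = "\<Pi>\<^sub>M v\<in>vertices. choice_factor v"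
  have cm: "choice_measure \<mu> = ?P" by (simp add: choice_measure_def choice_factor_def)
  have tr: "?t \<tau> = (\<Sum>v\<in>?L. of_real (2 * diameter v powr (s - 2)) * ?h (\<tau> v))" if "\<tau> \<in> space ?P" for \<tau>
  proof -
    have ch: "\<tau> v \<in> choices v" if "v \<in> vertices" for v
      using \<open>\<tau> \<in> space ?P\<close> that by (auto simp: space_PiM space_choice_factor)
    have "?h (\<tau> v) = 0" if "v \<in> vertices" "\<not> e \<le> diameter v" for v
    proof -
      have "dist (fst (\<tau> v)) (snd (\<tau> v)) < e"
        using ch[OF that(1)] that(2) by (auto simp: choices_def)
      then have "f (fst (\<tau> v)) = f (snd (\<tau> v))" using f(1) by (simp add: constant_at_def)
      then show ?thesis by simp
    qed
    then have "?t \<tau> = infsum (\<lambda>v. of_real (2 * diameter v powr (s - 2)) * ?h (\<tau> v)) ?L"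
      unfolding op_trace_def
      by (intro infsum_cong_neutral) (auto simp: trace_fibre diameter_pos)
    then show ?thesis using fin by simp
  qed
  have ps: "\<And>v. v \<in> vertices \<Longrightarrow> prob_space (choice_factor v)" by (rule prob_space_choice_factor)
  have proj: "(\<lambda>\<tau>. \<tau> v) \<in> measurable ?P (choice_factor v)" if "v \<in> vertices" for v
    using that by (rule measurable_component_singleton)
  have distr: "distr ?P (choice_factor v) (\<lambda>\<tau>. \<tau> v) = choice_factor v" if "v \<in> vertices" for v
    using distr_PiM_component[of vertices choice_factor v, OF ps that] .
  have int: "integrable ?P (\<lambda>\<tau>. ?h (\<tau> v))" if "v \<in> vertices" for v
    by (intro integrable_distr[OF proj[OF that]])
      (simp only: distr[OF that] integral_choice_factor(1)[OF that f' g])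
  have val: "(LINT \<tau>|?P. ?h (\<tau> v)) = (1 / choice_mass v) *\<^sub>R form_at v f g"
    if "v \<in> vertices" for v
  proof -
    have "?h \<in> borel_measurable (choice_factor v)"
      using integral_choice_factor(1)[OF that f' g] by (rule borel_measurable_integrable)
    then have "(LINT \<tau>|?P. ?h (\<tau> v)) = (LINT p|distr ?P (choice_factor v) (\<lambda>\<tau>. \<tau> v). ?h p)"
      by (intro integral_distr[symmetric] proj that)
    then show ?thesis
      by (simp only: distr[OF that] integral_choice_factor(2)[OF that f' g])
  qed
  have "form_Q s \<mu> f g = 1 / 2 * (LINT \<tau>|?P. (\<Sum>v\<in>?L. of_real (2 * diameter v powr (s - 2)) * ?h (\<tau> v)))"
    unfolding form_Q_def cm
    by (rule arg_cong[where f = "\<lambda>i. 1 / 2 * i"]) (rule Bochner_Integration.integral_cong[OF refl tr])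
  also have "\<dots> = 1 / 2 * (\<Sum>v\<in>?L. of_real (2 * diameter v powr (s - 2)) * (LINT \<tau>|?P. ?h (\<tau> v)))"
    using int by (subst Bochner_Integration.integral_sum) (auto intro!: integrable_mult_right)
  also have "\<dots> = (\<Sum>v\<in>?L. weight s v *\<^sub>R form_at v f g)"
    unfolding sum_distrib_left
  proof (rule sum.cong[OF refl])
    fix v assume "v \<in> ?L"
    then have v: "v \<in> vertices" by simp
    show "1 / 2 * (of_real (2 * diameter v powr (s - 2)) * (LINT \<tau>|?P. ?h (\<tau> v))) = weight s v *\<^sub>R form_at v f g"
      unfolding val[OF v] by (simp add: weight_def scaleR_conv_of_real)
  qed
  finally show ?thesis .
qed


text \<open>The operator behind the contribution of \<open>v\<close> to the form: \<open>f x - f y\<close> is integrated over the \<open>y\<close>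
  that lie in another child of \<open>v\<close> than \<open>x\<close>.\<close>

definition jump :: "'a set \<Rightarrow> ('a \<Rightarrow> complex) \<Rightarrow> 'a \<Rightarrow> complex" where
  "jump v f x = indicator v x *\<^sub>R (LINT y:(v - ball x (diameter v))|\<mu>. f x - f y)"

lemma far_sets [measurable]: "v \<in> vertices \<Longrightarrow> v - ball x r \<in> sets \<mu>"
  using vertex_sets ball_sets by blast

lemma set_integrable_far:
  "integrable \<mu> f \<Longrightarrow> v \<in> vertices \<Longrightarrow> set_integrable \<mu> (v - ball x r) (f :: 'a \<Rightarrow> complex)"
  unfolding set_integrable_def by (rule integrable_mult_indicator[OF far_sets])

text \<open>Exchanging \<open>x\<close> and \<open>y\<close> preserves \<open>choices v\<close> and changes the sign of the increment of \<open>f\<close>, so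
  both terms of the increment of \<open>g\<close> contribute equally.\<close>

lemma form_at_eq_jump:
  assumes v: "v \<in> vertices" and f: "f \<in> test_functions" and g: "g \<in> test_functions"
  shows "form_at v f g = 2 * L2_inner \<mu> (jump v f) g"
proof -
  have [measurable]: "f \<in> borel_measurable \<mu>" "g \<in> borel_measurable \<mu>"
    using f g by (simp_all add: test_measurable)
  note measurable_choices[OF v, measurable]
  let ?C = "indicat_real (choices v)"
  let ?a = "\<lambda>p. ?C p *\<^sub>R (cnj (f (fst p) - f (snd p)) * g (fst p))"
  let ?b = "\<lambda>p. ?C p *\<^sub>R (cnj (f (fst p) - f (snd p)) * g (snd p))"
  obtain a b where ab: "\<And>x. norm (f x) \<le> a" "\<And>x. norm (g x) \<le> b"
    using test_bounded[OF f] test_bounded[OF g] by blast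
  have nn: "0 \<le> a" "0 \<le> b" using ab norm_ge_zero order_trans by blast+
  have bd: "norm (?C p *\<^sub>R (cnj (f x - f y) * g z)) \<le> (a + a) * b" for p x y z
  proof -
    have "norm (cnj (f x - f y) * g z) \<le> (a + a) * b"
      unfolding norm_mult complex_mod_cnj
      using nn by (intro mult_mono order_trans[OF norm_triangle_ineq4] add_mono ab) auto
    then show ?thesis using nn by (auto simp: indicator_def)
  qed
  have inta: "integrable (\<mu> \<Otimes>\<^sub>M \<mu>) ?a" and intb: "integrable (\<mu> \<Otimes>\<^sub>M \<mu>) ?b"
    using bd by (auto intro!: pair.P.integrable_const_bound[of _ "(a + a) * b"])
  have sym: "?C (y, x) = ?C (x, y)" for x y
    by (simp add: indicator_def choices_def dist_commute conj_commute)
  have swap: "(LINT p|(\<mu> \<Otimes>\<^sub>M \<mu>). ?b p) = - (LINT p|(\<mu> \<Otimes>\<^sub>M \<mu>). ?a p)"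
  proof -
    have "(LINT p|(\<mu> \<Otimes>\<^sub>M \<mu>). ?b p) = (LINT p|(\<mu> \<Otimes>\<^sub>M \<mu>). (case p of (x, y) \<Rightarrow> ?b (y, x)))"
      using pair.integral_product_swap[of ?b] borel_measurable_integrable[OF intb] by simp
    also have "\<dots> = (LINT p|(\<mu> \<Otimes>\<^sub>M \<mu>). - ?a p)"
      by (rule Bochner_Integration.integral_cong) (auto simp: sym algebra_simps)
    finally show ?thesis by simp
  qed
  have "form_at v f g = (LINT p|(\<mu> \<Otimes>\<^sub>M \<mu>). ?a p - ?b p)"
    unfolding form_at_def by (rule Bochner_Integration.integral_cong) (auto simp: algebra_simps)
  also have "\<dots> = 2 * (LINT p|(\<mu> \<Otimes>\<^sub>M \<mu>). ?a p)"
    unfolding Bochner_Integration.integral_diff[OF inta intb] swap by simp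
  also have "(LINT p|(\<mu> \<Otimes>\<^sub>M \<mu>). ?a p) = (LINT x|\<mu>. LINT y|\<mu>. ?a (x, y))"
    by (rule pair.integral_fst'[symmetric]) (rule inta)
  also have "\<dots> = L2_inner \<mu> (jump v f) g"
    unfolding L2_inner_def
  proof (rule Bochner_Integration.integral_cong[OF refl])
    fix x
    have "(LINT y|\<mu>. ?a (x, y)) = (LINT y|\<mu>. indicator v x *\<^sub>R (cnj (indicator (v - ball x (diameter v)) y *\<^sub>R (f x - f y)) * g x))"
      by (rule Bochner_Integration.integral_cong) (auto simp: choices_eq[OF v] indicator_def)
    also have "\<dots> = cnj (jump v f x) * g x"
      unfolding jump_def set_lebesgue_integral_def
      by (cases "x \<in> v") (simp_all del: complex_cnj_scaleR mult_scaleR_left mult_scaleR_right)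
    finally show "(LINT y|\<mu>. ?a (x, y)) = cnj (jump v f x) * g x" .
  qed
  finally show ?thesis .
qed

lemma jump_sum:
  assumes v: "v \<in> vertices" and f: "\<And>i. i \<in> I \<Longrightarrow> integrable \<mu> (f i)"
  shows "jump v (\<lambda>x. \<Sum>i\<in>I. f i x) x = (\<Sum>i\<in>I. jump v (f i) x)"
proof -
  have "(LINT y:(v - ball x (diameter v))|\<mu>. (\<Sum>i\<in>I. f i x) - (\<Sum>i\<in>I. f i y)) =
      (\<Sum>i\<in>I. LINT y:(v - ball x (diameter v))|\<mu>. f i x - f i y)"
    unfolding sum_subtractf[symmetric] set_lebesgue_integral_def scaleR_sum_right
    using f v far_sets
    by (intro Bochner_Integration.integral_sum integrable_mult_indicator Bochner_Integration.integrable_diff) auto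
  then show ?thesis by (simp add: jump_def scaleR_sum_right)
qed

text \<open>For a vertex \<open>w\<close> strictly inside \<open>v\<close> this is the mass of the other children of \<open>v\<close>; for \<open>w = v\<close> it
  is the mass of all of \<open>v\<close>.  It is the factor by which the part of the operator that belongs to
  \<open>v\<close> multiplies the components at \<open>w\<close>.\<close>

definition jump_mass :: "'a set \<Rightarrow> 'a set \<Rightarrow> real" where
  "jump_mass v w = (if w \<noteq> {} \<and> w \<subseteq> v then measure \<mu> {y \<in> v. \<not> w \<subseteq> ball y (diameter v)} else 0)"

lemma integral_component_far:
  assumes v: "v \<in> vertices" and w: "w \<in> vertices" and f: "integrable \<mu> f"
    and x: "x \<in> v" and wv: "w \<subseteq> v" and xw: "x \<notin> w \<or> w = v"
  shows "(LINT y:(v - ball x (diameter v))|\<mu>. component w f y) =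
    (if w = v then - (measure \<mu> (ball x (diameter v)) *\<^sub>R component w f x) else 0)"
proof -
  let ?u = "ball x (diameter v)"
  have u: "?u \<in> vertices" "?u \<subset> v" "x \<in> ?u"
    using child_vertex[OF v] ball_diameter_psubset[OF v x] in_child[OF v] by auto
  have int: "integrable \<mu> (component w f)" using component_L2[of w f] w by (intro L2_integrable) (simp add: modes_def)
  have "(LINT y:(v - ?u) \<union> ?u|\<mu>. component w f y) =
      (LINT y:(v - ?u)|\<mu>. component w f y) + (LINT y:?u|\<mu>. component w f y)"
    using v u int by (intro set_integral_Un set_integrable_far set_integrable_vertex) auto
  moreover have "(v - ?u) \<union> ?u = v" using u by blast
  moreover have "avg v (component w f) = 0" using wv by (intro avg_component_outside w f v) auto
  then have "(LINT y:v|\<mu>. component w f y) = 0" using v by (simp add: integral_eq_avg)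
  ultimately have *: "(LINT y:(v - ?u)|\<mu>. component w f y) = - (measure \<mu> ?u *\<^sub>R avg ?u (component w f))"
    using u(1) by (simp add: integral_eq_avg eq_neg_iff_add_eq_0)
  show ?thesis
  proof (cases "w = v")
    case True
    then show ?thesis using * avg_component_inside[OF w u(1) _ u(3)] u by simp
  next
    case False
    then have "\<not> ?u \<subset> w" using u xw by blast
    then have "avg ?u (component w f) = 0" by (intro avg_component_outside w f u)
    then show ?thesis using * False by simp
  qed
qed

text \<open>If \<open>v\<close> does not contain \<open>w\<close>, then the component of \<open>w\<close> is constant on \<open>v\<close> and no jump is seen.  If
  \<open>w\<close> lies inside one child of \<open>v\<close>, then a jump out of this child loses the whole value, while a jump
  from another child into it averages to zero.  If \<open>w = v\<close>, then the integral over the other children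
  is minus the mass of the own child times the value on it, which completes the mass of \<open>v\<close>.\<close>

lemma jump_component:
  assumes v: "v \<in> vertices" and w: "w \<in> modes" and f: "integrable \<mu> f"
  shows "jump v (component w f) x = jump_mass v w *\<^sub>R component w f x"
proof (cases "x \<in> v \<and> w \<noteq> {}")
  case False
  show ?thesis
  proof (cases "w = {}")
    case True
    then show ?thesis by (simp add: jump_def jump_mass_def component_empty)
  next
    case False
    then have "x \<notin> v" "w \<in> vertices" using \<open>\<not> (x \<in> v \<and> w \<noteq> {})\<close> w by (auto simp: modes_def)
    then show ?thesis using component_outside[of w x f] by (auto simp: jump_def jump_mass_def)
  qed
next
  case True
  then have x: "x \<in> v" and w: "w \<in> vertices" using w by (auto simp: modes_def)
  let ?u = "ball x (diameter v)"
  let ?c = "component w f"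
  have u: "?u \<in> vertices" "?u \<subset> v" "x \<in> ?u"
    using child_vertex[OF v] ball_diameter_psubset[OF v x] in_child[OF v] by auto
  have int: "integrable \<mu> ?c" using component_L2[of w f] w by (intro L2_integrable) (simp add: modes_def)
  have J: "jump v ?c x = (LINT y:(v - ?u)|\<mu>. ?c x - ?c y)" using x by (simp add: jump_def)
  have const: "(LINT y:(v - ?u)|\<mu>. c) = measure \<mu> (v - ?u) *\<^sub>R c" for c :: complex
    unfolding set_lebesgue_integral_def using far_sets[OF v]
    by (subst integral_scaleR_left) (auto simp: emeasure_eq_measure)
  have split: "jump v ?c x = measure \<mu> (v - ?u) *\<^sub>R ?c x - (LINT y:(v - ?u)|\<mu>. ?c y)"
    unfolding J using v int
    by (subst set_integral_diff) (auto intro!: set_integrable_far simp: const)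
  show ?thesis
  proof (cases "w \<subseteq> v")
    case False
    have eq: "?c x = ?c y" if y: "y \<in> v" for y
    proof (cases "v \<inter> w = {}")
      case True
      then have "x \<notin> w" "y \<notin> w" using x y by blast+
      then show ?thesis by (simp add: component_outside[OF w])
    next
      case no: False
      then obtain z where z: "z \<in> v" "z \<in> w" by blast
      have "v \<subset> w" using vertices_nested[OF v w z] vertices_nested[OF w v z(2,1)] False by auto
      have "dist x y \<le> diameter v" by (rule dist_le_diameter[OF x y])
      also have "\<dots> < diameter w" by (rule psubset_diameter_less[OF v w \<open>v \<subset> w\<close>])
      finally show ?thesis using component_constant_at[OF w] by (simp add: constant_at_def)
    qed
    have "jump v ?c x = (LINT y:(v - ?u)|\<mu>. 0)"
      unfolding J using eq v by (intro set_lebesgue_integral_cong far_sets) auto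
    then show ?thesis using False by (simp add: set_lebesgue_integral_def jump_mass_def)
  next
    case sub: True
    show ?thesis
    proof (cases "x \<notin> w \<or> w = v")
      case True
      show ?thesis
      proof (cases "w = v")
        case True
        have "jump_mass v w = measure \<mu> v"
        proof -
          have "{y \<in> v. \<not> w \<subseteq> ball y (diameter v)} = v" using True ball_diameter_psubset[OF v] by blast
          then show ?thesis using True vertex_nonempty[OF v] by (simp add: jump_mass_def)
        qed
        also have "\<dots> = measure \<mu> (v - ?u) + measure \<mu> ?u"
          using finite_measure_Diff[OF vertex_sets[OF v] vertex_sets[OF u(1)]] u by simp
        finally show ?thesis
          using split integral_component_far[OF v w f x sub] True w vertex_nonempty[OF w]
          by (simp add: scaleR_add_left)
      next
        case False
        then have "x \<notin> w" using \<open>x \<notin> w \<or> w = v\<close> by blast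
        then show ?thesis
          using split integral_component_far[OF v w f x sub] False by (simp add: component_outside[OF w])
      qed
    next
      case False
      then have xw: "x \<in> w" "w \<subset> v" using sub by auto
      then have wu: "w \<subseteq> ?u" using psubset_iff_subset_child[OF v w xw(1) x] by simp
      have "(LINT y:(v - ?u)|\<mu>. ?c y) = (LINT y:(v - ?u)|\<mu>. 0)"
        using wu v by (intro set_lebesgue_integral_cong far_sets) (auto intro!: component_outside[OF w])
      then have z: "(LINT y:(v - ?u)|\<mu>. ?c y) = 0" by (simp add: set_lebesgue_integral_def)
      have "{y \<in> v. \<not> w \<subseteq> ball y (diameter v)} = v - ?u"
      proof (intro set_eqI iffI)
        fix y assume y: "y \<in> {y \<in> v. \<not> w \<subseteq> ball y (diameter v)}"
        have "y \<notin> ?u" using y wu ball_eq by blast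
        then show "y \<in> v - ?u" using y by blast
      next
        fix y assume y: "y \<in> v - ?u"
        have "x \<notin> ball y (diameter v)" using y by (simp add: dist_commute)
        then show "y \<in> {y \<in> v. \<not> w \<subseteq> ball y (diameter v)}" using y xw by blast
      qed
      then show ?thesis using split z sub vertex_nonempty[OF w] by (simp add: jump_mass_def)
    qed
  qed
qed

definition eigenvalue :: "real \<Rightarrow> 'a set \<Rightarrow> real" where
  "eigenvalue s w = (\<Sum>v\<in>{v \<in> vertices. w \<subseteq> v}. weight s v * jump_mass v w)"

lemma eigenvalue_empty: "eigenvalue s {} = 0"
  by (simp add: eigenvalue_def jump_mass_def)

lemma eigenvalue_nonneg: "eigenvalue s w \<ge> 0"
  by (auto simp: eigenvalue_def jump_mass_def intro!: sum_nonneg mult_nonneg_nonneg weight_nonneg)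

abbreviation heat_factor :: "real \<Rightarrow> real \<Rightarrow> 'a set \<Rightarrow> real" where
  "heat_factor s t v \<equiv> exp (- t * eigenvalue s v)"

lemma avg_constant_at:
  assumes "constant_at e f" "e > 0" shows "avg (ball x e) f = f x"
  using assms by (intro avg_const ball_vertex) (auto simp: constant_at_def dist_commute)

lemma synth_constant_at:
  assumes "constant_at e f" "e > 0" shows "synth (coarse e) (\<lambda>_. 1) f = f"
  using avg_ball_eq_sum[OF assms(2), of _ f] avg_constant_at[OF assms] by (simp add: synth_def fun_eq_iff)

text \<open>Exchanging the sums over the vertices \<open>v\<close> of the form and the components \<open>w\<close> of \<open>f\<close>; every
  ancestor of a ball of diameter at least \<open>e\<close> has diameter at least \<open>e\<close>, so all summands of the
  eigenvalue are present.\<close>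

lemma form_Q_eq_inner:
  assumes f: "constant_at e f" "e > 0" and g: "g \<in> test_functions"
  shows "form_Q s \<mu> f g = 2 * L2_inner \<mu> (synth (coarse e) (eigenvalue s) f) g"
proof -
  have f': "f \<in> test_functions" using f test_functions_iff by blast
  let ?L = "{v \<in> (vertices :: 'a set set). e \<le> diameter v}"
  have fin: "finite ?L" "finite (coarse e)" using f(2) by (simp_all add: finite_large_vertices finite_coarse)
  have jump: "jump v f = synth (coarse e) (jump_mass v) f" if v: "v \<in> vertices" for v
  proof
    fix x
    have "jump v f x = jump v (\<lambda>x. \<Sum>w\<in>coarse e. component w f x) x"
      using synth_constant_at[OF f] by (simp add: synth_def[abs_def])
    also have "\<dots> = (\<Sum>w\<in>coarse e. jump v (component w f) x)"
      using coarse_modes by (intro jump_sum v L2_integrable component_L2) blast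
    also have "\<dots> = synth (coarse e) (jump_mass v) f x"
      unfolding synth_def using coarse_modes L2_integrable[OF test_L2[OF f']]
      by (intro sum.cong refl jump_component v) auto
    finally show "jump v f x = synth (coarse e) (jump_mass v) f x" .
  qed
  have jumpL2: "jump v f \<in> L2 \<mu>" if "v \<in> vertices" for v
    unfolding jump[OF that] using coarse_modes by (rule synth_L2)
  have eig: "(\<Sum>v\<in>?L. weight s v * jump_mass v w) = eigenvalue s w" if w: "w \<in> coarse e" for w
  proof (cases "w = {}")
    case True
    then show ?thesis by (simp add: eigenvalue_empty jump_mass_def)
  next
    case False
    have "e \<le> diameter v" if "w \<subseteq> v" for v
      using w False diameter_mono[OF that] by (auto simp: coarse_def)
    then show ?thesis
      unfolding eigenvalue_def using fin(1)
      by (intro sum.mono_neutral_right) (auto simp: jump_mass_def)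
  qed
  have gen: "(\<Sum>v\<in>?L. weight s v *\<^sub>R jump v f x) = synth (coarse e) (eigenvalue s) f x" for x
  proof -
    have "(\<Sum>v\<in>?L. weight s v *\<^sub>R jump v f x) =
        (\<Sum>v\<in>?L. \<Sum>w\<in>coarse e. (weight s v * jump_mass v w) *\<^sub>R component w f x)"
      by (intro sum.cong refl) (simp add: jump synth_def scaleR_sum_right)
    also have "\<dots> = (\<Sum>w\<in>coarse e. (\<Sum>v\<in>?L. weight s v * jump_mass v w) *\<^sub>R component w f x)"
      unfolding scaleR_sum_left by (rule sum.swap)
    also have "\<dots> = synth (coarse e) (eigenvalue s) f x"
      unfolding synth_def by (intro sum.cong refl) (simp add: eig)
    finally show ?thesis .
  qed
  have "form_Q s \<mu> f g = (\<Sum>v\<in>?L. weight s v *\<^sub>R (2 * L2_inner \<mu> (jump v f) g))"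
    unfolding form_Q_eq_sum[OF f g] using f' g by (intro sum.cong refl) (simp add: form_at_eq_jump)
  also have "\<dots> = 2 * L2_inner \<mu> (\<lambda>x. \<Sum>v\<in>?L. weight s v *\<^sub>R jump v f x) g"
    using jumpL2 test_L2[OF g]
    by (subst L2_inner_sum_left) (auto simp: L2_inner_scaleR_left sum_distrib_left intro!: L2_scaleR)
  finally show ?thesis unfolding gen .
qed


section \<open>The Vladimirov-Pearson operator is a multiplier\<close>

text \<open>The sum is meant for test functions, which have finitely many nonzero components; there
  \<open>gen s\<close> is the operator \<open>D\<close> with \<open>Q\<^sub>s(f, g) = 2 \<langle>D f, g\<rangle>\<close>.\<close>

definition gen :: "real \<Rightarrow> ('a \<Rightarrow> complex) \<Rightarrow> 'a \<Rightarrow> complex" where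
  "gen s f = synth {w \<in> modes. component w f \<noteq> (\<lambda>x. 0)} (eigenvalue s) f"

lemma component_eq_0_if_constant_at:
  assumes f: "constant_at e f" and w: "w \<in> modes" "w \<notin> coarse e"
  shows "component w f x = 0"
proof (cases "x \<in> w")
  case True
  have wv: "w \<in> vertices" "diameter w < e" using w by (auto simp: modes_def coarse_def)
  have eq: "f y = f x" if "y \<in> w" for y
    using f dist_le_diameter[OF that True] wv(2) by (simp add: constant_at_def)
  have "avg w f = f x" by (rule avg_const[OF wv(1) eq])
  moreover have "avg (ball x (diameter w)) f = f x"
    using ball_diameter_psubset[OF wv(1) True] by (intro avg_const child_vertex wv(1) eq) blast
  ultimately show ?thesis using True wv(1) by (simp add: component_inside)
next
  case False
  then show ?thesis using w by (auto simp: modes_def coarse_def component_outside)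
qed

lemma gen_eq:
  assumes "constant_at e f" "e > 0"
  shows "gen s f = synth (coarse e) (eigenvalue s) f"
proof
  fix x
  have "{w \<in> modes. component w f \<noteq> (\<lambda>x. 0)} \<subseteq> coarse e"
    using component_eq_0_if_constant_at[OF assms(1)] by blast
  then show "gen s f x = synth (coarse e) (eigenvalue s) f x"
    unfolding gen_def synth_def using finite_coarse[OF assms(2)] coarse_modes
    by (intro sum.mono_neutral_left) auto
qed

lemma gen_test: "f \<in> test_functions \<Longrightarrow> gen s f \<in> test_functions"
  unfolding gen_def by (intro synth_test) auto

lemma gen_L2: "f \<in> test_functions \<Longrightarrow> gen s f \<in> L2 \<mu>"
  by (intro test_L2 gen_test)

lemma diagonal_gen:
  assumes "f \<in> test_functions" shows "diagonal (eigenvalue s) f (gen s f)"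
proof -
  obtain e where e: "e > 0" "constant_at e f" using assms test_functions_iff by blast
  have "component v (gen s f) x = eigenvalue s v *\<^sub>R component v f x" if "v \<in> modes" for v x
    unfolding gen_eq[OF e(2,1)]
    using component_synth[OF finite_coarse[OF e(1)] coarse_modes that L2_integrable[OF test_L2[OF assms]]]
      component_eq_0_if_constant_at[OF e(2) that] by simp
  then show ?thesis using assms by (auto simp: diagonal_def gen_L2 test_L2)
qed

lemma common_scale:
  assumes "f \<in> test_functions" "g \<in> test_functions"
  shows "\<exists>e>0. constant_at e f \<and> constant_at e (g :: 'a \<Rightarrow> complex)"
proof -
  obtain a b where "a > 0" "b > 0" "constant_at a f" "constant_at b g"
    using assms by (auto simp: test_functions_iff)
  then show ?thesis by (intro exI[of _ "min a b"]) (auto simp: constant_at_def)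
qed

lemma gen_lincomb:
  assumes f: "f \<in> test_functions" and g: "g \<in> test_functions"
  shows "gen s (\<lambda>x. a * f x + b * g x) = (\<lambda>x. a * gen s f x + b * gen s g x)"
proof -
  obtain e where e: "e > 0" "constant_at e f" "constant_at e g" using common_scale[OF f g] by blast
  then have "constant_at e (\<lambda>x. a * f x + b * g x)" unfolding constant_at_def by metis
  then show ?thesis
    using e f g coarse_modes
    by (intro ext) (simp add: gen_eq synth_def sum_distrib_left flip: sum.distrib,
      intro sum.cong refl, simp add: component_add component_cmult L2_integrable test_L2 L2_cmult subset_iff algebra_simps)
qed

subsection \<open>The form on test functions\<close>

lemma form_Q_gen:
  assumes "f \<in> test_functions" "g \<in> test_functions"
  shows "form_Q s \<mu> f g = 2 * L2_inner \<mu> (gen s f) g"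
proof -
  obtain e where e: "e > 0" "constant_at e f" using assms test_functions_iff by blast
  then show ?thesis using form_Q_eq_inner[OF e(2,1) assms(2)] gen_eq[OF e(2,1)] by simp
qed

lemma form_Q_diff_left:
  assumes "f \<in> test_functions" "g \<in> test_functions" "h \<in> test_functions"
  shows "form_Q s \<mu> (\<lambda>x. f x - g x) h = form_Q s \<mu> f h - form_Q s \<mu> g h"
  using gen_lincomb[OF assms(1,2), of s 1 "-1"] assms
  by (simp add: form_Q_gen test_binop[where h = "(-)"] L2_inner_diff_left gen_L2 test_L2 right_diff_distrib)

lemma form_Q_diff_right:
  assumes "f \<in> test_functions" "g \<in> test_functions" "h \<in> test_functions"
  shows "form_Q s \<mu> h (\<lambda>x. f x - g x) = form_Q s \<mu> h f - form_Q s \<mu> h g"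
  using assms
  by (simp add: form_Q_gen test_binop[where h = "(-)"] L2_inner_diff_right gen_L2 test_L2 right_diff_distrib)

definition energy :: "real \<Rightarrow> ('a \<Rightarrow> complex) \<Rightarrow> real" where
  "energy s f = Re (form_Q s \<mu> f f)"

lemma form_Q_spectral:
  assumes e: "constant_at e f" "e > 0" and g: "g \<in> test_functions"
  shows "form_Q s \<mu> f g =
    2 * (\<Sum>w\<in>coarse e. eigenvalue s w *\<^sub>R L2_inner \<mu> (component w f) (component w g))"
proof -
  have "f \<in> test_functions" using e test_functions_iff by blast
  then show ?thesis
    unfolding form_Q_eq_inner[OF e g] using coarse_modes g
    by (subst component_synth_inner) (auto intro: test_L2)
qed

lemma form_Q_self:
  assumes e: "constant_at e f" "e > 0"
  shows "form_Q s \<mu> f f =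
    of_real (2 * (\<Sum>w\<in>coarse e. eigenvalue s w * (L2_norm \<mu> (component w f))\<^sup>2))"
proof -
  have "f \<in> test_functions" using e test_functions_iff by blast
  then show ?thesis
    unfolding form_Q_spectral[OF e \<open>f \<in> test_functions\<close>] by (simp add: L2_norm_sq_inner scaleR_conv_of_real)
qed

lemma energy_nonneg:
  assumes "f \<in> test_functions" shows "energy s f \<ge> 0"
  using assms form_Q_self
  by (auto simp: energy_def test_functions_iff intro!: sum_nonneg mult_nonneg_nonneg eigenvalue_nonneg)

lemma form_Q_Cauchy_Schwarz:
  assumes f: "f \<in> test_functions" and g: "g \<in> test_functions"
  shows "(norm (form_Q s \<mu> f g))\<^sup>2 \<le> energy s f * energy s g"
proof -
  obtain e where e: "e > 0" "constant_at e f" "constant_at e g" using common_scale[OF f g] by blast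
  let ?F = "coarse e" and ?l = "\<lambda>w. sqrt (eigenvalue s w)"
  let ?a = "\<lambda>w. ?l w * L2_norm \<mu> (component w f)" and ?b = "\<lambda>w. ?l w * L2_norm \<mu> (component w g)"
  have "norm (form_Q s \<mu> f g) \<le> 2 * (\<Sum>w\<in>?F. norm (eigenvalue s w *\<^sub>R L2_inner \<mu> (component w f) (component w g)))"
    unfolding form_Q_spectral[OF e(2,1) g] norm_mult by (simp del: norm_scaleR add: norm_sum)
  also have "\<dots> \<le> 2 * (\<Sum>w\<in>?F. ?a w * ?b w)"
  proof (intro mult_left_mono sum_mono)
    fix w assume "w \<in> ?F"
    then have "w \<in> modes" using coarse_modes by blast
    have "norm (eigenvalue s w *\<^sub>R L2_inner \<mu> (component w f) (component w g))
        \<le> eigenvalue s w * (L2_norm \<mu> (component w f) * L2_norm \<mu> (component w g))"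
      using eigenvalue_nonneg[of s w] component_L2[OF \<open>w \<in> modes\<close>]
      by (simp add: L2_Cauchy_Schwarz mult_left_mono)
    also have "\<dots> = (?l w * ?l w) * (L2_norm \<mu> (component w f) * L2_norm \<mu> (component w g))"
      using eigenvalue_nonneg[of s w] by simp
    finally show "norm (eigenvalue s w *\<^sub>R L2_inner \<mu> (component w f) (component w g)) \<le> ?a w * ?b w"
      by (simp only: mult_ac)
  qed simp
  finally have "(norm (form_Q s \<mu> f g))\<^sup>2 \<le> (2 * (\<Sum>w\<in>?F. ?a w * ?b w))\<^sup>2" by (rule power_mono) simp
  also have "\<dots> \<le> 4 * ((\<Sum>w\<in>?F. (?a w)\<^sup>2) * (\<Sum>w\<in>?F. (?b w)\<^sup>2))"
    using Cauchy_Schwarz_ineq_sum[of ?a ?b ?F] by (simp add: power_mult_distrib)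
  also have "\<dots> = energy s f * energy s g"
    using form_Q_self[OF e(2,1)] form_Q_self[OF e(3,1)] eigenvalue_nonneg
    by (simp add: energy_def power_mult_distrib)
  finally show ?thesis .
qed

lemma form_Q_le_energy:
  assumes f: "f \<in> test_functions" and g: "g \<in> test_functions"
  shows "norm (form_Q s \<mu> f g) \<le> (energy s f + energy s g) / 2"
proof (rule power2_le_imp_le)
  have "0 \<le> (energy s f - energy s g)\<^sup>2" by simp
  then have "energy s f * energy s g \<le> ((energy s f + energy s g) / 2)\<^sup>2"
    by (simp add: power2_eq_square field_simps)
  then show "(norm (form_Q s \<mu> f g))\<^sup>2 \<le> ((energy s f + energy s g) / 2)\<^sup>2"
    using form_Q_Cauchy_Schwarz[OF f g, of s] by linarith
  show "0 \<le> (energy s f + energy s g) / 2" using energy_nonneg f g by simp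
qed

lemma energy_le:
  assumes f: "f \<in> test_functions" and g: "g \<in> test_functions"
  shows "energy s f \<le> 2 * energy s (\<lambda>x. f x - g x) + 2 * energy s g"
proof -
  let ?d = "\<lambda>x. f x - g x"
  have d: "?d \<in> test_functions" using f g by (rule test_binop)
  have c: "form_Q s \<mu> f f = form_Q s \<mu> ?d ?d + form_Q s \<mu> ?d g + form_Q s \<mu> g ?d + form_Q s \<mu> g g"
    using f g d by (simp add: form_Q_diff_left form_Q_diff_right)
  have "energy s f = energy s ?d + Re (form_Q s \<mu> ?d g) + Re (form_Q s \<mu> g ?d) + energy s g"
    unfolding energy_def c by simp
  moreover have "Re (form_Q s \<mu> ?d g) \<le> (energy s ?d + energy s g) / 2"
    by (rule order_trans[OF complex_Re_le_cmod form_Q_le_energy[OF d g]])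
  moreover have "Re (form_Q s \<mu> g ?d) \<le> (energy s g + energy s ?d) / 2"
    by (rule order_trans[OF complex_Re_le_cmod form_Q_le_energy[OF g d]])
  ultimately show ?thesis by (simp add: field_simps)
qed

subsection \<open>Closability\<close>

lemma form_approx_test:
  assumes "form_approx s \<mu> \<phi> f" shows "\<phi> n \<in> test_functions"
  using assms by (simp add: form_approx_def)

lemma form_approx_Cauchy:
  assumes "form_approx s \<mu> \<phi> f" "e > 0"
  shows "\<exists>N. \<forall>m\<ge>N. \<forall>n\<ge>N. energy s (\<lambda>x. \<phi> m x - \<phi> n x) < e"
proof -
  obtain N where N: "\<And>m n. m \<ge> N \<Longrightarrow> n \<ge> N \<Longrightarrow>
      norm (form_Q s \<mu> (\<lambda>x. \<phi> m x - \<phi> n x) (\<lambda>x. \<phi> m x - \<phi> n x)) < e"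
    using assms unfolding form_approx_def by meson
  have "energy s (\<lambda>x. \<phi> m x - \<phi> n x) < e" if "m \<ge> N" "n \<ge> N" for m n
    using N[OF that] complex_Re_le_cmod unfolding energy_def by (rule le_less_trans[rotated])
  then show ?thesis by blast
qed

lemma form_approx_energy_bounded:
  assumes "form_approx s \<mu> \<phi> f"
  shows "\<exists>K N. \<forall>n\<ge>N. energy s (\<phi> n) \<le> K"
proof -
  obtain N where N: "\<And>m n. m \<ge> N \<Longrightarrow> n \<ge> N \<Longrightarrow> energy s (\<lambda>x. \<phi> m x - \<phi> n x) < 1"
    using form_approx_Cauchy[OF assms, of 1] by auto
  have "energy s (\<phi> n) \<le> 2 * 1 + 2 * energy s (\<phi> N)" if "n \<ge> N" for n
    using energy_le[OF form_approx_test[OF assms] form_approx_test[OF assms], of s n N] N[OF that order_refl]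
    by linarith
  then show ?thesis by blast
qed

text \<open>Closability: let \<open>\<eta>\<^sub>n = \<phi>\<^sub>n - f\<close> and split \<open>Q\<^sub>s(\<eta>\<^sub>n, \<eta>\<^sub>n)\<close> into \<open>Q\<^sub>s(\<eta>\<^sub>n, \<eta>\<^sub>n - \<eta>\<^sub>m)\<close> and \<open>Q\<^sub>s(\<eta>\<^sub>n, \<eta>\<^sub>m)\<close>.
  The first term is controlled by the Cauchy property, and the second tends to \<open>0\<close> for \<open>m \<rightarrow> \<infinity>\<close>, as
  \<open>Q\<^sub>s(\<eta>\<^sub>n, \<cdot>) = 2 \<langle>D \<eta>\<^sub>n, \<cdot>\<rangle>\<close> is continuous in \<open>L\<^sup>2\<close>.\<close>

lemma form_approx_energy_tendsto:
  assumes f: "f \<in> test_functions" and \<phi>: "form_approx s \<mu> \<phi> f"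
  shows "(\<lambda>n. energy s (\<lambda>x. \<phi> n x - f x)) \<longlonglongrightarrow> 0"
proof (rule LIMSEQ_I)
  fix e :: real assume "e > 0"
  define \<eta> where "\<eta> n x = \<phi> n x - f x" for n x
  have \<eta>: "\<eta> n \<in> test_functions" for n
    unfolding \<eta>_def using form_approx_test[OF \<phi>] f by (rule test_binop)
  have lim: "(\<lambda>m. L2_norm \<mu> (\<lambda>x. \<eta> m x - 0)) \<longlonglongrightarrow> 0"
    using \<phi> by (simp add: form_approx_def \<eta>_def)
  obtain N where N: "\<And>m n. m \<ge> N \<Longrightarrow> n \<ge> N \<Longrightarrow> energy s (\<lambda>x. \<phi> n x - \<phi> m x) < e / 2"
    using form_approx_Cauchy[OF \<phi>, of "e / 2"] \<open>e > 0\<close> by auto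
  have "energy s (\<eta> n) \<le> e / 2" if n: "n \<ge> N" for n
  proof (rule LIMSEQ_le_const)
    show "(\<lambda>m. e / 2 + 2 * norm (form_Q s \<mu> (\<eta> n) (\<eta> m))) \<longlonglongrightarrow> e / 2"
    proof -
      have "(\<lambda>m. L2_inner \<mu> (gen s (\<eta> n)) (\<eta> m)) \<longlonglongrightarrow> L2_inner \<mu> (gen s (\<eta> n)) (\<lambda>x. 0)"
        by (intro L2_inner_tendsto test_L2 \<eta> L2_zero gen_test lim)
      then have "(\<lambda>m. form_Q s \<mu> (\<eta> n) (\<eta> m)) \<longlonglongrightarrow> 2 * 0"
        unfolding form_Q_gen[OF \<eta> \<eta>] by (intro tendsto_mult tendsto_const) (simp add: L2_inner_def)
      then have "(\<lambda>m. e / 2 + 2 * norm (form_Q s \<mu> (\<eta> n) (\<eta> m))) \<longlonglongrightarrow> e / 2 + 2 * norm (2 * 0 :: complex)"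
        by (intro tendsto_intros)
      then show ?thesis by simp
    qed
    have "energy s (\<eta> n) \<le> e / 2 + 2 * norm (form_Q s \<mu> (\<eta> n) (\<eta> m))" if m: "m \<ge> N" for m
    proof -
      let ?d = "\<lambda>x. \<eta> n x - \<eta> m x"
      have d: "?d \<in> test_functions" by (intro test_binop[where h = "(-)"] \<eta>)
      have "?d = (\<lambda>x. \<phi> n x - \<phi> m x)" by (simp add: \<eta>_def)
      then have small: "energy s ?d < e / 2" using N[OF m n] by simp
      have "form_Q s \<mu> (\<eta> n) (\<eta> n) = form_Q s \<mu> (\<eta> n) ?d + form_Q s \<mu> (\<eta> n) (\<eta> m)"
        using \<eta> by (simp add: form_Q_diff_right)
      then have "energy s (\<eta> n) = Re (form_Q s \<mu> (\<eta> n) ?d) + Re (form_Q s \<mu> (\<eta> n) (\<eta> m))"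
        by (simp add: energy_def)
      also have "\<dots> \<le> (energy s (\<eta> n) + energy s ?d) / 2 + norm (form_Q s \<mu> (\<eta> n) (\<eta> m))"
        by (intro add_mono order_trans[OF complex_Re_le_cmod form_Q_le_energy[OF \<eta> d]] complex_Re_le_cmod)
      finally show ?thesis using small by (simp add: field_simps)
    qed
    then show "\<exists>M. \<forall>m\<ge>M. energy s (\<eta> n) \<le> e / 2 + 2 * norm (form_Q s \<mu> (\<eta> n) (\<eta> m))" by blast
  qed
  then have "norm (energy s (\<eta> n) - 0) < e" if "n \<ge> N" for n
    using that \<open>e > 0\<close> energy_nonneg[OF \<eta>, of s n] by fastforce
  then show "\<exists>N. \<forall>n\<ge>N. norm (energy s (\<lambda>x. \<phi> n x - f x) - 0) < e"
    unfolding \<eta>_def by blast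
qed

text \<open>The error \<open>Q\<^sub>s(\<phi>\<^sub>n - f, \<gamma>\<^sub>n)\<close> vanishes in the limit because the energy of \<open>\<phi>\<^sub>n - f\<close> tends to \<open>0\<close>
  and that of \<open>\<gamma>\<^sub>n\<close> stays bounded.\<close>

lemma form_Q_tendsto:
  assumes f: "f \<in> test_functions" and \<phi>: "form_approx s \<mu> \<phi> f"
    and g: "g \<in> L2 \<mu>" and \<gamma>: "form_approx s \<mu> \<gamma> g"
  shows "(\<lambda>n. form_Q s \<mu> (\<phi> n) (\<gamma> n)) \<longlonglongrightarrow> 2 * L2_inner \<mu> (gen s f) g"
proof -
  note \<phi>t = form_approx_test[OF \<phi>] and \<gamma>t = form_approx_test[OF \<gamma>]
  let ?\<eta> = "\<lambda>n x. \<phi> n x - f x"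
  have \<eta>: "?\<eta> n \<in> test_functions" for n using \<phi>t f by (rule test_binop)
  obtain K N where K: "\<And>n. n \<ge> N \<Longrightarrow> energy s (\<gamma> n) \<le> K"
    using form_approx_energy_bounded[OF \<gamma>] by blast
  have "(\<lambda>n. (norm (form_Q s \<mu> (?\<eta> n) (\<gamma> n)))\<^sup>2) \<longlonglongrightarrow> 0"
  proof (rule Lim_null_comparison)
    show "(\<lambda>n. energy s (?\<eta> n) * K) \<longlonglongrightarrow> 0"
      using tendsto_mult_right[OF form_approx_energy_tendsto[OF f \<phi>], of K] by simp
    have "norm ((norm (form_Q s \<mu> (?\<eta> n) (\<gamma> n)))\<^sup>2) \<le> energy s (?\<eta> n) * K" if "n \<ge> N" for n
    proof -
      have "(norm (form_Q s \<mu> (?\<eta> n) (\<gamma> n)))\<^sup>2 \<le> energy s (?\<eta> n) * energy s (\<gamma> n)"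
        by (rule form_Q_Cauchy_Schwarz[OF \<eta> \<gamma>t])
      also have "\<dots> \<le> energy s (?\<eta> n) * K"
        by (rule mult_left_mono[OF K[OF that] energy_nonneg[OF \<eta>]])
      finally show ?thesis by simp
    qed
    then show "eventually (\<lambda>n. norm ((norm (form_Q s \<mu> (?\<eta> n) (\<gamma> n)))\<^sup>2) \<le> energy s (?\<eta> n) * K) sequentially"
      using eventually_sequentially by blast
  qed
  from tendsto_real_sqrt[OF this] have 1: "(\<lambda>n. form_Q s \<mu> (?\<eta> n) (\<gamma> n)) \<longlonglongrightarrow> 0"
    by (simp add: tendsto_norm_zero_iff)
  have "(\<lambda>n. 2 * L2_inner \<mu> (gen s f) (\<gamma> n)) \<longlonglongrightarrow> 2 * L2_inner \<mu> (gen s f) g"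
    using \<gamma> by (intro tendsto_mult_left L2_inner_tendsto test_L2 \<gamma>t gen_test f g) (simp add: form_approx_def)
  then have 2: "(\<lambda>n. form_Q s \<mu> f (\<gamma> n)) \<longlonglongrightarrow> 2 * L2_inner \<mu> (gen s f) g"
    using f \<gamma>t by (simp add: form_Q_gen)
  have "(\<lambda>n. form_Q s \<mu> (?\<eta> n) (\<gamma> n) + form_Q s \<mu> f (\<gamma> n)) \<longlonglongrightarrow> 0 + 2 * L2_inner \<mu> (gen s f) g"
    by (rule tendsto_add[OF 1 2])
  then show ?thesis using f \<phi>t \<gamma>t by (simp add: form_Q_diff_left)
qed

lemma form_approx_self:
  assumes "f \<in> test_functions" shows "form_approx s \<mu> (\<lambda>n. f) f"
  using assms form_Q_gen[OF test_const test_const, of s 0 0]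
  by (simp add: form_approx_def L2_norm_def L2_inner_def)

lemma test_form_domain: "f \<in> test_functions \<Longrightarrow> f \<in> form_domain s \<mu>"
  using form_approx_self by (auto simp: form_domain_def test_L2)

lemma form_closure_eq:
  assumes f: "f \<in> test_functions" and g: "g \<in> form_domain s \<mu>"
  shows "form_closure s \<mu> f g = 2 * L2_inner \<mu> (gen s f) g"
  unfolding form_closure_def
proof (rule the_equality)
  have gL: "g \<in> L2 \<mu>" using g by (simp add: form_domain_def)
  obtain \<gamma> where \<gamma>: "form_approx s \<mu> \<gamma> g" using g by (auto simp: form_domain_def)
  show "\<forall>\<phi> \<gamma>. form_approx s \<mu> \<phi> f \<longrightarrow> form_approx s \<mu> \<gamma> g \<longrightarrow>
      (\<lambda>n. form_Q s \<mu> (\<phi> n) (\<gamma> n)) \<longlonglongrightarrow> 2 * L2_inner \<mu> (gen s f) g"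
    using form_Q_tendsto[OF f _ gL] by blast
  fix c assume "\<forall>\<phi> \<gamma>. form_approx s \<mu> \<phi> f \<longrightarrow> form_approx s \<mu> \<gamma> g \<longrightarrow>
      (\<lambda>n. form_Q s \<mu> (\<phi> n) (\<gamma> n)) \<longlonglongrightarrow> c"
  then have "(\<lambda>n. form_Q s \<mu> f (\<gamma> n)) \<longlonglongrightarrow> c" using form_approx_self[OF f] \<gamma> by blast
  moreover have "(\<lambda>n. form_Q s \<mu> f (\<gamma> n)) \<longlonglongrightarrow> 2 * L2_inner \<mu> (gen s f) g"
    by (rule form_Q_tendsto[OF f form_approx_self[OF f] gL \<gamma>])
  ultimately show "c = 2 * L2_inner \<mu> (gen s f) g" by (rule LIMSEQ_unique)
qed

lemma laplacian_graph_gen: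
  assumes f: "f \<in> test_functions" shows "(f, \<lambda>x. - (2 * gen s f x)) \<in> laplacian_graph s \<mu>"
proof -
  have "L2_inner \<mu> (\<lambda>x. 2 * gen s f x) g = 2 * L2_inner \<mu> (gen s f) g" for g
    by (simp add: L2_inner_def mult.assoc)
  then show ?thesis
    using f by (auto simp: laplacian_graph_def test_form_domain form_closure_eq intro!: L2_uminus L2_cmult gen_L2)
qed

text \<open>Testing with the indicators of balls determines \<open>\<Delta>\<^sub>s f\<close> up to a null set, so the choice made in
  \<open>laplacian\<close> does not affect averages over balls.\<close>

lemma laplacian_graph_unique:
  assumes f: "f \<in> test_functions" and h: "(f, h) \<in> laplacian_graph s \<mu>" and v: "v \<in> vertices"
  shows "avg v (\<lambda>x. - h x) = 2 * avg v (gen s f)"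
proof -
  let ?i = "indicator v :: 'a \<Rightarrow> complex"
  have "L2_inner \<mu> (\<lambda>x. - h x) ?i = 2 * L2_inner \<mu> (gen s f) ?i"
    using h test_form_domain[OF test_indicator[OF v]] form_closure_eq[OF f test_form_domain[OF test_indicator[OF v]]]
    by (auto simp: laplacian_graph_def)
  then have "L2_inner \<mu> ?i (\<lambda>x. - h x) = 2 * L2_inner \<mu> ?i (gen s f)"
    using arg_cong[of _ _ cnj] by (metis cnj_L2_inner complex_cnj_mult complex_cnj_numeral)
  then show ?thesis using vertex_measure_pos[OF v] v by (simp add: L2_inner_indicator scaleR_conv_of_real)
qed

lemma diameter_ball_less:
  assumes "r > 0" shows "diameter (ball (x :: 'a) r) < r"
proof -
  obtain a b where "a \<in> ball x r" "b \<in> ball x r" "dist a b = diameter (ball x r)"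
    using diameter_attained[OF ball_vertex[OF assms]] by blast
  then show ?thesis using dist_trans_less[of a x r b] by (simp add: dist_commute)
qed

lemma discs_shrinking_to_nontrivial: "discs_shrinking_to (z :: 'a) \<noteq> bot"
proof
  assume "discs_shrinking_to z = bot"
  then have "eventually (\<lambda>v. False) (discs_shrinking_to z)" by simp
  then have "\<exists>r\<in>{0<..}. eventually (\<lambda>v. False) (principal {v \<in> vertices. z \<in> v \<and> diameter v < r})"
    unfolding discs_shrinking_to_def
  proof (subst (asm) eventually_INF_base)
    fix a b :: real assume "a \<in> {0<..}" "b \<in> {0<..}"
    then show "\<exists>x\<in>{0<..}. principal {v \<in> vertices. z \<in> v \<and> diameter v < x} \<le>
        inf (principal {v \<in> vertices. z \<in> v \<and> diameter v < a}) (principal {v \<in> vertices. z \<in> v \<and> diameter v < b})"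
      by (intro bexI[of _ "min a b"]) auto
  qed auto
  then obtain r where "r > 0" "{v \<in> vertices. z \<in> v \<and> diameter v < r} = {}"
    unfolding eventually_principal by blast
  moreover have "ball z r \<in> {v \<in> vertices. z \<in> v \<and> diameter v < r}"
    using \<open>r > 0\<close> by (simp add: ball_vertex diameter_ball_less)
  ultimately show False by blast
qed

text \<open>The function \<open>D f\<close> is locally constant, so its averages over discs that shrink to \<open>z\<close> are
  eventually equal to its value at \<open>z\<close>.\<close>

lemma vp_test_eq:
  assumes f: "f \<in> test_functions" shows "vp_test s \<mu> f z = gen s f z"
proof -
  have graph: "(f, laplacian s \<mu> f) \<in> laplacian_graph s \<mu>"
    unfolding laplacian_def
    using someI[of "\<lambda>h. (f, h) \<in> laplacian_graph s \<mu>", OF laplacian_graph_gen[OF f]] .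
  obtain e where e: "e > 0" "constant_at e (gen s f)"
    using gen_test[OF f] test_functions_iff by blast
  let ?q = "\<lambda>v. L2_inner \<mu> (indicator v) (\<lambda>x. - laplacian s \<mu> f x) / of_real (measure \<mu> v)"
  have "?q v = 2 * gen s f z" if v: "v \<in> vertices" "z \<in> v" "diameter v < e" for v
  proof -
    have "avg v (gen s f) = gen s f z"
      using e(2) v dist_le_diameter[OF _ v(2)] by (intro avg_const[OF v(1)]) (fastforce simp: constant_at_def)
    then show ?thesis
      using laplacian_graph_unique[OF f graph v(1)] vertex_measure_pos[OF v(1)] v(1)
      by (simp add: L2_inner_indicator scaleR_conv_of_real)
  qed
  then have "eventually (\<lambda>v. ?q v = 2 * gen s f z) (principal {v \<in> vertices. z \<in> v \<and> diameter v < e})"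
    by (simp add: eventually_principal)
  then have "eventually (\<lambda>v. ?q v = 2 * gen s f z) (discs_shrinking_to z)"
    unfolding discs_shrinking_to_def using e(1) by (intro eventually_INF1[of e]) simp_all
  then have "Lim (discs_shrinking_to z) ?q = 2 * gen s f z"
    by (intro tendsto_Lim[OF discs_shrinking_to_nontrivial] tendsto_eventually)
  then show ?thesis by (simp add: vp_test_def)
qed

lemma level_scale: "inverse (real (Suc n)) > 0"
  by simp

lemma component_constant_at_coarse:
  assumes "w \<in> coarse e" shows "constant_at e (component w f)"
  using assms component_constant_at[of w f] constant_at_mono[of _ _ e]
  by (cases "w = {}") (auto simp: coarse_def constant_at_def component_empty)

lemma synth_constant: "constant_at e (synth (coarse e) m f)"
  unfolding constant_at_def synth_def
proof (intro allI impI sum.cong refl)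
  fix x y :: 'a and w assume "dist x y < e" "w \<in> coarse e"
  then show "m w *\<^sub>R component w f x = m w *\<^sub>R component w f y"
    using component_constant_at_coarse[of w e f] by (simp add: constant_at_def)
qed

lemma gen_synth_level:
  assumes "diagonal (eigenvalue s) f g"
  shows "gen s (partial_sum n f) = partial_sum n g"
proof
  fix x
  have "gen s (partial_sum n f) = synth (level n) (eigenvalue s) (partial_sum n f)"
    unfolding level_def by (rule gen_eq[OF synth_constant level_scale])
  also have "\<dots> = synth (level n) (eigenvalue s) f"
    unfolding synth_def[of _ "eigenvalue s"]
    using level_modes[of n] L2_integrable[OF diagonalD(1)[OF assms]]
    by (intro ext sum.cong refl) (simp add: component_synth subset_iff)
  finally show "gen s (partial_sum n f) x = partial_sum n g x"
    by (simp add: diagonal_synth[OF assms])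
qed

text \<open>Components are continuous in \<open>L\<^sup>2\<close>, which gives one inclusion; for the other, the partial
  wavelet sums of \<open>f\<close> are test functions that approximate \<open>f\<close> in the graph norm.\<close>

lemma vp_graph_eq: "vp_graph s \<mu> = {(f, g). diagonal (eigenvalue s) f g}"
proof (intro subset_antisym subrelI)
  fix f g assume fg: "(f, g) \<in> vp_graph s \<mu>"
  then obtain \<phi> where L: "f \<in> L2 \<mu>" "g \<in> L2 \<mu>" and \<phi>: "\<And>n. \<phi> n \<in> test_functions"
    and lim: "L2_tendsto \<mu> \<phi> f"
      "(\<lambda>n. L2_norm \<mu> (\<lambda>x. vp_test s \<mu> (\<phi> n) x - g x)) \<longlonglongrightarrow> 0"
    unfolding vp_graph_def by blast
  note lim = lim(1) lim(2)[unfolded vp_test_eq[OF \<phi>]]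
  have "component v g x = eigenvalue s v *\<^sub>R component v f x" if v: "v \<in> modes" for v x
  proof (rule LIMSEQ_unique)
    show "(\<lambda>n. component v (gen s (\<phi> n)) x) \<longlonglongrightarrow> component v g x"
      by (rule component_tendsto[OF gen_L2[OF \<phi>] L(2) lim(2) v])
    have "(\<lambda>n. eigenvalue s v *\<^sub>R component v (\<phi> n) x) \<longlonglongrightarrow> eigenvalue s v *\<^sub>R component v f x"
      by (intro tendsto_intros component_tendsto[OF test_L2[OF \<phi>] L(1) lim(1) v])
    then show "(\<lambda>n. component v (gen s (\<phi> n)) x) \<longlonglongrightarrow> eigenvalue s v *\<^sub>R component v f x"
      using diagonalD(3)[OF diagonal_gen[OF \<phi>] v] by simp
  qed
  then show "(f, g) \<in> {(f, g). diagonal (eigenvalue s) f g}" using L by (simp add: diagonal_def)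
next
  fix f g assume "(f, g) \<in> {(f, g). diagonal (eigenvalue s) f g}"
  then have d: "diagonal (eigenvalue s) f g" by simp
  note L = diagonalD(1,2)[OF d]
  have t: "partial_sum n f \<in> test_functions" for n using level_modes by (rule synth_test)
  have "(\<lambda>n. L2_norm \<mu> (\<lambda>x. vp_test s \<mu> (partial_sum n f) x - g x)) \<longlonglongrightarrow> 0"
    using synth_tendsto[OF L(2)] by (simp add: vp_test_eq[OF t] gen_synth_level[OF d])
  then have "\<exists>\<phi>. (\<forall>n. \<phi> n \<in> test_functions) \<and> L2_tendsto \<mu> \<phi> f \<and>
      (\<lambda>n. L2_norm \<mu> (\<lambda>x. vp_test s \<mu> (\<phi> n) x - g x)) \<longlonglongrightarrow> 0"
    by (intro exI[of _ "\<lambda>n. partial_sum n f"] conjI allI t synth_tendsto[OF L(1)])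
  then show "(f, g) \<in> vp_graph s \<mu>"
    unfolding vp_graph_def mem_Collect_eq prod.case by (intro conjI L)
qed


section \<open>Positivity\<close>

definition neg_part :: "('a \<Rightarrow> complex) \<Rightarrow> 'a \<Rightarrow> complex" where
  "neg_part g x = of_real (max 0 (- Re (g x)))"

lemma neg_part_test: "g \<in> test_functions \<Longrightarrow> neg_part g \<in> test_functions"
  unfolding neg_part_def[abs_def] by (rule test_binop[of g g "\<lambda>a b. of_real (max 0 (- Re a))"])

text \<open>The function \<open>r \<mapsto> max 0 (- r)\<close> is decreasing, so the increments of \<open>Re g\<close> and of its negative
  part have opposite signs; this is the Beurling--Deny condition for the form.\<close>

lemma neg_part_contraction:
  "Re (cnj (g x - g y) * (neg_part g x - neg_part g y)) \<le> 0"
proof -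
  let ?n = "\<lambda>x. max 0 (- Re (g x))"
  have "Re (cnj (g x - g y) * (neg_part g x - neg_part g y)) = (Re (g x) - Re (g y)) * (?n x - ?n y)"
    by (simp add: neg_part_def flip: of_real_diff)
  also have "\<dots> \<le> 0" by (auto simp: mult_le_0_iff max_def)
  finally show ?thesis .
qed

lemma form_Q_neg_part:
  assumes g: "g \<in> test_functions"
  shows "Re (form_Q s \<mu> g (neg_part g)) \<le> 0"
proof -
  obtain e where e: "e > 0" "constant_at e g" using g test_functions_iff by blast
  have "Re (form_at v g (neg_part g)) \<le> 0" if v: "v \<in> vertices" for v
  proof -
    let ?h = "\<lambda>p. cnj (g (fst p) - g (snd p)) * (neg_part g (fst p) - neg_part g (snd p))"
    have "form_at v g (neg_part g) =
        choice_mass v *\<^sub>R (LINT p|choice_factor v. ?h p)"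
      using integral_choice_factor(2)[OF v g neg_part_test[OF g]] measure_choices_pos[OF v] by simp
    moreover have "Re (LINT p|choice_factor v. ?h p) = (LINT p|choice_factor v. Re (?h p))"
      using integral_choice_factor(1)[OF v g neg_part_test[OF g]] by (rule integral_Re[symmetric])
    moreover have "(LINT p|choice_factor v. Re (?h p)) \<le> (LINT p|choice_factor v. 0)"
      using integral_choice_factor(1)[OF v g neg_part_test[OF g]] neg_part_contraction
      by (intro integral_mono integrable_Re) auto
    ultimately show ?thesis by (simp add: mult_le_0_iff)
  qed
  then show ?thesis
    unfolding form_Q_eq_sum[OF e(2,1) neg_part_test[OF g]]
    by (auto intro!: sum_nonpos simp: mult_le_0_iff weight_nonneg)
qed

lemma test_AE_zero:
  assumes f: "f \<in> test_functions" and z: "AE x in \<mu>. f x = 0" shows "f x = 0"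
proof -
  obtain e where e: "e > 0" "constant_at e f" using f test_functions_iff by blast
  have "avg (ball x e) f = avg (ball x e) (\<lambda>x. 0)"
    using z test_measurable[OF f] ball_vertex[OF e(1)] by (intro avg_cong_AE) auto
  also have "\<dots> = 0" using ball_vertex[OF e(1)] by (rule avg_const) simp
  finally show ?thesis using avg_constant_at[OF e(2,1), of x] by simp
qed

lemma L2_norm_eq_0:
  assumes "f \<in> L2 \<mu>" "L2_norm \<mu> f = 0" shows "AE x in \<mu>. f x = 0"
proof -
  have "(LINT x|\<mu>. (norm (f x))\<^sup>2) = 0" using assms(2) by (simp add: L2_norm_def)
  then have "AE x in \<mu>. (norm (f x))\<^sup>2 = 0"
    using L2_integrable_sq[OF assms(1)] by (subst (asm) integral_nonneg_eq_0_iff_AE) auto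
  then show ?thesis by simp
qed

lemma Re_inner_neg_part:
  assumes f: "f \<in> test_functions"
  shows "Re (L2_inner \<mu> f (neg_part f)) = - (L2_norm \<mu> (neg_part f))\<^sup>2"
proof -
  have "Re (L2_inner \<mu> f (neg_part f)) = (LINT x|\<mu>. Re (cnj (f x) * neg_part f x))"
    unfolding L2_inner_def
    by (rule integral_Re[symmetric]) (intro integrable_L2_inner test_L2 f neg_part_test)
  also have "\<dots> = (LINT x|\<mu>. - ((norm (neg_part f x))\<^sup>2))"
    by (rule Bochner_Integration.integral_cong) (auto simp: neg_part_def max_def power2_eq_square)
  finally show ?thesis by (simp add: L2_norm_sq)
qed

text \<open>The synthesised function \<open>g\<close> solves \<open>g + h D g = f\<close>.  Pairing this equation with the negative
  part \<open>n\<close> of \<open>Re g\<close> gives \<open>0 \<le> Re \<langle>f, n\<rangle> = - \<parallel>n\<parallel>\<^sup>2 + (h / 2) Re Q\<^sub>s(g, n) \<le> - \<parallel>n\<parallel>\<^sup>2\<close>, hence \<open>n = 0\<close>.\<close>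

lemma resolvent_pos:
  assumes e: "constant_at e f" "e > 0" and pos: "\<And>x. Re (f x) \<ge> 0" and h: "h \<ge> 0"
  shows "Re (synth (coarse e) (\<lambda>v. 1 / (1 + h * eigenvalue s v)) f x) \<ge> 0"
proof -
  define g where "g = synth (coarse e) (\<lambda>v. 1 / (1 + h * eigenvalue s v)) f"
  have f: "f \<in> test_functions" using e test_functions_iff by blast
  have g: "g \<in> test_functions" unfolding g_def using coarse_modes by (rule synth_test)
  have n: "neg_part g \<in> test_functions" using g by (rule neg_part_test)
  have gen: "gen s g = synth (coarse e) (\<lambda>v. eigenvalue s v / (1 + h * eigenvalue s v)) f"
  proof
    fix x
    have "gen s g = synth (coarse e) (eigenvalue s) g"
      unfolding g_def by (rule gen_eq[OF synth_constant e(2)])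
    then show "gen s g x = synth (coarse e) (\<lambda>v. eigenvalue s v / (1 + h * eigenvalue s v)) f x"
      unfolding synth_def[of _ "eigenvalue s"] synth_def[of _ "\<lambda>v. eigenvalue s v / (1 + h * eigenvalue s v)"] g_def
      using coarse_modes[of e] L2_integrable[OF test_L2[OF f]] finite_coarse[OF e(2)]
      by (simp add: component_synth subset_iff)
  qed
  have eq: "f x = g x + h *\<^sub>R gen s g x" for x
  proof -
    have "f x = synth (coarse e) (\<lambda>_. 1) f x" using synth_constant_at[OF e] by simp
    also have "\<dots> = g x + h *\<^sub>R gen s g x"
      unfolding g_def gen[unfolded g_def] synth_def scaleR_sum_right sum.distrib[symmetric]
    proof (rule sum.cong[OF refl])
      fix v
      have "1 + h * eigenvalue s v \<noteq> 0"
        using mult_nonneg_nonneg[OF h eigenvalue_nonneg[of s v]] by linarith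
      then have "1 / (1 + h * eigenvalue s v) + h * (eigenvalue s v / (1 + h * eigenvalue s v)) = 1"
        by (simp add: field_simps)
      then show "1 *\<^sub>R component v f x = (1 / (1 + h * eigenvalue s v)) *\<^sub>R component v f x +
          h *\<^sub>R (eigenvalue s v / (1 + h * eigenvalue s v)) *\<^sub>R component v f x"
        by (metis scaleR_add_left scaleR_scaleR)
    qed
    finally show ?thesis .
  qed
  have "f = (\<lambda>x. g x + h *\<^sub>R gen s g x)" using eq by auto
  then have "L2_inner \<mu> f (neg_part g) = L2_inner \<mu> g (neg_part g) + h *\<^sub>R L2_inner \<mu> (gen s g) (neg_part g)"
    using g n by (simp add: L2_inner_add_left L2_inner_scaleR_left test_L2 L2_scaleR gen_L2)
  then have "Re (L2_inner \<mu> f (neg_part g)) =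
      - (L2_norm \<mu> (neg_part g))\<^sup>2 + h / 2 * Re (form_Q s \<mu> g (neg_part g))"
    using form_Q_gen[OF g n, of s] Re_inner_neg_part[OF g] by simp
  moreover have "h / 2 * Re (form_Q s \<mu> g (neg_part g)) \<le> 0"
    using h form_Q_neg_part[OF g] by (simp add: mult_le_0_iff)
  moreover have "Re (L2_inner \<mu> f (neg_part g)) \<ge> 0"
  proof -
    have "Re (L2_inner \<mu> f (neg_part g)) = (LINT x|\<mu>. Re (cnj (f x) * neg_part g x))"
      unfolding L2_inner_def
      by (rule integral_Re[symmetric]) (intro integrable_L2_inner test_L2 f n)
    also have "\<dots> \<ge> 0" using pos by (intro integral_nonneg_AE) (auto simp: neg_part_def)
    finally show ?thesis .
  qed
  ultimately have "(L2_norm \<mu> (neg_part g))\<^sup>2 \<le> 0" by linarith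
  then have "L2_norm \<mu> (neg_part g) = 0" by simp
  then have "AE x in \<mu>. neg_part g x = 0" by (rule L2_norm_eq_0[OF test_L2[OF n]])
  then have "neg_part g x = 0" by (rule test_AE_zero[OF n])
  then show ?thesis by (simp add: neg_part_def g_def max_def split: if_splits)
qed

lemma synth_synth:
  assumes "finite F" "F \<subseteq> modes" "integrable \<mu> f"
  shows "synth F m (synth F m' f) x = synth F (\<lambda>v. m v * m' v) f x"
  unfolding synth_def[of F m] synth_def[of F "\<lambda>v. m v * m' v"]
  using assms by (intro sum.cong refl) (simp add: component_synth subset_iff)

text \<open>Euler's formula \<open>e\<^sup>-\<^sup>t\<^sup>D = lim (1 + t D / k)\<^sup>-\<^sup>k\<close> passes from the resolvents to the semigroup.\<close>

lemma heat_pos_finite: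
  assumes e: "constant_at e f" "e > 0" and pos: "\<And>x. Re (f x) \<ge> 0" and t: "t \<ge> 0"
  shows "Re (synth (coarse e) (heat_factor s t) f x) \<ge> 0"
proof (rule LIMSEQ_le_const)
  have f: "integrable \<mu> f" using e test_functions_iff by (blast intro: L2_integrable test_L2)
  let ?R = "\<lambda>h v. 1 / (1 + h * eigenvalue s v)"
  have R: "Re (synth (coarse e) (\<lambda>v. ?R h v ^ k) f x) \<ge> 0" if h: "h \<ge> 0" for h k x
  proof (induction k arbitrary: x)
    case 0
    then show ?case using synth_constant_at[OF e] pos by simp
  next
    case (Suc k)
    have "synth (coarse e) (?R h) (synth (coarse e) (\<lambda>v. ?R h v ^ k) f) x = synth (coarse e) (\<lambda>v. ?R h v ^ Suc k) f x"
      using synth_synth[OF finite_coarse[OF e(2)] coarse_modes f] by simp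
    then show ?case using resolvent_pos[OF synth_constant e(2) Suc h, of s x] by simp
  qed
  have "(\<lambda>k. ?R (t / real k) v ^ k) \<longlonglongrightarrow> exp (- t * eigenvalue s v)" for v
  proof -
    have "(\<lambda>k. inverse ((1 + (t * eigenvalue s v) / real k) ^ k)) \<longlonglongrightarrow> inverse (exp (t * eigenvalue s v))"
      by (intro tendsto_inverse tendsto_exp_limit_sequentially) simp
    then show ?thesis by (simp add: exp_minus field_simps)
  qed
  then show "(\<lambda>k. Re (synth (coarse e) (\<lambda>v. ?R (t / real k) v ^ k) f x)) \<longlonglongrightarrow>
      Re (synth (coarse e) (heat_factor s t) f x)"
    unfolding synth_def by (intro tendsto_intros)
  show "\<exists>N. \<forall>k\<ge>N. 0 \<le> Re (synth (coarse e) (\<lambda>v. ?R (t / real k) v ^ k) f x)"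
    by (intro exI[of _ 0] allI impI R divide_nonneg_nonneg t) simp
qed

text \<open>The negative part of \<open>Re g\<close> is bounded by \<open>|S\<^sub>n - g|\<close>, as \<open>Re S\<^sub>n \<ge> 0\<close>.\<close>

lemma Re_nonneg_limit:
  assumes S: "\<And>n. S n \<in> L2 \<mu>" and g: "g \<in> L2 \<mu>"
    and lim: "L2_tendsto \<mu> S g" and pos: "\<And>n x. Re (S n x) \<ge> 0"
  shows "AE x in \<mu>. Re (g x) \<ge> 0"
proof -
  have [measurable]: "g \<in> borel_measurable \<mu>" using g by (rule L2_measurable)
  have meas: "neg_part g \<in> borel_measurable \<mu>" unfolding neg_part_def[abs_def] by measurable
  have le: "norm (neg_part g x) \<le> norm (S n x - g x)" for n x
  proof -
    have "- Re (g x) \<le> Re (S n x - g x)" using pos[of n x] by simp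
    also have "\<dots> \<le> norm (S n x - g x)" by (rule complex_Re_le_cmod)
    finally show ?thesis by (simp add: neg_part_def)
  qed
  have int: "integrable \<mu> (\<lambda>x. (norm (neg_part g x))\<^sup>2)"
    by (rule Bochner_Integration.integrable_bound[OF L2_integrable_sq[OF L2_diff[OF S g], of 0]])
      (use meas le[of _ 0] in \<open>auto intro!: power_mono\<close>)
  then have nL: "neg_part g \<in> L2 \<mu>" using meas by (simp add: L2_def)
  have "L2_norm \<mu> (neg_part g) \<le> L2_norm \<mu> (\<lambda>x. S n x - g x)" for n
    unfolding L2_norm_def using le
    by (intro real_sqrt_le_mono integral_mono int L2_integrable_sq[OF L2_diff[OF S g]] power_mono) auto
  then have "L2_norm \<mu> (neg_part g) \<le> 0" by (intro LIMSEQ_le_const[OF lim]) blast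
  then have "L2_norm \<mu> (neg_part g) = 0" by (simp add: order_antisym)
  then have "AE x in \<mu>. neg_part g x = 0" by (rule L2_norm_eq_0[OF nL])
  then show ?thesis by eventually_elim (simp add: neg_part_def max_def split: if_splits)
qed

text \<open>The partial wavelet sums of \<open>f\<close> are averages of \<open>f\<close> over balls, hence again have nonnegative
  real part, and the semigroup maps them to the partial sums of \<open>g\<close>.\<close>

lemma heat_Re_nonneg:
  assumes fg: "diagonal (heat_factor s t) f g" and t: "t \<ge> 0"
    and pos: "AE x in \<mu>. Re (f x) \<ge> 0"
  shows "AE x in \<mu>. Re (g x) \<ge> 0"
proof (rule Re_nonneg_limit)
  note f = diagonalD(1)[OF fg] and g = diagonalD(2)[OF fg]
  let ?S = "\<lambda>n. partial_sum n"
  show "?S n g \<in> L2 \<mu>" for n using level_modes by (rule synth_L2)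
  show "g \<in> L2 \<mu>" by (rule g)
  show "(\<lambda>n. L2_norm \<mu> (\<lambda>x. ?S n g x - g x)) \<longlonglongrightarrow> 0" by (rule synth_tendsto[OF g])
  fix n x
  let ?e = "inverse (real (Suc n))"
  have ca: "constant_at ?e (?S n f)" unfolding level_def by (rule synth_constant)
  have "Re (?S n f y) \<ge> 0" for y
  proof -
    have eq: "?S n f y = avg (ball y ?e) f"
      unfolding level_def synth_def scaleR_one by (rule avg_ball_eq_sum[OF level_scale, symmetric])
    have "Re (LINT x:ball y ?e|\<mu>. f x) = (LINT x|\<mu>. Re (indicator (ball y ?e) x *\<^sub>R f x))"
      unfolding set_lebesgue_integral_def using L2_integrable[OF f]
      by (intro integral_Re[symmetric] integrable_mult_indicator ball_sets)
    also have "\<dots> \<ge> 0" using pos by (intro integral_nonneg_AE) (auto elim!: AE_mp)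
    finally show ?thesis unfolding eq by (simp add: avg_def)
  qed
  then have "Re (synth (coarse ?e) (heat_factor s t) (?S n f) x) \<ge> 0"
    by (intro heat_pos_finite[OF ca level_scale _ t])
  moreover have "synth (level n) (heat_factor s t) (?S n f) x = ?S n g x"
    unfolding diagonal_synth[OF fg] using synth_synth[OF finite_level level_modes L2_integrable[OF f]] by simp
  ultimately show "Re (?S n g x) \<ge> 0"
    by (simp add: level_def)
qed

lemma diagonal_cmult: "diagonal m f g \<Longrightarrow> diagonal m (\<lambda>x. a * f x) (\<lambda>x. a * g x)"
  by (simp add: diagonal_def L2_cmult component_cmult)

text \<open>A function is nonnegative if it and its products with \<open>\<i>\<close> and \<open>- \<i>\<close> have nonnegative real part.\<close>

lemma heat_nonneg:
  assumes fg: "diagonal (heat_factor s t) f g" and t: "t \<ge> 0"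
    and pos: "AE x in \<mu>. 0 \<le> f x"
  shows "AE x in \<mu>. 0 \<le> g x"
proof -
  \<comment> \<open>The real parts of \<open>\<i> * g\<close> and \<open>- \<i> * g\<close> are \<open>- Im g\<close> and \<open>Im g\<close>.\<close>
  have "AE x in \<mu>. Re (a * g x) \<ge> 0" if a: "a \<in> {1, \<i>, - \<i>}" for a
  proof (rule heat_Re_nonneg[OF diagonal_cmult[OF fg] t])
    show "AE x in \<mu>. Re (a * f x) \<ge> 0"
      using pos by eventually_elim (use a in \<open>auto simp: less_eq_complex_def\<close>)
  qed
  from this[of 1] this[of "\<i>"] this[of "- \<i>"]
  have "AE x in \<mu>. Re (1 * g x) \<ge> 0" "AE x in \<mu>. Re (\<i> * g x) \<ge> 0" "AE x in \<mu>. Re (- \<i> * g x) \<ge> 0"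
    by simp_all
  then show ?thesis by eventually_elim (simp add: less_eq_complex_def)
qed

section \<open>The semigroup\<close>

definition heat :: "real \<Rightarrow> real \<Rightarrow> ('a \<Rightarrow> complex) \<Rightarrow> 'a \<Rightarrow> complex" where
  "heat s t f = (SOME g. diagonal (heat_factor s t) f g)"

lemma diagonal_heat:
  assumes "f \<in> L2 \<mu>" "t \<ge> 0" shows "diagonal (heat_factor s t) f (heat s t f)"
proof -
  have "\<bar>exp (- t * eigenvalue s v)\<bar> \<le> 1" for v
    using assms(2) eigenvalue_nonneg[of s v] by simp
  then have "\<exists>g. diagonal (heat_factor s t) f g"
    using multiplier_exists[OF assms(1), of "\<lambda>v. exp (- t * eigenvalue s v)" 1] by blast
  then show ?thesis unfolding heat_def by (rule someI_ex)
qed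

lemma heat_L2: "f \<in> L2 \<mu> \<Longrightarrow> t \<ge> 0 \<Longrightarrow> heat s t f \<in> L2 \<mu>"
  using diagonal_heat diagonalD(2) by blast

lemma component_heat:
  "f \<in> L2 \<mu> \<Longrightarrow> t \<ge> 0 \<Longrightarrow> v \<in> modes \<Longrightarrow>
    component v (heat s t f) x = exp (- t * eigenvalue s v) *\<^sub>R component v f x"
  using diagonal_heat diagonalD(3) by blast

lemma sobolev_iff: "f \<in> sobolev s \<mu> \<longleftrightarrow> (\<exists>g. diagonal (eigenvalue s) f g)"
  by (simp add: sobolev_def vp_graph_eq)

lemma sobolev_L2: "f \<in> sobolev s \<mu> \<Longrightarrow> f \<in> L2 \<mu>"
  by (auto simp: sobolev_iff diagonal_def)

lemma sobolev_norm_eq: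
  assumes "diagonal (eigenvalue s) f g"
  shows "sobolev_norm s \<mu> f = sqrt ((L2_norm \<mu> f)\<^sup>2 + (L2_norm \<mu> g)\<^sup>2)"
proof -
  have d: "diagonal (eigenvalue s) f (vp_operator s \<mu> f)"
    unfolding vp_operator_def vp_graph_eq using assms by (simp add: someI[of _ g])
  have "L2_norm \<mu> (vp_operator s \<mu> f) = L2_norm \<mu> g"
    using diagonal_unique[OF d assms] diagonalD(2)[OF d] diagonalD(2)[OF assms]
    by (intro L2_norm_cong_AE L2_measurable) auto
  then show ?thesis by (simp add: sobolev_norm_def)
qed

lemma sobolev_norm_tendsto_0:
  assumes hk: "\<And>t. t > 0 \<Longrightarrow> diagonal (eigenvalue s) (h t) (k t)"
    and h: "((\<lambda>t. L2_norm \<mu> (h t)) \<longlongrightarrow> 0) (at_right 0)"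
    and k: "((\<lambda>t. L2_norm \<mu> (k t)) \<longlongrightarrow> 0) (at_right (0 :: real))"
  shows "((\<lambda>t. sobolev_norm s \<mu> (h t)) \<longlongrightarrow> 0) (at_right 0)"
proof (rule Lim_transform_eventually)
  have "((\<lambda>t. sqrt ((L2_norm \<mu> (h t))\<^sup>2 + (L2_norm \<mu> (k t))\<^sup>2)) \<longlongrightarrow> sqrt (0\<^sup>2 + 0\<^sup>2)) (at_right 0)"
    by (intro tendsto_intros h k)
  then show "((\<lambda>t. sqrt ((L2_norm \<mu> (h t))\<^sup>2 + (L2_norm \<mu> (k t))\<^sup>2)) \<longlongrightarrow> 0) (at_right 0)" by simp
  show "eventually (\<lambda>t. sqrt ((L2_norm \<mu> (h t))\<^sup>2 + (L2_norm \<mu> (k t))\<^sup>2) = sobolev_norm s \<mu> (h t)) (at_right 0)"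
    using eventually_at_right_less by eventually_elim (simp add: sobolev_norm_eq[OF hk])
qed

lemma diagonal_heat_heat:
  assumes "diagonal (eigenvalue s) f g" "t \<ge> 0"
  shows "diagonal (eigenvalue s) (heat s t f) (heat s t g)"
  using assms by (auto simp: diagonal_def heat_L2 component_heat)

lemma L2_divide: "f \<in> L2 \<mu> \<Longrightarrow> (\<lambda>x. f x / c) \<in> L2 \<mu>"
  using L2_cmult[of f \<mu> "1 / c"] by simp

lemma component_divide: "component v (\<lambda>x. f x / c) x = component v f x / c"
  using component_cmult[of v "1 / c" f x] by simp

text \<open>The scalars \<open>exp (- t \<lambda>) - 1\<close> are bounded by \<open>1\<close> and tend to \<open>0\<close> for each eigenvalue \<open>\<lambda>\<close>.\<close>

lemma heat_continuous:
  assumes f: "f \<in> L2 \<mu>"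
  shows "((\<lambda>t. L2_norm \<mu> (\<lambda>x. heat s t f x - f x)) \<longlongrightarrow> 0) (at_right 0)"
proof (rule multiplier_tendsto_0)
  fix t :: real assume t: "t > 0"
  show "diagonal (\<lambda>v. exp (- t * eigenvalue s v) - 1) f (\<lambda>x. heat s t f x - f x)"
    using f t by (auto simp: diagonal_def L2_diff heat_L2 component_diff component_heat L2_integrable scaleR_diff_left)
  show "\<bar>exp (- t * eigenvalue s v) - 1\<bar> \<le> 1" for v
    using t eigenvalue_nonneg[of s v] by (simp add: abs_le_iff)
next
  fix v
  have "((\<lambda>t. exp (- t * eigenvalue s v) - 1) \<longlongrightarrow> exp (- 0 * eigenvalue s v) - 1) (at_right 0)"
    by (intro tendsto_intros)
  then show "((\<lambda>t. exp (- t * eigenvalue s v) - 1) \<longlongrightarrow> 0) (at_right 0)" by simp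
qed

text \<open>Used with \<open>x = t \<lambda>\<close>: the error of the difference quotient of \<open>exp (- t \<lambda>)\<close> relative to the
  eigenvalue \<open>\<lambda>\<close> tends to \<open>0\<close> with \<open>t\<close> and is bounded uniformly in \<open>\<lambda>\<close>.\<close>

lemma exp_quotient_bound:
  assumes "x > (0 :: real)"
  shows "0 \<le> (exp (- x) - 1) / x + 1" "(exp (- x) - 1) / x + 1 \<le> min x 1"
proof -
  have 1: "1 - x \<le> exp (- x)" using exp_ge_add_one_self[of "- x"] by simp
  then show "0 \<le> (exp (- x) - 1) / x + 1" using assms by (simp add: field_simps)
  have "exp (- x) \<le> 1 / (1 + x)"
    using exp_ge_add_one_self[of x] assms by (simp add: exp_minus field_simps)
  also have "\<dots> \<le> 1 - x + x * x" using assms by (simp add: field_simps)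
  finally have "exp (- x) - 1 + x \<le> x * x" by simp
  then have "(exp (- x) - 1 + x) / x \<le> x" using assms by (simp add: field_simps)
  moreover have "(exp (- x) - 1) / x + 1 = (exp (- x) - 1 + x) / x" using assms by (simp add: field_simps)
  moreover have "(exp (- x) - 1) / x \<le> 0" using assms by (simp add: divide_nonpos_pos)
  ultimately show "(exp (- x) - 1) / x + 1 \<le> min x 1" by simp
qed

text \<open>Expressed through the components of \<open>p = D f\<close> instead of those of \<open>f\<close>, the multiplier of the
  error is bounded by \<open>1\<close>.\<close>

lemma heat_derivative:
  assumes fp: "diagonal (eigenvalue s) f p"
  shows "((\<lambda>t. L2_norm \<mu> (\<lambda>x. (heat s t f x - f x) / of_real t + p x)) \<longlongrightarrow> 0) (at_right 0)"
proof -
  note f = diagonalD(1)[OF fp] and p = diagonalD(2)[OF fp]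
  let ?l = "eigenvalue s"
  define m where "m t v = (if ?l v = 0 then 0 else (exp (- (t * ?l v)) - 1) / (t * ?l v) + 1)" for t v
  have pos: "0 < t * ?l v" if "t > 0" "?l v \<noteq> 0" for t v
    using that eigenvalue_nonneg[of s v] by (simp add: order_le_less)
  have diag: "diagonal (m t) p (\<lambda>x. (heat s t f x - f x) / of_real t + p x)" if t: "t > 0" for t
  proof -
    have "component v (\<lambda>x. (heat s t f x - f x) / of_real t + p x) x = m t v *\<^sub>R component v p x"
      if v: "v \<in> modes" for v x
    proof -
      have "component v (\<lambda>x. (heat s t f x - f x) / of_real t + p x) x =
          (exp (- t * ?l v) *\<^sub>R component v f x - component v f x) / of_real t + component v p x"
        using f p t v
        by (simp add: component_add component_divide component_diff component_heat L2_integrable L2_divide L2_diff heat_L2)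
      also have "\<dots> = m t v *\<^sub>R component v p x"
        using t by (auto simp: diagonalD(3)[OF fp v] m_def scaleR_conv_of_real field_simps)
      finally show ?thesis .
    qed
    then show ?thesis using f p t by (auto simp: diagonal_def L2_add L2_divide L2_diff heat_L2)
  qed
  have bound: "\<bar>m t v\<bar> \<le> 1" if "t > 0" for t v
    using exp_quotient_bound[OF pos[OF that, of v]] by (auto simp: m_def)
  have lim: "((\<lambda>t. m t v) \<longlongrightarrow> 0) (at_right 0)" for v
  proof (cases "?l v = 0")
    case False
    then have "?l v > 0" using eigenvalue_nonneg[of s v] by simp
    have "((\<lambda>t. (exp (- (t * ?l v)) - 1) / (t * ?l v) + 1) \<longlongrightarrow> 0) (at_right 0)"
    proof (rule tendsto_sandwich[where f = "\<lambda>_. 0" and h = "\<lambda>t. t * ?l v"])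
      show "((\<lambda>t. t * ?l v) \<longlongrightarrow> 0) (at_right 0)" by (rule tendsto_eq_intros refl)+ simp
      show "eventually (\<lambda>t. 0 \<le> (exp (- (t * ?l v)) - 1) / (t * ?l v) + 1) (at_right 0)"
        using eventually_at_right_less by eventually_elim (simp add: exp_quotient_bound(1) \<open>?l v > 0\<close>)
      show "eventually (\<lambda>t. (exp (- (t * ?l v)) - 1) / (t * ?l v) + 1 \<le> t * ?l v) (at_right 0)"
        using eventually_at_right_less
      proof eventually_elim
        case (elim t)
        then show ?case using exp_quotient_bound(2)[of "t * ?l v"] \<open>?l v > 0\<close> by simp
      qed
    qed simp
    with False show ?thesis by (simp add: m_def)
  qed (simp add: m_def)
  show ?thesis by (rule multiplier_tendsto_0[OF diag bound lim])
qed

lemma heat_semigroup: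
  "strongly_continuous_semigroup \<mu> (sobolev s \<mu>) (sobolev_norm s \<mu>) (heat s)"
  unfolding strongly_continuous_semigroup_def
proof (intro conjI allI ballI impI)
  fix t :: real and f assume t: "t \<ge> 0" and f: "f \<in> sobolev s \<mu>"
  show "heat s t f \<in> sobolev s \<mu>"
    using f diagonal_heat_heat[OF _ t] unfolding sobolev_iff by blast
next
  fix t :: real and f g assume "t \<ge> 0" "f \<in> sobolev s \<mu>" "g \<in> sobolev s \<mu>" "AE x in \<mu>. f x = g x"
  then show "AE x in \<mu>. heat s t f x = heat s t g x"
    using diagonal_unique[OF diagonal_heat diagonal_heat] sobolev_L2 by blast
next
  fix t :: real and f g and a b :: complex assume t: "t \<ge> 0" and "f \<in> sobolev s \<mu>" "g \<in> sobolev s \<mu>"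
  then have L: "f \<in> L2 \<mu>" "g \<in> L2 \<mu>" by (simp_all add: sobolev_L2)
  then have "(\<lambda>y. a * f y + b * g y) \<in> L2 \<mu>" by (intro L2_add L2_cmult)
  from diagonal_unique[OF diagonal_heat[OF this t] diagonal_lincomb[OF diagonal_heat[OF L(1) t] diagonal_heat[OF L(2) t]]]
  show "AE x in \<mu>. heat s t (\<lambda>y. a * f y + b * g y) x = a * heat s t f x + b * heat s t g x" by simp
next
  fix t :: real assume t: "t \<ge> 0"
  have le: "L2_norm \<mu> (heat s t f) \<le> L2_norm \<mu> f" if "f \<in> L2 \<mu>" for f
    using multiplier_norm_le[OF diagonal_heat[OF that t, of s], of 1] t eigenvalue_nonneg by simp
  have "sobolev_norm s \<mu> (heat s t f) \<le> 1 * sobolev_norm s \<mu> f" if f: "f \<in> sobolev s \<mu>" for f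
  proof -
    obtain g where g: "diagonal (eigenvalue s) f g" using f by (auto simp: sobolev_iff)
    show ?thesis
      unfolding sobolev_norm_eq[OF g] sobolev_norm_eq[OF diagonal_heat_heat[OF g t]] mult_1
      using le[OF diagonalD(1)[OF g]] le[OF diagonalD(2)[OF g]]
      by (intro real_sqrt_le_mono add_mono power_mono) auto
  qed
  then show "\<exists>K. \<forall>f\<in>sobolev s \<mu>. sobolev_norm s \<mu> (heat s t f) \<le> K * sobolev_norm s \<mu> f" by blast
next
  fix f assume "f \<in> sobolev s \<mu>"
  then have L: "f \<in> L2 \<mu>" by (rule sobolev_L2)
  then have "diagonal (\<lambda>v. exp (- 0 * eigenvalue s v)) f f" by (simp add: diagonal_def)
  from diagonal_unique[OF diagonal_heat[OF L order_refl] this]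
  show "AE x in \<mu>. heat s 0 f x = f x" by simp
next
  fix t r :: real and f assume t: "t \<ge> 0" and r: "r \<ge> 0" and "f \<in> sobolev s \<mu>"
  then have L: "f \<in> L2 \<mu>" by (simp add: sobolev_L2)
  have "diagonal (\<lambda>v. exp (- (t + r) * eigenvalue s v)) f (heat s t (heat s r f))"
    by (rule diagonal_cong[OF diagonal_compose[OF diagonal_heat[OF L r] diagonal_heat[OF heat_L2[OF L r] t]]])
      (simp add: algebra_simps flip: exp_add)
  from diagonal_unique[OF diagonal_heat[OF L] this] t r
  show "AE x in \<mu>. heat s (t + r) f x = heat s t (heat s r f) x" by simp
next
  fix f assume "f \<in> sobolev s \<mu>"
  then obtain g where g: "diagonal (eigenvalue s) f g" by (auto simp: sobolev_iff)
  note L = diagonalD(1,2)[OF g]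
  show "((\<lambda>t. sobolev_norm s \<mu> (\<lambda>x. heat s t f x - f x)) \<longlongrightarrow> 0) (at_right 0)"
  proof (rule sobolev_norm_tendsto_0[OF _ heat_continuous[OF L(1)] heat_continuous[OF L(2)]])
    fix t :: real assume "t > 0"
    then show "diagonal (eigenvalue s) (\<lambda>x. heat s t f x - f x) (\<lambda>x. heat s t g x - g x)"
      using diagonal_lincomb[OF diagonal_heat_heat[OF g] g, of t 1 "-1"] by simp
  qed
qed

text \<open>A Sobolev norm limit of the difference quotients is also an \<open>L\<^sup>2\<close> limit, hence equal to \<open>- D f\<close>.
  Conversely, if \<open>g = - D f\<close> is itself in the domain of \<open>D\<close>, then \<open>D\<close> maps the difference quotients of
  \<open>f\<close> to those of \<open>D f\<close>, and both converge in \<open>L\<^sup>2\<close>.\<close>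

lemma heat_generator:
  "infinitesimal_generator (sobolev s \<mu>) (sobolev_norm s \<mu>) (heat s) =
    {(f, g). f \<in> sobolev s \<mu> \<and> g \<in> sobolev s \<mu> \<and> (f, \<lambda>x. - g x) \<in> vp_graph s \<mu>}"
proof (intro subset_antisym subrelI)
  fix f g assume "(f, g) \<in> infinitesimal_generator (sobolev s \<mu>) (sobolev_norm s \<mu>) (heat s)"
  then have W: "f \<in> sobolev s \<mu>" "g \<in> sobolev s \<mu>"
    and lim: "((\<lambda>t. sobolev_norm s \<mu> (\<lambda>x. (heat s t f x - f x) / of_real t - g x)) \<longlongrightarrow> 0) (at_right 0)"
    by (auto simp: infinitesimal_generator_def)
  obtain p where p: "diagonal (eigenvalue s) f p" using W by (auto simp: sobolev_iff)
  note L = diagonalD(1,2)[OF p] sobolev_L2[OF W(2)]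
  let ?q = "\<lambda>t x. (heat s t f x - f x) / of_real t"
  let ?gp = "\<lambda>x. g x + p x"
  have "((\<lambda>t. sobolev_norm s \<mu> (\<lambda>x. ?q t x - g x) + L2_norm \<mu> (\<lambda>x. ?q t x + p x)) \<longlongrightarrow> 0 + 0) (at_right 0)"
    by (rule tendsto_add[OF lim heat_derivative[OF p]])
  moreover have "eventually (\<lambda>t. L2_norm \<mu> ?gp \<le> sobolev_norm s \<mu> (\<lambda>x. ?q t x - g x) + L2_norm \<mu> (\<lambda>x. ?q t x + p x)) (at_right 0)"
    using eventually_at_right_less
  proof eventually_elim
    case (elim t)
    then have qL: "?q t \<in> L2 \<mu>" using L by (intro L2_divide L2_diff heat_L2) auto
    have "L2_norm \<mu> (\<lambda>x. g x - (- p x)) \<le> L2_norm \<mu> (\<lambda>x. g x - ?q t x) + L2_norm \<mu> (\<lambda>x. ?q t x - (- p x))"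
      by (intro L2_norm_triangle_diff L qL L2_uminus)
    moreover have "L2_norm \<mu> (\<lambda>x. ?q t x - g x) \<le> sobolev_norm s \<mu> (\<lambda>x. ?q t x - g x)"
      unfolding sobolev_norm_def by (rule real_le_rsqrt) simp
    ultimately show ?case by (simp add: L2_norm_minus_commute[of \<mu> g])
  qed
  ultimately have "L2_norm \<mu> ?gp \<le> 0 + 0"
    by (intro tendsto_lowerbound) auto
  then have "L2_norm \<mu> ?gp = 0" by (simp add: order_antisym)
  then have "AE x in \<mu>. ?gp x = 0" by (intro L2_norm_eq_0 L2_add L)
  then have "AE x in \<mu>. - g x = p x" by eventually_elim (rule minus_unique)
  then have "diagonal (eigenvalue s) f (\<lambda>x. - g x)"
    using p L component_cong_AE[OF L2_measurable[OF L2_uminus[OF L(3)]] L2_measurable[OF L(2)]] by (simp add: diagonal_def L2_uminus)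
  then show "(f, g) \<in> {(f, g). f \<in> sobolev s \<mu> \<and> g \<in> sobolev s \<mu> \<and> (f, \<lambda>x. - g x) \<in> vp_graph s \<mu>}"
    using W by (simp add: vp_graph_eq)
next
  fix f g assume "(f, g) \<in> {(f, g). f \<in> sobolev s \<mu> \<and> g \<in> sobolev s \<mu> \<and> (f, \<lambda>x. - g x) \<in> vp_graph s \<mu>}"
  then have W: "f \<in> sobolev s \<mu>" "g \<in> sobolev s \<mu>" and fg: "diagonal (eigenvalue s) f (\<lambda>x. - g x)"
    by (auto simp: vp_graph_eq)
  obtain g' where g': "diagonal (eigenvalue s) g g'" using W by (auto simp: sobolev_iff)
  let ?g = "\<lambda>x. - g x" and ?g' = "\<lambda>x. - g' x"
  have gg': "diagonal (eigenvalue s) ?g ?g'" using diagonal_cmult[OF g', of "-1"] by simp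
  have "((\<lambda>t. sobolev_norm s \<mu> (\<lambda>x. (heat s t f x - f x) / of_real t + ?g x)) \<longlongrightarrow> 0) (at_right 0)"
  proof (rule sobolev_norm_tendsto_0[OF _ heat_derivative[OF fg] heat_derivative[OF gg']])
    fix t :: real assume t: "t > 0"
    have "diagonal (eigenvalue s) (\<lambda>x. heat s t f x - f x) (\<lambda>x. heat s t ?g x - ?g x)"
      using diagonal_lincomb[OF diagonal_heat_heat[OF fg] fg, of t 1 "-1"] t by simp
    from diagonal_lincomb[OF this gg', of "1 / of_real t" 1]
    show "diagonal (eigenvalue s) (\<lambda>x. (heat s t f x - f x) / of_real t + ?g x)
        (\<lambda>x. (heat s t ?g x - ?g x) / of_real t + ?g' x)" by simp
  qed
  then show "(f, g) \<in> infinitesimal_generator (sobolev s \<mu>) (sobolev_norm s \<mu>) (heat s)"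
    using W by (simp add: infinitesimal_generator_def)
qed

text \<open>Constants have only the component with eigenvalue \<open>0\<close>.\<close>

lemma heat_one:
  assumes "t \<ge> 0" shows "AE x in \<mu>. heat s t (\<lambda>_. 1) x = 1"
proof -
  have "exp (- t * eigenvalue s v) *\<^sub>R component v (\<lambda>_. 1) x = component v (\<lambda>_. 1) x" if "v \<in> modes" for v x
    using that component_const[of v 1 x] by (auto simp: modes_def eigenvalue_empty)
  then have "diagonal (heat_factor s t) (\<lambda>_. 1) (\<lambda>_. 1)"
    by (simp add: diagonal_def L2_const)
  from diagonal_unique[OF diagonal_heat[OF L2_const assms] this] show ?thesis by simp
qed

lemma heat_markov: "markov_property \<mu> (sobolev s \<mu>) (heat s)"
  unfolding markov_property_def
proof (intro allI impI conjI ballI)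
  fix t :: real assume t: "t \<ge> 0"
  show "AE x in \<mu>. heat s t (\<lambda>_. 1) x = 1" by (rule heat_one[OF t])
  fix f assume "f \<in> sobolev s \<mu>"
  then have f: "f \<in> L2 \<mu>" by (rule sobolev_L2)
  show "AE x in \<mu>. 0 \<le> heat s t f x" if "AE x in \<mu>. 0 \<le> f x"
    by (rule heat_nonneg[OF diagonal_heat[OF f t] t that])
  show "AE x in \<mu>. heat s t f x \<le> 1" if "AE x in \<mu>. f x \<le> 1"
  proof -
    have "diagonal (heat_factor s t) (\<lambda>x. 1 - f x) (\<lambda>x. heat s t (\<lambda>_. 1) x - heat s t f x)"
      using diagonal_lincomb[OF diagonal_heat[OF L2_const[of 1] t] diagonal_heat[OF f t], of s 1 "-1"] by simp
    moreover have "AE x in \<mu>. 0 \<le> 1 - f x" using that by eventually_elim (simp add: less_eq_complex_def)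
    ultimately have "AE x in \<mu>. 0 \<le> heat s t (\<lambda>_. 1) x - heat s t f x" by (rule heat_nonneg[OF _ t])
    then show ?thesis using heat_one[OF t, of s] by eventually_elim (simp add: less_eq_complex_def)
  qed
qed

end

theorem theorem4p3:
  fixes \<mu> :: "'a::metric_space measure"
    and \<tau> :: "'a set \<Rightarrow> 'a \<times> 'a"
    and s :: real
  assumes "ultrametric_cantor_set TYPE('a)"
    and "equitising TYPE('a)"
    and "zeta_regular TYPE('a)"
    and "\<tau> \<in> choice_functions"
    and "connes_measure \<tau> \<mu>"
    and "supp \<mu> = UNIV"
    and "equity_measure \<mu>"
  shows "\<exists>T. strongly_continuous_semigroup \<mu> (sobolev s \<mu>) (sobolev_norm s \<mu>) T \<and>
           infinitesimal_generator (sobolev s \<mu>) (sobolev_norm s \<mu>) T =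
             {(f, g). f \<in> sobolev s \<mu> \<and> g \<in> sobolev s \<mu> \<and> (f, \<lambda>x. - g x) \<in> vp_graph s \<mu>} \<and>
           markov_property \<mu> (sobolev s \<mu>) T"
proof -
  have "prob_space \<mu>" "sets \<mu> = sets borel" using assms(5) by (simp_all add: connes_measure_def)
  then interpret cantor_measure \<mu>
    using assms(1,6) by (intro cantor_measure.intro ultrametric_cantor.intro cantor_measure_axioms.intro)
  show ?thesis using heat_semigroup heat_generator heat_markov by blast
qed

end
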